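(* Let $p$, $q$, $r$ be distinct primes with $p^2q^2<r$. Then every spectral set of the cyclic group $\mathbb{Z}_{p^2q^2r}$ is a tile. Consequently, $\mathbb{Z}_{p^2q^2r}$ is a Fuglede group.
   Context: For a finite abelian group $G$ (here cyclic, $\mathbb{Z}_n$, whose characters are $x\mapsto e^{2\pi i \lambda x/n}$, $\lambda\in\mathbb{Z}_n$), a nonempty set $S\subseteq G$ is spectral if there is a set $\Lambda$ of characters of $G$ whose restrictions to $S$ form an orthogonal basis of the space of complex functions on $S$ (then $|\Lambda|=|S|$ and $(S,\Lambda)$ is called a spectral pair). A set $S\subseteq G$ is a tile if there is $T\subseteq G$ such that every element of $G$ can be written uniquely as $s+t$ with $s\in S$, $t\in T$. A group $G$ is a Fuglede group if a subset of $G$ is spectral if and only if it is a tile. *)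

theory Defs
  imports Complex_Main "HOL-Computational_Algebra.Primes"
begin

text \<open>The cyclic group Z_n is modelled by the carrier {0..<n} of natural numbers
  with addition modulo n. The character indexed by lambda is
  x \<mapsto> exp(2 pi i lambda x / n).\<close>

definition zchar :: "nat \<Rightarrow> nat \<Rightarrow> nat \<Rightarrow> complex" where
  "zchar n lam x = exp (2 * of_real pi * \<i> * of_nat lam * of_nat x / of_nat n)"

definition inner_on :: "nat set \<Rightarrow> (nat \<Rightarrow> complex) \<Rightarrow> (nat \<Rightarrow> complex) \<Rightarrow> complex" where
  "inner_on S f g = (\<Sum>x\<in>S. f x * cnj (g x))"

definition spectral_pair :: "nat \<Rightarrow> nat set \<Rightarrow> nat set \<Rightarrow> bool" where
  "spectral_pair n S \<Lambda> \<longleftrightarrow>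
     S \<subseteq> {0..<n} \<and> \<Lambda> \<subseteq> {0..<n} \<and>
     (\<forall>l1\<in>\<Lambda>. \<forall>l2\<in>\<Lambda>. l1 \<noteq> l2 \<longrightarrow> inner_on S (zchar n l1) (zchar n l2) = 0) \<and>
     (\<forall>f :: nat \<Rightarrow> complex. \<exists>c :: nat \<Rightarrow> complex.
         \<forall>x\<in>S. f x = (\<Sum>l\<in>\<Lambda>. c l * zchar n l x))"

definition spectral :: "nat \<Rightarrow> nat set \<Rightarrow> bool" where
  "spectral n S \<longleftrightarrow> S \<subseteq> {0..<n} \<and> S \<noteq> {} \<and> (\<exists>\<Lambda>. spectral_pair n S \<Lambda>)"

definition tile :: "nat \<Rightarrow> nat set \<Rightarrow> bool" where
  "tile n S \<longleftrightarrow> S \<subseteq> {0..<n} \<and>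
     (\<exists>T \<subseteq> {0..<n}. \<forall>g\<in>{0..<n}. \<exists>!(s, t). s \<in> S \<and> t \<in> T \<and> (s + t) mod n = g)"

definition fuglede_cyclic :: "nat \<Rightarrow> bool" where
  "fuglede_cyclic n \<longleftrightarrow> (\<forall>S \<subseteq> {0..<n}. spectral n S \<longleftrightarrow> tile n S)"

end

theory Submission
  imports Defs "HOL-Number_Theory.Number_Theory" "HOL-Computational_Algebra.Polynomial"
begin

text \<open>Write $M = p^2q^2$ and split \<open>S \<subseteq> Z\<^bsub>Mr\<^esub>\<close> into its slices \<open>S\<^sub>j\<close> over the residues $j$
  modulo $r$. By Galois invariance of vanishing sums of roots of unity, a character that is
  nontrivial on the $r$-part annihilates $S$ iff its $M$-part has the same sum on every slice.

  Let \<open>(S, \<Lambda>)\<close> be a spectral pair. If \<open>|S| \<le> M < r\<close>, some slice is empty, so all slice sums vanish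
  and \<open>\<Lambda>\<close> is a spectrum of $S$ modulo $M$. If \<open>|S| > M\<close>, the slices of $S$ have equal size, and so do
  those of \<open>\<Lambda>\<close>; as $r > M$, some slice of \<open>\<Lambda>\<close> has only elements that recur modulo $M$ in another
  slice, and this slice is a spectrum modulo $M$ of every \<open>S\<^sub>j\<close>. It therefore suffices
  that all subsets of \<open>Z\<^bsub>M\<^esub>\<close> with a given spectrum have a common tiling complement. This follows
  from the conditions (T1) and (T2) of Coven and Meyerowitz, which are verified by counting: a zero
  at $p^iq^j$ makes a table of residue class counts a sum of two nonnegative integer marginals.

  Conversely, if \<open>S \<oplus> T = Z\<^bsub>Mr\<^esub>\<close>, then $r$ divides only one of $|S|$ and $|T|$; the other set has an empty slice
  and tiles \<open>Z\<^bsub>M\<^esub>\<close> with every slice of the first one. The same counting lemmas give (T2) for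
  tilings of \<open>Z\<^bsub>M\<^esub>\<close>, hence Laba's standard spectrum, which depends only on the complement.\<close>

section \<open>Galois invariance of vanishing sums of roots of unity\<close>

text \<open>The complement has to be common because the slices of \<open>S\<close> are completed
  simultaneously; complements chosen slice by slice cannot be glued. Hence the exponents in (T1) and
  (T2) must be extracted from the spectrum and the common size \<open>k\<close>, not from a single
  member. The engine modulo \<open>p^2 q^2\<close> is a tension between packing and zeros. An order
  of differences that the spectrum lacks lets it pack against a standard set, which bounds
  \<open>k\<close> from above; an order that it has is a zero of every member, which forces
  divisibility or a lower bound for the same \<open>k\<close>. When the bounds meet, the packing is
  a tiling and yields new zeros wherever the standard set has none. Symmetry of spectral pairs then
  carries the information back to the members. Only orders \<open>p^i q^j\<close> with
  \<open>i, j\<close> at most 2 occur, so a finite case analysis remains, organised by the pure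
  orders (\<open>i = 0\<close> or \<open>j = 0\<close>). The obstacle is the mixed orders: a zero
  there does not by itself make the size divisible by \<open>p\<close> or \<open>q\<close>. The
  marginals show that on a small set it nevertheless implies a pure zero, or else the size is
  exactly a prime or its square.\<close>

abbreviation ipoly :: "int poly \<Rightarrow> complex \<Rightarrow> complex" where
  "ipoly f z \<equiv> poly (map_poly of_int f) z"

lemma ipoly_pCons: "ipoly (pCons a f) z = of_int a + z * ipoly f z"
  by (simp add: map_poly_pCons)

lemma ipoly_add: "ipoly (f + g) z = ipoly f z + ipoly g z"
proof -
  have "map_poly of_int (f + g) = (map_poly of_int f + map_poly of_int g :: complex poly)"
    by (intro poly_eqI) (simp add: coeff_map_poly)
  thus ?thesis by simp
qed

lemma ipoly_smult: "ipoly (smult c f) z = of_int c * ipoly f z"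
  by (simp add: map_poly_smult)

lemma ipoly_minus: "ipoly (f - g) z = ipoly f z - ipoly g z"
  using ipoly_add[of "f - g" g z] by simp

lemma ipoly_mult: "ipoly (f * g) z = ipoly f z * ipoly g z"
  by (induction f) (simp_all add: ipoly_pCons ipoly_add ipoly_smult algebra_simps)

lemma ipoly_power: "ipoly (f ^ n) z = ipoly f z ^ n"
  by (induction n) (simp_all add: ipoly_mult)

lemma ipoly_monom: "ipoly (monom c n) z = of_int c * z ^ n"
  by (simp add: map_poly_monom poly_monom)

lemma ipoly_sum: "ipoly (\<Sum>x\<in>A. f x) z = (\<Sum>x\<in>A. ipoly (f x) z)"
  by (induction A rule: infinite_finite_induct) (simp_all add: ipoly_add)

lemma ipoly_pcompose_monom: "ipoly (pcompose f (monom 1 l)) z = ipoly f (z ^ l)"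
  by (induction f) (simp_all add: pcompose_pCons ipoly_add ipoly_mult ipoly_pCons ipoly_monom)

text \<open>Gauss's lemma at work: pseudo-division stays over the integers at the cost of a factor
  \<open>a\<close>, minimality kills the remainder, and as \<open>g\<close> is primitive,
  \<open>a\<close> divides the content of the quotient and cancels.\<close>

lemma ipoly_minimal_dvd:
  assumes g: "g \<noteq> 0" "content g = 1" "ipoly g z = 0"
    and minimal: "\<And>f. f \<noteq> 0 \<Longrightarrow> ipoly f z = 0 \<Longrightarrow> degree g \<le> degree f"
    and f: "ipoly f z = 0"
  shows "g dvd f"
proof -
  from pseudo_mod[OF g(1), of f] obtain a q where aq: "a \<noteq> 0" "smult a f = g * q + pseudo_mod f g"
    and deg: "pseudo_mod f g = 0 \<or> degree (pseudo_mod f g) < degree g" by blast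
  have "ipoly (smult a f) z = ipoly (g * q + pseudo_mod f g) z" using aq(2) by simp
  hence "ipoly (pseudo_mod f g) z = 0"
    by (simp only: ipoly_smult ipoly_add ipoly_mult f g(3)) simp
  with deg minimal[of "pseudo_mod f g"] have "pseudo_mod f g = 0" by fastforce
  with aq have *: "smult a f = g * q" by simp
  hence "content (smult a f) = content q" using g(2) by (simp add: content_mult)
  hence "a dvd content q" by (simp only: content_smult flip: \<open>content (smult a f) = content q\<close>) simp
  hence "[:a:] dvd q" by (simp add: const_poly_dvd_iff_dvd_content)
  then obtain q' where "q = smult a q'" by (auto elim!: dvdE)
  with * have "smult a f = smult a (g * q')" by simp
  hence "smult a (f - g * q') = 0" by (simp add: smult_diff_right)
  with aq(1) have "f = g * q'" by simp
  thus ?thesis by simp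
qed

text \<open>Modulo \<open>l\<close> the \<open>l\<close>-th power map is additive and fixes
  constants. The induction splits off the constant coefficient: divisibility of the middle binomial
  coefficients handles the sum, Fermat's theorem the constant.\<close>

lemma prime_dvd_frobenius_int_poly:
  assumes "prime l"
  shows "[:int l:] dvd pcompose h (monom 1 l) - h ^ l"
proof (induction h)
  case 0
  show ?case using prime_gt_0_nat[OF assms] by (simp add: zero_power)
next
  case (pCons a h)
  have lpos: "l > 0" using assms by (rule prime_gt_0_nat)
  have binom: "[:int l:] dvd (x + y) ^ l - (x ^ l + y ^ l)" for x y :: "int poly"
  proof -
    have "{..l} = insert 0 (insert l {1..<l})" using lpos by auto
    hence "(x + y) ^ l = x ^ l + y ^ l + (\<Sum>k\<in>{1..<l}. of_nat (l choose k) * x ^ k * y ^ (l - k))"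
      using lpos by (simp add: binomial_ring sum.insert algebra_simps)
    moreover have "[:int l:] dvd (\<Sum>k\<in>{1..<l}. of_nat (l choose k) * x ^ k * y ^ (l - k))"
    proof (intro dvd_sum)
      fix k assume "k \<in> {1..<l}"
      hence "l dvd (l choose k)" using assms by (intro dvd_choose_prime) auto
      hence "[:int l:] dvd of_nat (l choose k)" by (simp add: of_nat_poly)
      thus "[:int l:] dvd of_nat (l choose k) * x ^ k * y ^ (l - k)" by (simp add: mult.assoc)
    qed
    ultimately show ?thesis by simp
  qed
  have fermat: "int l dvd a ^ l - a"
  proof (cases "int l dvd a")
    case True
    thus ?thesis using lpos by (intro dvd_diff) (simp_all add: dvd_power_same dvd_trans[OF _ dvd_power])
  next
    case False
    define b where "b = nat (a mod int l)"
    have b: "int b = a mod int l" using lpos by (simp add: b_def)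
    have "\<not> l dvd b" using False b by (metis dvd_mod_iff int_dvd_int_iff dvd_refl)
    hence "[b ^ (l - 1) = 1] (mod l)" using assms by (intro fermat_theorem)
    hence "[int b ^ (l - 1) = 1] (mod int l)" by (metis cong_int_iff of_nat_1 of_nat_power)
    moreover have "[int b ^ (l - 1) = a ^ (l - 1)] (mod int l)"
      unfolding b by (intro cong_pow) simp
    ultimately have "[a ^ (l - 1) = 1] (mod int l)" using cong_sym cong_trans by blast
    hence "[a * a ^ (l - 1) = a * 1] (mod int l)" by (rule cong_scalar_left)
    thus ?thesis using lpos by (simp add: cong_iff_dvd_diff flip: power_Suc)
  qed
  obtain k where k: "pcompose h (monom 1 l) = h ^ l + [:int l:] * k"
    using pCons.IH by (auto simp: algebra_simps elim!: dvdE)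
  have pc: "pCons a h = [:a:] + monom 1 1 * h" by (simp add: monom_altdef)
  have "[:int l:] dvd pCons a h ^ l - ([:a:] ^ l + (monom 1 1 * h) ^ l)"
    unfolding pc by (rule binom)
  moreover have "pcompose (pCons a h) (monom 1 l) - pCons a h ^ l
     = [:int l:] * (monom 1 l * k) - [:a ^ l - a:]
        - (pCons a h ^ l - ([:a:] ^ l + (monom 1 1 * h) ^ l))"
    by (simp add: pcompose_pCons k power_mult_distrib monom_power algebra_simps poly_const_pow)
  moreover have "[:int l:] dvd [:a ^ l - a:]" using fermat by simp
  ultimately show ?case by (simp only: dvd_diff dvd_triv_left)
qed

text \<open>For \<open>g\<close> monic up to sign and of positive degree, 1 belongs to a basis of
  Z[x]/(g) over Z, so divisibility of an integer by \<open>c\<close> in that ring descends to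
  Z.\<close>

lemma int_multiple_in_monic_ideal:
  assumes dvd: "g dvd [:a:] - smult c v" and "lead_coeff g = 1 \<or> lead_coeff g = -1" "degree g > 0"
  shows "c dvd (a::int)"
proof -
  obtain w where w: "[:a:] - smult c v = g * w" using dvd by (auto elim: dvdE)
  have "c dvd coeff w i" for i
  proof (rule ccontr)
    assume "\<not> c dvd coeff w i"
    define B where "B = {i. \<not> c dvd coeff w i}"
    have "B \<subseteq> {..degree w}" unfolding B_def using le_degree by force
    hence fin: "finite B" by (rule finite_subset) simp
    \<comment> \<open>The highest coefficient of \<open>w\<close> not divisible by \<open>c\<close>.
      In degree \<open>degree g + m\<close> it is the only contribution to \<open>g * w\<close> that
      can survive modulo \<open>c\<close>; that degree is positive, so the constant \<open>a\<close>
      does not interfere.\<close>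
    define m where "m = Max B"
    have mB: "m \<in> B" unfolding m_def using fin \<open>\<not> c dvd coeff w i\<close> by (intro Max_in) (auto simp: B_def)
    have gt: "c dvd coeff w k" if "k > m" for k
    proof (rule ccontr)
      assume "\<not> c dvd coeff w k"
      hence "k \<in> B" by (simp add: B_def)
      with fin have "k \<le> m" unfolding m_def by (rule Max_ge)
      thus False using that by simp
    qed
    have "coeff (g * w) (degree g + m) = (\<Sum>k\<le>degree g + m. coeff g k * coeff w (degree g + m - k))"
      by (simp add: coeff_mult)
    also have "\<dots> = lead_coeff g * coeff w m + (\<Sum>k\<in>{..degree g + m} - {degree g}. coeff g k * coeff w (degree g + m - k))"
      by (subst sum.remove[of _ "degree g"]) auto
    finally have 1: "coeff (g * w) (degree g + m) = \<dots>" .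
    have "c dvd (\<Sum>k\<in>{..degree g + m} - {degree g}. coeff g k * coeff w (degree g + m - k))"
    proof (intro dvd_sum)
      fix k assume "k \<in> {..degree g + m} - {degree g}"
      thus "c dvd coeff g k * coeff w (degree g + m - k)"
        using gt[of "degree g + m - k"] by (cases "k < degree g") (auto simp: coeff_eq_0)
    qed
    moreover have "c dvd coeff (g * w) (degree g + m)"
      using assms(3) unfolding w[symmetric] by (simp add: coeff_pCons split: nat.splits)
    ultimately have "c dvd lead_coeff g * coeff w m" unfolding 1 by (simp only: dvd_add_left_iff)
    hence "c dvd coeff w m" using assms(2) by auto
    thus False using mB by (simp add: B_def)
  qed
  hence "[:c:] dvd w" by (simp add: const_poly_dvd_iff)
  hence "[:c:] dvd [:a:] - smult c v" by (simp add: w)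
  moreover have "[:c:] dvd smult c v" by (simp add: const_poly_dvd_iff)
  ultimately have "[:c:] dvd [:a:] - smult c v + smult c v" by (rule dvd_add)
  hence "[:c:] dvd [:a:]" by simp
  thus ?thesis by simp
qed

text \<open>The classical irreducibility argument for cyclotomic polynomials. Let \<open>g\<close>
  be the primitive minimal polynomial of \<open>z\<close> and \<open>x^n - 1 = g h\<close>. If
  \<open>z^l\<close> were a root of \<open>h\<close>, the Frobenius congruence would make
  \<open>h(z)^l\<close> a multiple of \<open>l\<close> in Z[z]. Differentiating at \<open>z\<close>
  shows that \<open>h(z)\<close> divides \<open>n\<close> there, so \<open>l\<close> would divide
  \<open>n^l\<close>.\<close>

lemma ipoly_root_power_prime:
  assumes n: "n > 0" and z: "z ^ n = 1" and f: "ipoly f z = 0"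
    and l: "prime l" "\<not> l dvd n"
  shows "ipoly f (z ^ l) = 0"
proof -
  define F :: "int poly" where "F = monom 1 n - 1"
  have ipF: "ipoly F y = y ^ n - 1" for y
    by (simp add: F_def ipoly_minus ipoly_monom)
  have F0: "F \<noteq> 0"
  proof
    assume "F = 0"
    hence "coeff F n = 0" by simp
    thus False using n by (simp add: F_def)
  qed
  have lcF: "lead_coeff F = 1"
  proof -
    have "degree (monom 1 n + (- 1) :: int poly) = n"
      using n by (subst degree_add_eq_left) (auto simp: degree_monom_eq)
    hence "degree F = n" by (simp add: F_def)
    thus ?thesis using n by (simp add: F_def)
  qed
  define R where "R = (\<lambda>g. g \<noteq> 0 \<and> ipoly g z = 0)"
  have "R F" using F0 z by (simp add: R_def ipF)
  define g0 where "g0 = arg_min degree R"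
  have g0: "R g0" "\<And>f. R f \<Longrightarrow> degree g0 \<le> degree f"
    using arg_min_nat_lemma[of R F degree] \<open>R F\<close> by (auto simp: g0_def)
  define g where "g = primitive_part g0"
  have g: "g \<noteq> 0" "content g = 1" using g0(1) by (auto simp: g_def R_def)
  have "ipoly (smult (content g0) g) z = 0" using g0(1) by (simp add: g_def R_def)
  hence gz: "ipoly g z = 0" using g0(1) by (simp only: ipoly_smult) (simp add: R_def)
  have dvd: "g dvd f" if "ipoly f z = 0" for f
    by (rule ipoly_minimal_dvd[OF g gz _ that]) (use g0(2) in \<open>auto simp: g_def R_def\<close>)
  obtain h where h: "F = g * h" using dvd[of F] z by (auto simp: ipF elim: dvdE)
  obtain f' where f': "f = g * f'" using dvd[OF f] by (auto elim: dvdE)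
  have lc: "lead_coeff g = 1 \<or> lead_coeff g = -1"
    using lcF by (simp add: h lead_coeff_mult zmult_eq_1_iff) auto
  have degg: "degree g > 0"
  proof (rule ccontr)
    assume "\<not> degree g > 0"
    then obtain c where "g = [:c:]" by (auto elim: degree_eq_zeroE)
    with g gz show False by (simp add: map_poly_pCons)
  qed
  have "ipoly F (z ^ l) = 0" using z by (simp add: ipF) (metis power_mult mult.commute power_one)
  hence "ipoly g (z ^ l) = 0 \<or> ipoly h (z ^ l) = 0" by (simp add: h ipoly_mult)
  thus ?thesis
  proof
    assume "ipoly g (z ^ l) = 0"
    thus ?thesis by (simp add: f' ipoly_mult)
  next
    assume hz: "ipoly h (z ^ l) = 0"
    obtain w where w: "pcompose h (monom 1 l) - h ^ l = [:int l:] * w"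
      using prime_dvd_frobenius_int_poly[OF l(1), of h] by (auto elim: dvdE)
    have "ipoly (pcompose h (monom 1 l) - h ^ l) z = ipoly ([:int l:] * w) z" by (simp only: w)
    hence "- (ipoly h z ^ l) = of_nat l * ipoly w z"
      by (simp only: ipoly_minus ipoly_pcompose_monom ipoly_power hz ipoly_mult)
         (simp add: map_poly_pCons)
    hence hl: "ipoly h z ^ l = - of_nat l * ipoly w z" by (metis minus_minus mult_minus_left)
    have "pderiv F = monom (int n) (n - 1)" by (simp add: F_def pderiv_diff pderiv_monom)
    hence "ipoly (monom (int n) (n - 1)) z = ipoly (g * pderiv h + h * pderiv g) z"
      by (simp only: h pderiv_mult)
    hence "of_nat n * z ^ (n - 1) = ipoly h z * ipoly (pderiv g) z"
      by (simp add: ipoly_monom ipoly_add ipoly_mult gz)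
    hence "of_nat n * (z ^ (n - 1) * z) = ipoly h z * (ipoly (pderiv g) z * z)"
      by (simp only: mult.assoc[symmetric])
    moreover have "z ^ (n - 1) * z = 1" using n z by (metis Suc_diff_1 power_Suc2)
    ultimately have "of_nat n = ipoly h z * (ipoly (pderiv g) z * z)" by (simp only: mult_1_right)
    hence "of_nat n ^ l = ipoly h z ^ l * (ipoly (pderiv g) z * z) ^ l"
      by (simp add: power_mult_distrib)
    hence nl: "of_nat n ^ l = - of_nat l * ipoly w z * (ipoly (pderiv g) z * z) ^ l" by (simp add: hl)
    define v where "v = - w * (pderiv g * monom 1 1) ^ l"
    have wneg: "ipoly (- w) z = - ipoly w z" using ipoly_minus[of 0 w z] by simp
    have "ipoly ([:int n ^ l:] - smult (int l) v) z = 0"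
      by (simp only: ipoly_minus ipoly_smult v_def ipoly_mult ipoly_power ipoly_monom wneg)
         (simp add: nl map_poly_pCons)
    hence "g dvd [:int n ^ l:] - smult (int l) v" by (rule dvd)
    hence "int l dvd int n ^ l" using lc degg by (rule int_multiple_in_monic_ideal)
    hence "l dvd n ^ l" by (simp flip: of_nat_power)
    with l have False using prime_dvd_power_nat by blast
    thus ?thesis ..
  qed
qed

text \<open>The root \<open>z\<close> stays arbitrary in the induction, because removing a prime
  factor of \<open>u\<close> replaces \<open>z\<close> by another \<open>n\<close>-th root of
  unity.\<close>

lemma ipoly_root_power_coprime:
  assumes "n > 0" "z ^ n = 1" "ipoly f z = 0" "coprime u n"
  shows "ipoly f (z ^ u) = 0"
  using assms(2-4)
proof (induction u arbitrary: z rule: prime_divisors_induct)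
  case zero
  hence "n = 1" by simp
  with zero assms show ?case by simp
next
  case (unit u)
  thus ?case by simp
next
  case (factor l u)
  have "\<not> l dvd n" using factor.hyps factor.prems(3) by (metis coprime_mult_left_iff prime_imp_coprime_nat coprime_absorb_left not_prime_unit)
  hence "ipoly f (z ^ l) = 0"
    using ipoly_root_power_prime[OF assms(1) factor.prems(1,2) factor.hyps] by blast
  moreover have "(z ^ l) ^ n = 1" using factor.prems(1) by (metis power_mult mult.commute power_one)
  moreover have "coprime u n" using factor.prems(3) by simp
  ultimately have "ipoly f ((z ^ l) ^ u) = 0" by (intro factor.IH)
  thus ?case by (simp add: power_mult)
qed

section \<open>Exponential sums with integer frequencies\<close>

definition ru :: "nat \<Rightarrow> int \<Rightarrow> complex" where
  "ru n a = cis (2 * pi * of_int a / of_nat n)"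

lemma ru_add: "ru n (a + b) = ru n a * ru n b"
  by (simp add: ru_def cis_mult add_divide_distrib distrib_left)

lemma ru_0 [simp]: "ru n 0 = 1" by (simp add: ru_def)

lemma ru_minus: "ru n (- a) = cnj (ru n a)"
  by (simp add: ru_def cis_cnj)

lemma ru_power: "ru n a ^ k = ru n (int k * a)"
  by (simp add: ru_def DeMoivre mult_ac)

lemma norm_ru [simp]: "norm (ru n a) = 1" by (simp add: ru_def)

lemma ru_nonzero [simp]: "ru n a \<noteq> 0" using norm_ru[of n a] by (metis norm_zero zero_neq_one)

lemma ru_eq_1_iff: assumes "n > 0" shows "ru n a = 1 \<longleftrightarrow> int n dvd a"
proof
  assume "int n dvd a"
  then obtain k where "a = int n * k" by (auto elim: dvdE)
  hence "ru n a = cis (2 * pi * of_int k)" using assms by (simp add: ru_def mult.assoc)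
  thus "ru n a = 1" by (simp add: cis_multiple_2pi)
next
  assume "ru n a = 1"
  hence "cos (2 * pi * of_int a / of_nat n) = 1" by (simp add: ru_def complex_eq_iff)
  then obtain k :: int where "2 * pi * of_int a / of_nat n = of_int k * 2 * pi"
    by (auto simp: cos_one_2pi_int)
  hence "of_int a = (of_int k * of_nat n :: real)" using assms by (simp add: field_simps)
  hence "real_of_int a = real_of_int (k * int n)" by simp
  hence "a = k * int n" by (simp only: of_int_eq_iff)
  thus "int n dvd a" by simp
qed

lemma ru_cong: assumes "n > 0" "[a = b] (mod int n)" shows "ru n a = ru n b"
proof -
  have "ru n (a - b) = 1" using assms by (simp add: ru_eq_1_iff cong_iff_dvd_diff)
  thus ?thesis using ru_add[of n "a - b" b] by simp
qed

lemma ru_scale: assumes "k > 0" shows "ru (k * n) (int k * a) = ru n a"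
  using assms by (simp add: ru_def mult.assoc)

text \<open>Reducing the exponents modulo \<open>n\<close> turns the sum into an integer polynomial
  evaluated at \<open>ru n 1\<close>; this is why the weights are integers.\<close>

lemma galois_vanishing_sum:
  assumes n: "n > 0" and u: "coprime u (int n)"
    and sum0: "(\<Sum>x\<in>A. of_int (w x) * ru n (f x)) = 0"
  shows "(\<Sum>x\<in>A. of_int (w x) * ru n (u * f x)) = 0"
proof -
  define P where "P = (\<Sum>x\<in>A. monom (w x) (nat (f x mod int n)))"
  define v where "v = nat (u mod int n)"
  have v: "int v = u mod int n" using n by (simp add: v_def)
  have red: "ru n 1 ^ nat (f x mod int n) = ru n (f x)" for x
    unfolding ru_power using n by (intro ru_cong) (simp_all add: cong_def)
  have P: "ipoly P y = (\<Sum>x\<in>A. of_int (w x) * y ^ nat (f x mod int n))" for y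
    by (simp add: P_def ipoly_sum ipoly_monom)
  have 1: "ru n 1 ^ n = 1" unfolding ru_power using n by (simp add: ru_eq_1_iff)
  have 2: "coprime v n" using u v by (metis coprime_int_iff coprime_mod_left_iff n of_nat_0_less_iff less_irrefl)
  have "ipoly P (ru n 1 ^ v) = 0"
    by (rule ipoly_root_power_coprime[OF n 1 _ 2]) (simp add: P red sum0)
  moreover have "(ru n 1 ^ v) ^ nat (f x mod int n) = ru n (u * f x)" for x
  proof -
    have "(ru n 1 ^ v) ^ nat (f x mod int n) = ru n (f x) ^ v"
      by (metis power_mult mult.commute red)
    also have "\<dots> = ru n (int v * f x)" by (rule ru_power)
    also have "\<dots> = ru n (u * f x)"
      unfolding v using n by (intro ru_cong cong_mult) (simp_all add: cong_def)
    finally show ?thesis .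
  qed
  ultimately show ?thesis by (simp add: P)
qed

lemma galois_vanishing_sum_iff:
  assumes n: "n > 0" and u: "coprime u (int n)"
  shows "(\<Sum>x\<in>A. of_int (w x) * ru n (u * f x)) = 0 \<longleftrightarrow> (\<Sum>x\<in>A. of_int (w x) * ru n (f x)) = 0"
proof
  assume *: "(\<Sum>x\<in>A. of_int (w x) * ru n (u * f x)) = 0"
  obtain v where v: "[u * v = 1] (mod int n)" using cong_solve_coprime_int[OF u] by blast
  hence "coprime v (int n)" by (metis coprime_iff_invertible_int mult.commute)
  hence "(\<Sum>x\<in>A. of_int (w x) * ru n (v * (u * f x))) = 0"
    using galois_vanishing_sum[OF n _ *] by blast
  moreover have "ru n (v * (u * f x)) = ru n (f x)" for x
  proof (rule ru_cong[OF n])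
    have "[u * v * f x = 1 * f x] (mod int n)" using v by (rule cong_scalar_right)
    thus "[v * (u * f x) = f x] (mod int n)" by (simp add: mult_ac)
  qed
  ultimately show "(\<Sum>x\<in>A. of_int (w x) * ru n (f x)) = 0" by simp
next
  assume "(\<Sum>x\<in>A. of_int (w x) * ru n (f x)) = 0"
  thus "(\<Sum>x\<in>A. of_int (w x) * ru n (u * f x)) = 0" by (rule galois_vanishing_sum[OF n u])
qed

lemma ru_combine: assumes "m > 0" "k > 0" shows "ru m a * ru k b = ru (m * k) (a * int k + b * int m)"
  using assms by (simp add: ru_def cis_mult field_simps)

lemma sum_ru: assumes "n > 0" shows "(\<Sum>v<n. ru n (int v * a)) = (if int n dvd a then of_nat n else 0)"
proof (cases "int n dvd a")
  case True
  hence "ru n (int v * a) = 1" for v using assms by (simp add: ru_eq_1_iff)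
  with True show ?thesis by simp
next
  case False
  hence "ru n a \<noteq> 1" using assms by (simp add: ru_eq_1_iff)
  moreover have "ru n a ^ n = 1" unfolding ru_power using assms by (simp add: ru_eq_1_iff)
  ultimately have "(\<Sum>v<n. ru n a ^ v) = 0" by (simp add: geometric_sum)
  with False show ?thesis by (simp add: ru_power)
qed

text \<open>Galois invariance on the \<open>p\<close>-part alone shows that the transform
  \<open>G\<close> vanishes at every frequency prime to \<open>p\<close>. In the Fourier inversion
  for a class sum only multiples of \<open>p\<close> survive, and these see \<open>y\<close> only
  modulo \<open>p ^ (i - 1)\<close>.\<close>

lemma vanishing_sum_prime_power:
  fixes f g :: "'a \<Rightarrow> int"
  assumes p: "prime p" "i > 0" and m: "m > 0" "coprime m p" and b: "\<not> int p dvd b" and A: "finite A"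
    and sum0: "(\<Sum>x\<in>A. of_int (w x) * (ru m (f x) * ru (p ^ i) (b * g x))) = 0"
    and y: "[y = y'] (mod int (p ^ (i - 1)))"
  shows "(\<Sum>x\<in>{x\<in>A. [g x = y] (mod int (p ^ i))}. of_int (w x) * ru m (f x)) =
         (\<Sum>x\<in>{x\<in>A. [g x = y'] (mod int (p ^ i))}. of_int (w x) * ru m (f x))"
proof -
  define n where "n = p ^ i"
  have n: "n > 0" using p by (simp add: n_def prime_gt_0_nat)
  have cop_pn: "coprime v (int n)" if "\<not> int p dvd v" for v
    using that p prime_imp_coprime[of "int p" v] by (simp add: n_def coprime_commute)
  have cop_mn: "coprime (int m) (int n)" using m by (simp add: n_def)
  define G where "G = (\<lambda>v. \<Sum>x\<in>A. of_int (w x) * (ru m (f x) * ru n (v * g x)))"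
  have G0: "G v = 0" if v: "\<not> int p dvd v" for v
  proof -
    obtain b' where b': "[b * b' = 1] (mod int n)"
      using cong_solve_coprime_int[OF cop_pn[OF b]] by blast
    \<comment> \<open>The automorphism given by \<open>u\<close> fixes the \<open>m\<close>-th roots
      of unity and carries the frequency \<open>b\<close> to \<open>v\<close> on the
      \<open>p\<close>-part.\<close>
    obtain u where u: "[u = 1] (mod int m)" "[u = v * b'] (mod int n)"
      using binary_chinese_remainder_int[OF cop_mn] by blast
    have "[u * b = v * b' * b] (mod int n)" using u(2) by (rule cong_scalar_right)
    moreover have "[v * b' * b = v * 1] (mod int n)"
      using b' cong_scalar_left[of "b * b'" 1 "int n" v] by (simp add: mult_ac)
    ultimately have ub: "[u * b = v] (mod int n)" using cong_trans by fastforce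
    have cu: "coprime u (int (m * n))"
    proof -
      have "coprime u (int m)" using u(1) by (metis cong_imp_coprime cong_sym coprime_1_left)
      moreover have "coprime (u * b) (int n)" using ub cop_pn[OF v] by (metis cong_imp_coprime cong_sym)
      ultimately show ?thesis by simp
    qed
    have "(\<Sum>x\<in>A. of_int (w x) * ru (m * n) (f x * int n + b * g x * int m)) = 0"
      using sum0 m n by (simp add: ru_combine n_def)
    hence "(\<Sum>x\<in>A. of_int (w x) * ru (m * n) (u * (f x * int n + b * g x * int m))) = 0"
      using m n by (intro galois_vanishing_sum[OF _ cu]) auto
    moreover have "ru (m * n) (u * (f x * int n + b * g x * int m)) = ru m (f x) * ru n (v * g x)" for x
    proof -
      have "ru m (f x) = ru m (u * f x)"
        using m u(1) cong_scalar_right[of u 1 "int m" "f x"] by (intro ru_cong) (auto simp: cong_sym)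
      moreover have "ru n (v * g x) = ru n (u * b * g x)"
        using n ub cong_scalar_right[of "u * b" v "int n" "g x"] by (intro ru_cong) (auto simp: cong_sym)
      ultimately show ?thesis using m n by (simp add: ru_combine algebra_simps)
    qed
    ultimately show ?thesis by (simp add: G_def)
  qed
  have inv: "of_nat n * (\<Sum>x\<in>{x\<in>A. [g x = y] (mod int n)}. of_int (w x) * ru m (f x)) =
     (\<Sum>v<n. ru n (- (int v * y)) * G (int v))" for y
  proof -
    have "(\<Sum>v<n. ru n (- (int v * y)) * G (int v)) =
      (\<Sum>v<n. \<Sum>x\<in>A. of_int (w x) * ru m (f x) * ru n (int v * (g x - y)))"
      by (simp add: G_def sum_distrib_left right_diff_distrib flip: ru_add)
         (simp add: mult_ac algebra_simps flip: ru_add)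
    also have "\<dots> = (\<Sum>x\<in>A. of_int (w x) * ru m (f x) * (\<Sum>v<n. ru n (int v * (g x - y))))"
      by (subst sum.swap) (simp add: sum_distrib_left)
    also have "\<dots> = (\<Sum>x\<in>A. if [g x = y] (mod int n) then of_int (w x) * ru m (f x) * of_nat n else 0)"
      by (intro sum.cong refl) (simp add: sum_ru[OF n] cong_iff_dvd_diff)
    also have "\<dots> = (\<Sum>x\<in>{x\<in>A. [g x = y] (mod int n)}. of_int (w x) * ru m (f x) * of_nat n)"
      using A by (subst sum.inter_filter) auto
    finally show ?thesis by (simp add: sum_distrib_left mult_ac)
  qed
  have "(\<Sum>v<n. ru n (- (int v * y)) * G (int v)) = (\<Sum>v<n. ru n (- (int v * y')) * G (int v))"
  proof (intro sum.cong refl)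
    fix v
    show "ru n (- (int v * y)) * G (int v) = ru n (- (int v * y')) * G (int v)"
    proof (cases "int p dvd int v")
      case True
      have "int (p ^ (i - 1)) dvd y - y'" using y by (simp add: cong_iff_dvd_diff)
      hence "int p * int (p ^ (i - 1)) dvd int v * (y - y')" using True by (rule mult_dvd_mono[rotated])
      hence "int n dvd int v * (y - y')" using p by (simp add: n_def flip: power_Suc)
      hence "[- (int v * y) = - (int v * y')] (mod int n)"
        by (metis cong_iff_dvd_diff cong_minus_minus_iff right_diff_distrib')
      thus ?thesis using ru_cong[OF n] by simp
    next
      case False
      thus ?thesis by (simp add: G0)
    qed
  qed
  hence "of_nat n * (\<Sum>x\<in>{x\<in>A. [g x = y] (mod int n)}. of_int (w x) * ru m (f x)) =
     of_nat n * (\<Sum>x\<in>{x\<in>A. [g x = y'] (mod int n)}. of_int (w x) * ru m (f x))"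
    by (simp only: inv)
  with n show ?thesis unfolding n_def[symmetric] by simp
qed

text \<open>Shifting the summation variable by \<open>p ^ (i - 1)\<close> preserves \<open>h\<close>
  but multiplies the sum by a nontrivial \<open>p\<close>-th root of unity.\<close>

lemma sum_periodic_ru:
  assumes p: "prime p" "i > 0" and b: "\<not> int p dvd b"
    and h: "\<And>y y'. y < p ^ i \<Longrightarrow> y' < p ^ i \<Longrightarrow> y mod p ^ (i - 1) = y' mod p ^ (i - 1) \<Longrightarrow> h y = h y'"
  shows "(\<Sum>y<p ^ i. h y * ru (p ^ i) (b * int y)) = 0"
proof -
  define n s where "n = p ^ i" and "s = p ^ (i - 1)"
  have n: "n > 0" and s: "s > 0" using p by (auto simp: n_def s_def prime_gt_0_nat)
  have ns: "n = p * s" using p by (simp add: n_def s_def flip: power_Suc)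
  have bij: "bij_betw (\<lambda>y. (y + s) mod n) {..<n} {..<n}"
  proof (rule bij_betw_byWitness[where f' = "\<lambda>y. (y + (n - s)) mod n"])
    have "s \<le> n" unfolding ns using p by (simp add: prime_gt_0_nat Suc_leI)
    thus "\<forall>a\<in>{..<n}. ((a + s) mod n + (n - s)) mod n = a"
      by (intro ballI) (simp only: mod_add_left_eq, simp)
    show "\<forall>a\<in>{..<n}. ((a + (n - s)) mod n + s) mod n = a"
      using \<open>s \<le> n\<close> by (intro ballI) (simp only: mod_add_left_eq, simp)
  qed (use n in auto)
  have "(\<Sum>y<n. h y * ru n (b * int y)) = (\<Sum>y<n. h ((y + s) mod n) * ru n (b * int ((y + s) mod n)))"
    by (rule sum.reindex_bij_betw[OF bij, symmetric])
  also have "\<dots> = (\<Sum>y<n. h y * ru n (b * int y) * ru n (b * int s))"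
  proof (intro sum.cong refl)
    fix y assume "y \<in> {..<n}"
    moreover have "(y + s) mod n mod s = y mod s" unfolding ns by (simp add: mod_mod_cancel)
    ultimately have "h ((y + s) mod n) = h y" using n by (intro h) (auto simp: n_def s_def)
    moreover have "ru n (b * int ((y + s) mod n)) = ru n (b * int y + b * int s)"
    proof (rule ru_cong[OF n])
      have "[b * int ((y + s) mod n) = b * int (y + s)] (mod int n)"
        by (intro cong_mult) (simp_all add: cong_def of_nat_mod)
      thus "[b * int ((y + s) mod n) = b * int y + b * int s] (mod int n)" by (simp add: distrib_left)
    qed
    ultimately show "h ((y + s) mod n) * ru n (b * int ((y + s) mod n)) = h y * ru n (b * int y) * ru n (b * int s)"
      by (simp add: ru_add)
  qed
  also have "\<dots> = (\<Sum>y<n. h y * ru n (b * int y)) * ru n (b * int s)" by (simp add: sum_distrib_right)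
  finally have "(\<Sum>y<n. h y * ru n (b * int y)) * (ru n (b * int s) - 1) = 0" by (simp add: algebra_simps)
  moreover have "ru n (b * int s) \<noteq> 1"
    using n b s by (simp add: ru_eq_1_iff) (simp add: ns)
  ultimately show ?thesis unfolding n_def by simp
qed

section \<open>Zeros of mask polynomials as counting conditions\<close>

text \<open>The mask polynomial of \<^term>\<open>S\<close> vanishes at a primitive \<open>d\<close>-th root of unity; by Galois
  invariance it then vanishes at all of them.\<close>

definition zr :: "nat set \<Rightarrow> nat \<Rightarrow> bool" where
  "zr S d \<longleftrightarrow> (\<Sum>x\<in>S. ru d (int x)) = 0"

definition cnt :: "nat set \<Rightarrow> nat \<Rightarrow> nat \<Rightarrow> nat" where
  "cnt S m y = card {x\<in>S. x mod m = y}"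

definition cnt2 :: "nat set \<Rightarrow> nat \<Rightarrow> nat \<Rightarrow> nat \<Rightarrow> nat \<Rightarrow> nat" where
  "cnt2 S m n y z = card {x\<in>S. x mod m = y \<and> x mod n = z}"

lemma sum_mod_classes:
  fixes S :: "nat set"
  assumes "finite S" "m > 0"
  shows "sum f S = (\<Sum>y<m. \<Sum>x\<in>{x\<in>S. x mod m = y}. f x)"
  using assms by (intro sum.group[symmetric]) auto

lemma int_cong_residue_iff: "y < m \<Longrightarrow> [int x = int y] (mod int m) \<longleftrightarrow> x mod m = y"
  by (metis cong_def cong_int_iff mod_less)

text \<open>The preceding results with the trivial cofactor \<open>m = 1\<close>, written
  \<open>ru 1 0\<close>: the counts must be constant on cosets of the subgroup of order
  \<open>p\<close>.\<close>

lemma zr_prime_power: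
  assumes p: "prime p" "i > 0" and S: "finite S"
  shows "zr S (p ^ i) \<longleftrightarrow>
    (\<forall>y<p ^ i. \<forall>y'<p ^ i. y mod p ^ (i - 1) = y' mod p ^ (i - 1) \<longrightarrow> cnt S (p ^ i) y = cnt S (p ^ i) y')"
proof (intro iffI allI impI)
  fix y y' assume z: "zr S (p ^ i)" and y: "y < p ^ i" "y' < p ^ i" "y mod p ^ (i - 1) = y' mod p ^ (i - 1)"
  have "(\<Sum>x\<in>{x\<in>S. [int x = int y] (mod int (p ^ i))}. of_int 1 * ru 1 0) =
         (\<Sum>x\<in>{x\<in>S. [int x = int y'] (mod int (p ^ i))}. of_int 1 * ru 1 0)"
  proof (rule vanishing_sum_prime_power[OF p, where b = 1])
    show "\<not> int p dvd 1" using p(1) not_prime_unit by auto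
    show "(\<Sum>x\<in>S. of_int 1 * (ru 1 0 * ru (p ^ i) (1 * int x))) = 0" using z by (simp add: zr_def)
    show "[int y = int y'] (mod int (p ^ (i - 1)))" using y(3) by (metis cong_def cong_int_iff)
  qed (use S in auto)
  thus "cnt S (p ^ i) y = cnt S (p ^ i) y'"
    unfolding int_cong_residue_iff[OF y(1)] int_cong_residue_iff[OF y(2)] by (simp add: cnt_def)
next
  assume *: "\<forall>y<p ^ i. \<forall>y'<p ^ i. y mod p ^ (i - 1) = y' mod p ^ (i - 1) \<longrightarrow> cnt S (p ^ i) y = cnt S (p ^ i) y'"
  have n: "p ^ i > 0" using p by (simp add: prime_gt_0_nat)
  have "(\<Sum>x\<in>S. ru (p ^ i) (int x)) = (\<Sum>y<p ^ i. \<Sum>x\<in>{x\<in>S. x mod p ^ i = y}. ru (p ^ i) (int x))"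
    by (rule sum_mod_classes[OF S n])
  also have "\<dots> = (\<Sum>y<p ^ i. of_nat (cnt S (p ^ i) y) * ru (p ^ i) (1 * int y))"
  proof (intro sum.cong refl)
    fix y
    have "(\<Sum>x\<in>{x\<in>S. x mod p ^ i = y}. ru (p ^ i) (int x)) = (\<Sum>x\<in>{x\<in>S. x mod p ^ i = y}. ru (p ^ i) (int y))"
      by (intro sum.cong refl ru_cong[OF n]) (auto simp: cong_def of_nat_mod)
    thus "(\<Sum>x\<in>{x\<in>S. x mod p ^ i = y}. ru (p ^ i) (int x)) = of_nat (cnt S (p ^ i) y) * ru (p ^ i) (1 * int y)"
      by (simp add: cnt_def)
  qed
  also have "\<dots> = 0"
  proof (rule sum_periodic_ru[OF p])
    show "\<not> int p dvd 1" using p(1) not_prime_unit by auto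
    fix y y' assume "y < p ^ i" "y' < p ^ i" "y mod p ^ (i - 1) = y' mod p ^ (i - 1)"
    with * have "cnt S (p ^ i) y = cnt S (p ^ i) y'" by blast
    thus "(of_nat (cnt S (p ^ i) y) :: complex) = of_nat (cnt S (p ^ i) y')" by (rule arg_cong)
  qed
  finally show "zr S (p ^ i)" by (simp add: zr_def)
qed

text \<open>The condition says that mixed second differences of the table of counts vanish within
  each block. It results from resolving the sum first in the \<open>p\<close>-coordinate and then in
  the \<open>q\<close>-coordinate; the converse sums in the opposite manner.\<close>

lemma zr_two_prime_powers:
  assumes p: "prime p" "i > 0" and q: "prime q" "j > 0" and "p \<noteq> q" and S: "finite S"
  shows "zr S (p ^ i * q ^ j) \<longleftrightarrow>
    (\<forall>y<p ^ i. \<forall>y'<p ^ i. \<forall>z<q ^ j. \<forall>z'<q ^ j.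
       y mod p ^ (i - 1) = y' mod p ^ (i - 1) \<longrightarrow> z mod q ^ (j - 1) = z' mod q ^ (j - 1) \<longrightarrow>
       cnt2 S (p ^ i) (q ^ j) y z + cnt2 S (p ^ i) (q ^ j) y' z' =
       cnt2 S (p ^ i) (q ^ j) y z' + cnt2 S (p ^ i) (q ^ j) y' z)"
proof -
  define m n where "m = p ^ i" and "n = q ^ j"
  have m: "m > 0" and n: "n > 0" using p q by (auto simp: m_def n_def prime_gt_0_nat)
  have cop: "coprime m n" using p q \<open>p \<noteq> q\<close> by (simp add: m_def n_def primes_coprime)
  obtain a b where ab: "a * int n + b * int m = 1"
    using cop by (metis bezout_int coprime_commute coprime_imp_gcd_eq_1 coprime_int_iff)
  have pa: "\<not> int p dvd a"
  proof
    assume "int p dvd a"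
    moreover have "int p dvd int m" using p by (simp add: m_def dvd_power)
    ultimately have "int p dvd a * int n + b * int m" by simp
    thus False using ab p by auto
  qed
  have qb: "\<not> int q dvd b"
  proof
    assume "int q dvd b"
    moreover have "int q dvd int n" using q by (simp add: n_def dvd_power)
    ultimately have "int q dvd a * int n + b * int m" by simp
    thus False using ab q by auto
  qed
  have split: "ru (m * n) (int x) = ru n (b * int x) * ru m (a * int x)" for x
  proof -
    have "int x = (a * int n + b * int m) * int x" by (simp add: ab)
    also have "\<dots> = a * int x * int n + b * int x * int m" by (simp add: algebra_simps)
    finally show ?thesis using m n ru_combine[of m n "a * int x" "b * int x"] by (simp add: mult.commute)
  qed
  show ?thesis unfolding m_def[symmetric] n_def[symmetric]
  proof (intro iffI allI impI)
    fix y y' z z'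
    assume zr: "zr S (m * n)" and y: "y < m" "y' < m" "y mod p ^ (i - 1) = y' mod p ^ (i - 1)"
      and z: "z < n" "z' < n" "z mod q ^ (j - 1) = z' mod q ^ (j - 1)"
    have 1: "(\<Sum>x\<in>{x\<in>S. [int x = int y] (mod int m)}. of_int 1 * ru n (b * int x)) =
           (\<Sum>x\<in>{x\<in>S. [int x = int y'] (mod int m)}. of_int 1 * ru n (b * int x))"
      unfolding m_def
    proof (rule vanishing_sum_prime_power[OF p, where b = a])
      show "coprime n p" using p q \<open>p \<noteq> q\<close> by (simp add: n_def primes_coprime)
      show "(\<Sum>x\<in>S. of_int 1 * (ru n (b * int x) * ru (p ^ i) (a * int x))) = 0"
        using zr by (simp add: zr_def split flip: m_def)
      show "[int y = int y'] (mod int (p ^ (i - 1)))" using y(3) by (metis cong_def cong_int_iff)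
    qed (use S n pa in auto)
    \<comment> \<open>Row \<open>y\<close> minus row \<open>y'\<close>: the equality of the two row
      sums is again a vanishing sum, with signed weights, and can be resolved in the
      \<open>q\<close>-coordinate.\<close>
    define w where "w = (\<lambda>x. (if x mod m = y then 1 else 0) - (if x mod m = y' then 1 else 0 :: int))"
    have "(\<Sum>x\<in>S. of_int (w x) * ru n (b * int x)) =
       (\<Sum>x\<in>S. (if x mod m = y then ru n (b * int x) else 0)) - (\<Sum>x\<in>S. (if x mod m = y' then ru n (b * int x) else 0))"
      unfolding sum_subtractf[symmetric] by (intro sum.cong) (auto simp: w_def)
    also have "\<dots> = 0" using 1 y S by (simp add: int_cong_residue_iff sum.inter_filter)
    finally have w0: "(\<Sum>x\<in>S. of_int (w x) * (ru 1 0 * ru n (b * int x))) = 0" by simp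
    have "(\<Sum>x\<in>{x\<in>S. [int x = int z] (mod int n)}. of_int (w x) * ru 1 0) =
           (\<Sum>x\<in>{x\<in>S. [int x = int z'] (mod int n)}. of_int (w x) * ru 1 0)"
      unfolding n_def
    proof (rule vanishing_sum_prime_power[OF q, where b = b])
      show "(\<Sum>x\<in>S. of_int (w x) * (ru 1 0 * ru (q ^ j) (b * int x))) = 0"
        using w0 by (simp add: n_def)
      show "[int z = int z'] (mod int (q ^ (j - 1)))" using z(3) by (metis cong_def cong_int_iff)
    qed (use S qb in auto)
    hence "(of_int (\<Sum>x\<in>{x\<in>S. x mod n = z}. w x) :: complex) = of_int (\<Sum>x\<in>{x\<in>S. x mod n = z'}. w x)"
      using z by (simp add: int_cong_residue_iff)
    hence 2: "(\<Sum>x\<in>{x\<in>S. x mod n = z}. w x) = (\<Sum>x\<in>{x\<in>S. x mod n = z'}. w x)"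
      by (simp only: of_int_eq_iff)
    have 3: "(\<Sum>x\<in>{x\<in>S. x mod n = z}. w x) = int (cnt2 S m n y z) - int (cnt2 S m n y' z)" for z
    proof -
      have "(\<Sum>x\<in>{x\<in>S. x mod n = z}. (if x mod m = y then 1 else 0 :: int)) = int (cnt2 S m n y z)" for y
      proof -
        have "(\<Sum>x\<in>{x\<in>S. x mod n = z}. (if x mod m = y then 1 else 0 :: int)) = (\<Sum>x\<in>{x\<in>{x\<in>S. x mod n = z}. x mod m = y}. 1)"
          using S by (subst sum.inter_filter) auto
        also have "{x\<in>{x\<in>S. x mod n = z}. x mod m = y} = {x\<in>S. x mod m = y \<and> x mod n = z}" by auto
        finally show ?thesis by (simp add: cnt2_def)
      qed
      thus ?thesis by (simp add: w_def sum_subtractf)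
    qed
    show "cnt2 S m n y z + cnt2 S m n y' z' = cnt2 S m n y z' + cnt2 S m n y' z"
      using 2 unfolding 3 by linarith
  next
    assume *: "\<forall>y<m. \<forall>y'<m. \<forall>z<n. \<forall>z'<n. y mod p ^ (i - 1) = y' mod p ^ (i - 1) \<longrightarrow>
       z mod q ^ (j - 1) = z' mod q ^ (j - 1) \<longrightarrow>
       cnt2 S m n y z + cnt2 S m n y' z' = cnt2 S m n y z' + cnt2 S m n y' z"
    define G where "G = (\<lambda>y. \<Sum>x\<in>{x\<in>S. x mod m = y}. ru n (b * int x))"
    have G: "G y = (\<Sum>z<n. of_nat (cnt2 S m n y z) * ru n (b * int z))" for y
    proof -
      have "G y = (\<Sum>z<n. \<Sum>x\<in>{x\<in>{x\<in>S. x mod m = y}. x mod n = z}. ru n (b * int x))"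
        unfolding G_def using S n by (intro sum_mod_classes) auto
      also have "\<dots> = (\<Sum>z<n. of_nat (cnt2 S m n y z) * ru n (b * int z))"
      proof (intro sum.cong refl)
        fix z
        have "(\<Sum>x\<in>{x\<in>{x\<in>S. x mod m = y}. x mod n = z}. ru n (b * int x)) =
          (\<Sum>x\<in>{x\<in>S. x mod m = y \<and> x mod n = z}. ru n (b * int z))"
          by (intro sum.cong ru_cong[OF n] cong_mult) (auto simp: cong_def of_nat_mod)
        thus "(\<Sum>x\<in>{x\<in>{x\<in>S. x mod m = y}. x mod n = z}. ru n (b * int x)) = of_nat (cnt2 S m n y z) * ru n (b * int z)"
          by (simp add: cnt2_def)
      qed
      finally show ?thesis .
    qed
    have "(\<Sum>x\<in>S. ru (m * n) (int x)) = (\<Sum>y<m. \<Sum>x\<in>{x\<in>S. x mod m = y}. ru (m * n) (int x))"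
      by (rule sum_mod_classes[OF S m])
    also have "\<dots> = (\<Sum>y<m. G y * ru m (a * int y))"
    proof (intro sum.cong refl)
      fix y
      have "(\<Sum>x\<in>{x\<in>S. x mod m = y}. ru (m * n) (int x)) = (\<Sum>x\<in>{x\<in>S. x mod m = y}. ru n (b * int x) * ru m (a * int y))"
        unfolding split
        by (intro sum.cong refl arg_cong2[of _ _ _ _ "(*)"] ru_cong[OF m] cong_mult) (auto simp: cong_def of_nat_mod)
      thus "(\<Sum>x\<in>{x\<in>S. x mod m = y}. ru (m * n) (int x)) = G y * ru m (a * int y)"
        by (simp add: G_def sum_distrib_right)
    qed
    also have "\<dots> = 0" unfolding m_def
    proof (rule sum_periodic_ru[OF p pa])
      fix y y' assume y: "y < p ^ i" "y' < p ^ i" "y mod p ^ (i - 1) = y' mod p ^ (i - 1)"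
      have "G y - G y' = (\<Sum>z<n. (of_nat (cnt2 S m n y z) - of_nat (cnt2 S m n y' z)) * ru n (b * int z))"
        by (simp add: G sum_subtractf left_diff_distrib)
      also have "\<dots> = 0" unfolding n_def
      proof (rule sum_periodic_ru[OF q qb])
        fix z z' assume z: "z < q ^ j" "z' < q ^ j" "z mod q ^ (j - 1) = z' mod q ^ (j - 1)"
        have "cnt2 S m n y z + cnt2 S m n y' z' = cnt2 S m n y z' + cnt2 S m n y' z"
          using * y z by (simp add: m_def n_def)
        hence "(of_nat (cnt2 S m n y z + cnt2 S m n y' z') :: complex) = of_nat (cnt2 S m n y z' + cnt2 S m n y' z)"
          by (simp only: of_nat_eq_iff)
        thus "(of_nat (cnt2 S m (q ^ j) y z) - of_nat (cnt2 S m (q ^ j) y' z) :: complex) =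
          of_nat (cnt2 S m (q ^ j) y z') - of_nat (cnt2 S m (q ^ j) y' z')"
          by (simp add: n_def algebra_simps)
      qed
      finally show "G y = G y'" by simp
    qed
    finally show "zr S (m * n)" by (simp add: zr_def)
  qed
qed

section \<open>Bookkeeping for counts in residue classes and first divisibility consequences\<close>

lemma card_eq_sum_cnt: "finite S \<Longrightarrow> n > 0 \<Longrightarrow> card S = (\<Sum>z<n. cnt S n z)"
  using sum_mod_classes[of S n "\<lambda>_. 1::nat"] by (simp add: cnt_def)

lemma cnt_eq_sum_cnt2: assumes "finite S" "m > 0" shows "cnt S n z = (\<Sum>y<m. cnt2 S m n y z)"
proof -
  have "cnt S n z = (\<Sum>y<m. cnt {x\<in>S. x mod n = z} m y)"
    using assms card_eq_sum_cnt[of "{x\<in>S. x mod n = z}" m] by (simp add: cnt_def[of S])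
  also have "\<dots> = (\<Sum>y<m. cnt2 S m n y z)"
    unfolding cnt_def cnt2_def by (intro sum.cong arg_cong[of _ _ card]) auto
  finally show ?thesis .
qed

lemma cnt2_commute: "cnt2 S m n y z = cnt2 S n m z y"
  unfolding cnt2_def by (intro arg_cong[of _ _ card]) auto

lemma cnt_refine:
  assumes "finite S" "P > 0" "p > 0"
  shows "cnt S P c = (\<Sum>y\<in>{y. y < p * P \<and> y mod P = c}. cnt S (p * P) y)"
proof -
  have "cnt S P c = (\<Sum>y<p * P. cnt {x\<in>S. x mod P = c} (p * P) y)"
    using assms card_eq_sum_cnt[of "{x\<in>S. x mod P = c}" "p * P"] by (simp add: cnt_def[of S])
  also have "\<dots> = (\<Sum>y<p * P. if y mod P = c then cnt S (p * P) y else 0)"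
  proof (intro sum.cong refl)
    fix y
    have "{x\<in>{x\<in>S. x mod P = c}. x mod (p * P) = y} = (if y mod P = c then {x\<in>S. x mod (p * P) = y} else {})"
      by (auto simp: mod_mod_cancel)
    thus "cnt {x\<in>S. x mod P = c} (p * P) y = (if y mod P = c then cnt S (p * P) y else 0)"
      by (simp add: cnt_def split: if_splits)
  qed
  also have "\<dots> = (\<Sum>y\<in>{y\<in>{..<p * P}. y mod P = c}. cnt S (p * P) y)"
    by (rule sum.inter_filter[symmetric]) simp
  also have "{y\<in>{..<p * P}. y mod P = c} = {y. y < p * P \<and> y mod P = c}" by auto
  finally show ?thesis .
qed

lemma card_residue_class:
  assumes "c < P"
  shows "card {y. y < p * P \<and> y mod P = c} = (p::nat)"
proof -
  have "{y. y < p * P \<and> y mod P = c} = (\<lambda>t. c + t * P) ` {..<p}"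
  proof (intro equalityI subsetI)
    fix y assume y: "y \<in> {y. y < p * P \<and> y mod P = c}"
    hence "y = c + (y div P) * P" by auto
    moreover have "y div P < p" using y by (simp add: less_mult_imp_div_less)
    ultimately show "y \<in> (\<lambda>t. c + t * P) ` {..<p}" by blast
  next
    fix y assume "y \<in> (\<lambda>t. c + t * P) ` {..<p}"
    then obtain t where t: "t < p" "y = c + t * P" by auto
    have "y < (t + 1) * P" using assms t by simp
    also have "\<dots> \<le> p * P" using t by (intro mult_le_mono1) simp
    finally show "y \<in> {y. y < p * P \<and> y mod P = c}" using assms t by simp
  qed
  moreover have "inj_on (\<lambda>t. c + t * P) {..<p}" using assms by (auto simp: inj_on_def)
  ultimately show ?thesis by (simp add: card_image)
qed

lemma finite_residue_class [simp]: "finite {y. y < (p::nat) * P \<and> y mod P = c}"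
  by (rule finite_subset[of _ "{..<p * P}"]) auto

lemma sum_mod_fun:
  fixes f :: "nat \<Rightarrow> nat"
  assumes "P > 0"
  shows "(\<Sum>y<p * P. f (y mod P)) = p * (\<Sum>c<P. f c)"
proof -
  have "(\<Sum>y<p * P. f (y mod P)) = (\<Sum>c<P. \<Sum>y\<in>{y\<in>{..<p * P}. y mod P = c}. f (y mod P))"
    using assms by (intro sum_mod_classes) auto
  also have "\<dots> = (\<Sum>c<P. \<Sum>y\<in>{y. y < p * P \<and> y mod P = c}. f c)"
    by (intro sum.cong) auto
  also have "\<dots> = p * (\<Sum>c<P. f c)"
    by (simp add: card_residue_class sum_distrib_left)
  finally show ?thesis .
qed

lemma zr_prime_iff:
  assumes "prime p" "finite S"
  shows "zr S p \<longleftrightarrow> (\<forall>y<p. \<forall>y'<p. cnt S p y = cnt S p y')"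
  using zr_prime_power[of p 1 S] assms by simp

lemma zr_prime_cnt:
  assumes p: "prime p" and S: "finite S" and z: "zr S p" and y: "y < p"
  shows "p * cnt S p y = card S"
proof -
  have p0: "p > 0" using p by (rule prime_gt_0_nat)
  have "card S = (\<Sum>y'<p. cnt S p y')" using card_eq_sum_cnt[OF S p0] .
  also have "\<dots> = (\<Sum>y'<p. cnt S p y)"
    by (intro sum.cong refl) (use z y zr_prime_iff[OF p S] in blast)
  finally show ?thesis by simp
qed

text \<open>Each class modulo \<open>p\<close> splits into \<open>p\<close> classes modulo
  \<open>p^2\<close>, which the zero at \<open>p^2\<close> fills equally.\<close>

lemma zr_prime_sq_dvd_cnt:
  assumes p: "prime p" and S: "finite S" and z: "zr S (p^2)" and c: "c < p"
  shows "p dvd cnt S p c"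
proof -
  have p0: "p > 0" using p by (rule prime_gt_0_nat)
  have "p * p = p^2" by (simp add: power2_eq_square)
  have "c < p^2" using c p0 by (simp add: power2_eq_square) (metis le_square less_le_trans)
  have "cnt S p c = (\<Sum>y\<in>{y. y < p * p \<and> y mod p = c}. cnt S (p * p) y)"
    using cnt_refine[OF S p0 p0] .
  also have "\<dots> = (\<Sum>y\<in>{y. y < p * p \<and> y mod p = c}. cnt S (p * p) c)"
  proof (intro sum.cong refl)
    fix y assume "y \<in> {y. y < p * p \<and> y mod p = c}"
    hence y: "y < p^2" "y mod p ^ (2 - 1) = c mod p ^ (2 - 1)"
      using c by (simp_all add: power2_eq_square)
    show "cnt S (p * p) y = cnt S (p * p) c"
      using z y \<open>c < p^2\<close> unfolding \<open>p * p = p^2\<close> zr_prime_power[OF p zero_less_numeral S] by blast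
  qed
  also have "\<dots> = p * cnt S (p * p) c" using c by (simp add: card_residue_class)
  finally show ?thesis by simp
qed

lemma zr_prime_dvd_card:
  assumes p: "prime p" and S: "finite S" and i: "i = 1 \<or> i = 2" and z: "zr S (p ^ i)"
  shows "p dvd card S"
  using i
proof
  assume "i = 1"
  with z zr_prime_cnt[OF p S, of 0] prime_gt_0_nat[OF p] show ?thesis by (metis dvd_triv_left power_one_right)
next
  assume "i = 2"
  with z have "\<forall>c<p. p dvd cnt S p c" using zr_prime_sq_dvd_cnt[OF p S] by blast
  thus ?thesis using card_eq_sum_cnt[OF S prime_gt_0_nat[OF p]] by (metis dvd_sum lessThan_iff)
qed

lemma zr_both_sq_dvd_card:
  assumes p: "prime p" and S: "finite S" and "zr S p" "zr S (p^2)"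
  shows "p^2 dvd card S"
proof -
  have "p dvd cnt S p 0" using zr_prime_sq_dvd_cnt[OF p S assms(4)] prime_gt_0_nat[OF p] .
  hence "p * p dvd p * cnt S p 0" by simp
  thus ?thesis using zr_prime_cnt[OF p S assms(3), of 0] prime_gt_0_nat[OF p] by (simp add: power2_eq_square)
qed

text \<open>For two prime powers a vanishing sum splits the counting function additively; normalising
  one summand to have minimum 0 keeps both summands in the natural numbers.\<close>

lemma zr_two_decomp:
  assumes p: "prime p" "i > 0" and q: "prime q" "j > 0" and pq: "p \<noteq> q" and S: "finite S"
    and z: "zr S (p ^ i * q ^ j)"
  shows "\<exists>u v.
    (\<forall>y<p ^ i. \<forall>z<q ^ j.
       cnt2 S (p ^ i) (q ^ j) y z = u y (z mod q ^ (j - 1)) + v (y mod p ^ (i - 1)) z) \<and>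
    (\<forall>c<p ^ (i - 1). \<forall>d<q ^ (j - 1). \<exists>y<p ^ i. y mod p ^ (i - 1) = c \<and> u y d = 0)"
proof -
  define m n P Q where "m = p ^ i" and "n = q ^ j" and "P = p ^ (i - 1)" and "Q = q ^ (j - 1)"
  have mP: "m = p * P" and nQ: "n = q * Q" using p q by (simp_all add: m_def P_def n_def Q_def flip: power_Suc)
  have pos: "p > 0" "q > 0" "P > 0" "Q > 0" using p q by (auto simp: P_def Q_def prime_gt_0_nat)
  define C where "C = cnt2 S m n"
  have add: "C y z + C y' z' = C y z' + C y' z"
    if "y < m" "y' < m" "z < n" "z' < n" "y mod P = y' mod P" "z mod Q = z' mod Q" for y y' z z'
    using z that unfolding zr_two_prime_powers[OF p q pq S] C_def m_def n_def P_def Q_def by blast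
  \<comment> \<open>The row of class \<open>c\<close> in which column \<open>d\<close> is smallest,
    where \<open>d < Q\<close> also serves as the representative of its own column class.
    Subtracting this minimum makes the truncated difference below exact and gives \<open>u\<close>
    its zeros.\<close>
  define t0 where "t0 = (\<lambda>c d. arg_min (\<lambda>y. C y d) (\<lambda>y. y < m \<and> y mod P = c))"
  have t0: "t0 c d < m" "t0 c d mod P = c" "\<And>y. y < m \<Longrightarrow> y mod P = c \<Longrightarrow> C (t0 c d) d \<le> C y d"
    if "c < P" for c d
  proof -
    have "c < m" using that pos unfolding mP by (metis less_le_trans mult_le_mono1 mult_1 Suc_leI One_nat_def)
    hence "c < m \<and> c mod P = c" using that by simp
    from arg_min_nat_lemma[of "\<lambda>y. y < m \<and> y mod P = c", OF this, of "\<lambda>y. C y d"]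
    show "t0 c d < m" "t0 c d mod P = c" "\<And>y. y < m \<Longrightarrow> y mod P = c \<Longrightarrow> C (t0 c d) d \<le> C y d"
      by (auto simp: t0_def)
  qed
  show ?thesis
  proof (rule exI[of _ "\<lambda>y d. C y d - C (t0 (y mod P) d) d"], rule exI[of _ "\<lambda>c z. C (t0 c (z mod Q)) z"],
      intro conjI allI impI)
    fix y z assume y: "y < p ^ i" and z: "z < q ^ j"
    define c d where "c = y mod P" and "d = z mod Q"
    have c: "c < P" and d: "d < Q" using pos by (simp_all add: c_def d_def)
    have "d < n" using d pos unfolding nQ by (metis less_le_trans mult_le_mono1 mult_1 Suc_leI One_nat_def)
    have "C y z + C (t0 c d) d = C y d + C (t0 c d) z"
      using y z t0(1,2)[OF c, of d] \<open>d < n\<close> d by (intro add) (auto simp: c_def d_def m_def n_def)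
    moreover have "C (t0 c d) d \<le> C y d" using y t0(3)[OF c, of y d] by (simp add: c_def m_def)
    ultimately show "cnt2 S (p ^ i) (q ^ j) y z =
      (C y (z mod q ^ (j - 1)) - C (t0 (y mod P) (z mod q ^ (j - 1))) (z mod q ^ (j - 1))) +
      C (t0 (y mod p ^ (i - 1)) (z mod Q)) z"
      unfolding c_def d_def C_def m_def n_def P_def Q_def by (simp, linarith)
  next
    fix c d assume "c < p ^ (i - 1)" "d < q ^ (j - 1)"
    hence "t0 c d < m" "t0 c d mod P = c" using t0(1,2)[of c d] by (simp_all add: P_def)
    thus "\<exists>y<p ^ i. y mod p ^ (i - 1) = c \<and> C y d - C (t0 (y mod P) d) d = 0"
      by (intro exI[of _ "t0 c d"]) (simp add: m_def P_def)
  qed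
qed

lemma zr_two_primes_decomp:
  assumes p: "prime p" and q: "prime q" and pq: "p \<noteq> q" and S: "finite S" and z: "zr S (p * q)"
  shows "\<exists>u v. (\<forall>y<p. \<forall>z<q. cnt2 S p q y z = u y + v z) \<and> (\<exists>y<p. u y = 0)"
proof -
  have "zr S (p ^ 1 * q ^ 1)" using z by simp
  from zr_two_decomp[OF p zero_less_one q zero_less_one pq S this] obtain u v where
    a: "\<forall>y<p ^ 1. \<forall>z<q ^ 1. cnt2 S (p ^ 1) (q ^ 1) y z = u y (z mod q ^ (1 - 1)) + v (y mod p ^ (1 - 1)) z"
    and b: "\<forall>c<p ^ (1 - 1). \<forall>d<q ^ (1 - 1). \<exists>y<p ^ 1. y mod p ^ (1 - 1) = c \<and> u y d = 0"
    by blast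
  show ?thesis
    by (rule exI[of _ "\<lambda>y. u y 0"], rule exI[of _ "v 0"]) (use a b in simp)
qed

text \<open>Summing the decomposition over rows. \<open>U\<close> collects the part constant along
  cosets of order \<open>q\<close>, \<open>V\<close> the part constant along cosets of order
  \<open>p\<close>; if either part is absent, the other exhibits a pure zero. The last clause, a
  nonnegative combination of \<open>q\<close> and \<open>p\<close>, drives the size estimates
  below.\<close>

lemma zr_two_marginal:
  assumes p: "prime p" "i > 0" and q: "prime q" "j > 0" and pq: "p \<noteq> q" and S: "finite S"
    and z: "zr S (p ^ i * q ^ j)"
  shows "\<exists>U V. (\<forall>z<q ^ j. cnt S (q ^ j) z = U (z mod q ^ (j - 1)) + p * V z) \<and>
    ((\<forall>d<q ^ (j - 1). U d = 0) \<longrightarrow> zr S (p ^ i)) \<and>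
    ((\<forall>z<q ^ j. V z = 0) \<longrightarrow> zr S (q ^ j)) \<and>
    (\<forall>d<q ^ (j - 1).
       cnt S (q ^ (j - 1)) d = q * U d + p * (\<Sum>z\<in>{z. z < q ^ j \<and> z mod q ^ (j - 1) = d}. V z))"
proof -
  define m n P Q where "m = p ^ i" and "n = q ^ j" and "P = p ^ (i - 1)" and "Q = q ^ (j - 1)"
  have mP: "m = p * P" and nQ: "n = q * Q" using p q by (simp_all add: m_def P_def n_def Q_def flip: power_Suc)
  have pos: "p > 0" "q > 0" "P > 0" "Q > 0" using p q by (auto simp: P_def Q_def prime_gt_0_nat)
  hence pos': "m > 0" "n > 0" by (simp_all add: mP nQ)
  obtain u v where uv: "\<forall>y<m. \<forall>z<n. cnt2 S m n y z = u y (z mod Q) + v (y mod P) z"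
    using zr_two_decomp[OF p q pq S z] unfolding m_def n_def P_def Q_def by blast
  define U where "U = (\<lambda>d. \<Sum>y<m. u y d)"
  define V where "V = (\<lambda>z. \<Sum>c<P. v c z)"
  have a: "cnt S n z = U (z mod Q) + p * V z" if "z < n" for z
  proof -
    have "cnt S n z = (\<Sum>y<m. u y (z mod Q) + v (y mod P) z)"
      using cnt_eq_sum_cnt2[OF S pos'(1)] uv that by simp
    also have "\<dots> = U (z mod Q) + (\<Sum>y<p * P. v (y mod P) z)" by (simp add: U_def sum.distrib mP)
    also have "\<dots> = U (z mod Q) + p * V z" using sum_mod_fun[OF pos(3), of "\<lambda>c. v c z" p] by (simp add: V_def)
    finally show ?thesis .
  qed
  show ?thesis
  proof (rule exI[of _ U], rule exI[of _ V], intro conjI impI; (intro allI impI)?)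
    show "cnt S (q ^ j) z = U (z mod q ^ (j - 1)) + p * V z" if "z < q ^ j" for z
      using a that by (simp add: n_def Q_def)
  next
    assume "\<forall>d<q ^ (j - 1). U d = 0"
    hence "\<forall>d<Q. \<forall>y<m. u y d = 0" by (simp add: U_def Q_def)
    hence C: "cnt2 S m n y z = v (y mod P) z" if "y < m" "z < n" for y z using uv that pos by simp
    have *: "cnt S m y = (\<Sum>z<n. v (y mod P) z)" if "y < m" for y
      using C that cnt_eq_sum_cnt2[OF S pos'(2), of m y] by (simp add: cnt2_commute)
    show "zr S (p ^ i)" unfolding zr_prime_power[OF p S]
      using * by (simp add: m_def P_def)
  next
    assume "\<forall>z<q ^ j. V z = 0"
    hence *: "cnt S n z = U (z mod Q)" if "z < n" for z using a that by (simp add: n_def)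
    show "zr S (q ^ j)" unfolding zr_prime_power[OF q S]
      using * by (simp add: n_def Q_def)
  next
    fix d assume d: "d < q ^ (j - 1)"
    have "cnt S Q d = (\<Sum>z\<in>{z. z < n \<and> z mod Q = d}. cnt S n z)"
      unfolding nQ by (rule cnt_refine[OF S pos(4,2)])
    also have "\<dots> = (\<Sum>z\<in>{z. z < n \<and> z mod Q = d}. U d + p * V z)"
      using a by (intro sum.cong) auto
    also have "\<dots> = q * U d + p * (\<Sum>z\<in>{z. z < n \<and> z mod Q = d}. V z)"
      using d by (simp add: nQ card_residue_class sum.distrib sum_distrib_left Q_def)
    finally show "cnt S (q ^ (j - 1)) d = q * U d + p * (\<Sum>z\<in>{z. z < q ^ j \<and> z mod q ^ (j - 1) = d}. V z)"
      by (simp add: n_def Q_def)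
  qed
qed

text \<open>The size is \<open>q\<close> times the total of \<open>U\<close> plus \<open>p\<close>
  times the total of \<open>V\<close>, so a single positive \<open>U\<close> exhausts
  \<open>q\<close> and forces \<open>V = 0\<close>.\<close>

lemma zr_two_small:
  assumes p: "prime p" "i > 0" and q: "prime q" "j > 0" and pq: "p \<noteq> q" and S: "finite S"
    and z: "zr S (p ^ i * q ^ j)" and k: "card S \<le> q"
  shows "zr S (p ^ i) \<or> (card S = q \<and> zr S (q ^ j))"
proof -
  obtain U V where UV: "(\<forall>d<q ^ (j - 1). U d = 0) \<longrightarrow> zr S (p ^ i)"
    "(\<forall>z<q ^ j. V z = 0) \<longrightarrow> zr S (q ^ j)"
    "\<forall>d<q ^ (j - 1).
       cnt S (q ^ (j - 1)) d = q * U d + p * (\<Sum>z\<in>{z. z < q ^ j \<and> z mod q ^ (j - 1) = d}. V z)"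
    using zr_two_marginal[OF p q pq S z] by blast
  define Q where "Q = q ^ (j - 1)"
  have pos: "p > 0" "q > 0" "Q > 0" using p q by (auto simp: Q_def prime_gt_0_nat)
  have tot: "card S = (\<Sum>d<Q. q * U d + p * (\<Sum>z\<in>{z. z < q ^ j \<and> z mod Q = d}. V z))"
    using card_eq_sum_cnt[OF S pos(3)] UV(3) by (simp add: Q_def)
  show ?thesis
  proof (cases "\<forall>d<Q. U d = 0")
    case True
    thus ?thesis using UV(1) by (simp add: Q_def)
  next
    case False
    then obtain d0 where d0: "d0 < Q" "U d0 > 0" by auto
    define W where "W = (\<Sum>d<Q. \<Sum>z\<in>{z. z < q ^ j \<and> z mod Q = d}. V z)"
    have "card S = q * (\<Sum>d<Q. U d) + p * W"
      unfolding tot W_def by (simp add: sum.distrib sum_distrib_left)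
    moreover have "(\<Sum>d<Q. U d) \<ge> 1" using d0 member_le_sum[of d0 "{..<Q}" U] by simp
    hence "q * (\<Sum>d<Q. U d) \<ge> q" by simp
    ultimately have "card S = q" "p * W = 0" using k by linarith+
    hence "W = 0" using pos by simp
    have "V z = 0" if "z < q ^ j" for z
    proof -
      have "z mod Q < Q" using pos by simp
      with \<open>W = 0\<close> have "(\<Sum>z'\<in>{z'. z' < q ^ j \<and> z' mod Q = z mod Q}. V z') = 0"
        unfolding W_def by simp
      thus ?thesis using that by simp
    qed
    with \<open>card S = q\<close> UV(2) show ?thesis by blast
  qed
qed

text \<open>For rows \<open>y\<close>, \<open>y'\<close> in one class, the zero at
  \<open>p^i q^2\<close> makes their difference \<open>h\<close> depend on the column modulo
  \<open>q\<close> only; summed over column classes this is \<open>q * h\<close>, which the zero at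
  \<open>p^i q\<close> makes constant. If the constant were nonzero, every column modulo
  \<open>q^2\<close> would contain an element, too many for the size.\<close>

lemma zr_two_full_column:
  assumes p: "prime p" "i > 0" and q: "prime q" and pq: "p \<noteq> q" and S: "finite S"
    and z1: "zr S (p ^ i * q)" and z2: "zr S (p ^ i * q^2)" and k: "card S < q^2"
  shows "zr S (p ^ i)"
proof -
  define m where "m = p ^ i"
  have pos: "m > 0" "q > 0" "q^2 > 0" using p q by (auto simp: m_def prime_gt_0_nat)
  have qq: "q * q = q^2" by (simp add: power2_eq_square)
  have z1': "zr S (p ^ i * q ^ 1)" using z1 by simp
  show ?thesis unfolding zr_prime_power[OF p S]
  proof (intro allI impI)
    fix y y' assume y: "y < p ^ i" "y' < p ^ i" "y mod p ^ (i - 1) = y' mod p ^ (i - 1)"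
    define h where "h = (\<lambda>z. int (cnt2 S m (q^2) y z) - int (cnt2 S m (q^2) y' z))"
    have A: "h z = h z'" if "z < q^2" "z' < q^2" "z mod q = z' mod q" for z z'
    proof -
      have "cnt2 S m (q^2) y z + cnt2 S m (q^2) y' z' = cnt2 S m (q^2) y z' + cnt2 S m (q^2) y' z"
        using z2 that y unfolding zr_two_prime_powers[OF p q zero_less_numeral pq S] m_def by simp
      thus ?thesis by (simp add: h_def)
    qed
    have B: "int (cnt2 S m q y d) - int (cnt2 S m q y' d) = int q * h d" if "d < q" for d
    proof -
      have "cnt2 S m q y d = (\<Sum>z\<in>{z. z < q^2 \<and> z mod q = d}. cnt2 S m (q^2) y z)" for y
      proof -
        have "cnt2 S m q y d = cnt {x\<in>S. x mod m = y} q d"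
          unfolding cnt2_def cnt_def by (intro arg_cong[of _ _ card]) auto
        also have "\<dots> = (\<Sum>z\<in>{z. z < q * q \<and> z mod q = d}. cnt {x\<in>S. x mod m = y} (q * q) z)"
          using S pos by (intro cnt_refine) auto
        also have "\<dots> = (\<Sum>z\<in>{z. z < q^2 \<and> z mod q = d}. cnt2 S m (q^2) y z)"
          unfolding qq cnt_def cnt2_def by (intro sum.cong arg_cong[of _ _ card]) auto
        finally show ?thesis .
      qed
      hence "int (cnt2 S m q y d) - int (cnt2 S m q y' d) = (\<Sum>z\<in>{z. z < q^2 \<and> z mod q = d}. h z)"
        by (simp add: h_def sum_subtractf)
      also have "\<dots> = (\<Sum>z\<in>{z. z < q^2 \<and> z mod q = d}. h d)"
      proof (intro sum.cong refl A)
        show "d < q^2" using that le_square[of q] unfolding power2_eq_square by linarith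
      qed (use that in auto)
      also have "\<dots> = int q * h d" using card_residue_class[OF that, of q] by (simp add: qq)
      finally show ?thesis .
    qed
    have "h d = h 0" if "d < q" for d
    proof -
      have "cnt2 S m q y d + cnt2 S m q y' 0 = cnt2 S m q y 0 + cnt2 S m q y' d"
        using iffD1[OF zr_two_prime_powers[OF p q zero_less_one pq S] z1', rule_format, of y y' d 0]
          that y pos(2) by (simp add: m_def)
      hence "int q * h d = int q * h 0" using B[OF that] B[OF pos(2)] by linarith
      thus ?thesis using pos by simp
    qed
    hence h: "h z = h 0" if "z < q^2" for z
    proof -
      have "z mod q < q^2" using that by (meson le_less_trans mod_less_eq_dividend)
      hence "h z = h (z mod q)" using that by (intro A) auto
      also have "\<dots> = h 0" using pos by (intro \<open>\<And>d. d < q \<Longrightarrow> h d = h 0\<close>) simp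
      finally show ?thesis .
    qed
    have "h 0 = 0"
    proof (rule ccontr)
      assume "h 0 \<noteq> 0"
      hence "cnt2 S m (q^2) y z + cnt2 S m (q^2) y' z \<ge> 1" if "z < q^2" for z
        using h[OF that] by (auto simp: h_def)
      hence "cnt S (q^2) z \<ge> 1" if "z < q^2" for z
        using cnt_eq_sum_cnt2[OF S pos(1), of "q^2" z] that y
          member_le_sum[of y "{..<m}" "\<lambda>y. cnt2 S m (q^2) y z"] member_le_sum[of y' "{..<m}" "\<lambda>y. cnt2 S m (q^2) y z"]
        by (fastforce simp: m_def)
      hence "(\<Sum>z<q^2. 1) \<le> (\<Sum>z<q^2. cnt S (q^2) z)" by (intro sum_mono) simp
      thus False using k card_eq_sum_cnt[OF S pos(3)] by simp
    qed
    with h have "\<forall>z<q^2. cnt2 S m (q^2) y z = cnt2 S m (q^2) y' z" by (simp add: h_def)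
    thus "cnt S (p ^ i) y = cnt S (p ^ i) y'"
      using cnt_eq_sum_cnt2[OF S pos(3), of m y] cnt_eq_sum_cnt2[OF S pos(3), of m y']
      by (simp add: m_def cnt2_commute)
  qed
qed

abbreviation compl12 :: "nat \<Rightarrow> nat \<Rightarrow> bool" where
  "compl12 i j \<equiv> (i = 1 \<and> j = 2) \<or> (i = 2 \<and> j = 1)"

text \<open>Suppose some \<open>U\<close> is positive. If \<open>j0 = 1\<close>, the columns modulo
  \<open>q\<close> have equal size, at least \<open>q\<close> and so exactly \<open>q\<close>; a
  column with \<open>U = 0\<close> would give that \<open>p\<close> divides \<open>q\<close>, hence
  \<open>V = 0\<close> throughout. If \<open>j0 = 2\<close>, there is only one \<open>U\<close>, so
  every column is nonempty and a multiple of \<open>q\<close>, and the size bound makes all of them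
  equal to \<open>q\<close>.\<close>

lemma zr_mixed_column_bound:
  assumes p: "prime p" "i > 0" and q: "prime q" and pq: "p \<noteq> q" and S: "finite S"
    and j: "compl12 j0 j1"
    and z0: "zr S (q ^ j0)" and z1: "zr S (p ^ i * q ^ j1)" and k: "card S \<le> q^2"
  shows "zr S (p ^ i) \<or> (card S = q^2 \<and> zr S q \<and> zr S (q^2))"
proof -
  have q0: "q > 0" and p0: "p > 0" using p q by (auto simp: prime_gt_0_nat)
  have j1: "j1 > 0" using j by auto
  obtain U V where UV: "\<forall>z<q ^ j1. cnt S (q ^ j1) z = U (z mod q ^ (j1 - 1)) + p * V z"
    "(\<forall>d<q ^ (j1 - 1). U d = 0) \<longrightarrow> zr S (p ^ i)"
    "(\<forall>z<q ^ j1. V z = 0) \<longrightarrow> zr S (q ^ j1)"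
    "\<forall>d<q ^ (j1 - 1).
       cnt S (q ^ (j1 - 1)) d = q * U d + p * (\<Sum>z\<in>{z. z < q ^ j1 \<and> z mod q ^ (j1 - 1) = d}. V z)"
    using zr_two_marginal[OF p q j1 pq S z1] by blast
  show ?thesis
  proof (cases "\<forall>d<q ^ (j1 - 1). U d = 0")
    case True
    thus ?thesis using UV(2) by blast
  next
    case False
    then obtain d0 where d0: "d0 < q ^ (j1 - 1)" "U d0 > 0" by auto
    from j show ?thesis
    proof
      assume jj: "j0 = 1 \<and> j1 = 2"
      hence zq: "zr S q" using z0 by simp
      have d0q: "d0 < q" using d0 jj by simp
      define W where "W = (\<lambda>d. \<Sum>z\<in>{z. z < q ^ 2 \<and> z mod q = d}. V z)"
      have col: "cnt S q d = q * U d + p * W d" if "d < q" for d using UV(4) that jj by (simp add: W_def)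
      have tot: "q * cnt S q d = card S" if "d < q" for d using zr_prime_cnt[OF q S zq that] .
      have "q \<le> q * U d0" using d0(2) by simp
      hence "q \<le> cnt S q d0" unfolding col[OF d0q] by linarith
      moreover have "cnt S q d0 \<le> q" using tot[OF d0q] k q0 by (metis mult_le_cancel1 power2_eq_square)
      ultimately have "cnt S q d0 = q" by simp
      hence kq: "card S = q^2" using tot[OF d0q] by (simp add: power2_eq_square)
      have "W d = 0" if d: "d < q" for d
      proof -
        have c: "cnt S q d = q" using tot[OF d] kq q0 by (simp add: power2_eq_square)
        have "U d \<noteq> 0"
        proof
          assume "U d = 0"
          hence "q = p * W d" using col[OF d] c by simp
          hence "p dvd q" by simp
          thus False using p(1) q pq primes_dvd_imp_eq by blast
        qed
        hence "q * U d \<ge> q" by simp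
        hence "p * W d = 0" using col[OF d] c by linarith
        thus ?thesis using p0 by simp
      qed
      hence "V z = 0" if "z < q^2" for z
      proof -
        have "W (z mod q) = 0" using q0 by (intro \<open>\<And>d. d < q \<Longrightarrow> W d = 0\<close>) simp
        thus ?thesis using that finite_subset[of "{z'. z' < q^2 \<and> z' mod q = z mod q}" "{..<q^2}"]
          by (auto simp: W_def)
      qed
      hence "zr S (q^2)" using UV(3) jj by simp
      thus ?thesis using kq zq by simp
    next
      assume jj: "j0 = 2 \<and> j1 = 1"
      hence zq: "zr S (q^2)" using z0 by simp
      have U0: "U 0 > 0" using d0 jj by simp
      have ge: "q \<le> cnt S q z" if "z < q" for z
      proof -
        have "cnt S q z = U 0 + p * V z" using UV(1) that jj by simp
        hence "cnt S q z > 0" using U0 by simp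
        moreover have "q dvd cnt S q z" using zr_prime_sq_dvd_cnt[OF q S zq that] .
        ultimately show ?thesis by (simp add: dvd_imp_le)
      qed
      have tot: "card S = (\<Sum>z<q. cnt S q z)" using card_eq_sum_cnt[OF S q0] .
      have eq: "cnt S q z = q" if z: "z < q" for z
      proof (rule ccontr)
        assume "cnt S q z \<noteq> q"
        hence "q < cnt S q z" using ge[OF z] by simp
        hence "(\<Sum>z<q. q) < (\<Sum>z<q. cnt S q z)" using ge z by (intro sum_strict_mono_ex1) auto
        thus False using tot k by (simp add: power2_eq_square)
      qed
      hence "card S = q^2" using tot by (simp add: power2_eq_square)
      moreover have "zr S q" using eq zr_prime_iff[OF q S] by simp
      ultimately show ?thesis using zq by simp
    qed
  qed
qed

text \<open>The zero at \<open>q\<close> gives each column \<open>p * m = q * U + p * W\<close>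
  elements. So \<open>p\<close> divides \<open>U\<close>, and \<open>m < q\<close> leaves only
  \<open>U = 0\<close>. Then both pure \<open>p\<close>-powers are zeros and \<open>p^2\<close>
  divides the size, against \<open>m < p\<close>.\<close>

lemma zr_square_pattern_step:
  assumes p: "prime p" and q: "prime q" and pq: "p \<noteq> q" and S: "finite S"
    and i: "compl12 i0 i1"
    and z: "zr S (p ^ i0)" "zr S q" "zr S (p ^ i1 * q^2)"
    and k: "card S = p * q * m" "0 < m" "m < p" "m < q"
  shows False
proof -
  have q0: "q > 0" and p0: "p > 0" using p q by (auto simp: prime_gt_0_nat)
  have i1: "i1 > 0" using i by auto
  obtain U V where UV: 
    "(\<forall>d<q ^ (2 - 1). U d = 0) \<longrightarrow> zr S (p ^ i1)"
    "\<forall>d<q ^ (2 - 1).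
       cnt S (q ^ (2 - 1)) d = q * U d + p * (\<Sum>z\<in>{z. z < q ^ 2 \<and> z mod q ^ (2 - 1) = d}. V z)"
    using zr_two_marginal[OF p i1 q zero_less_numeral pq S z(3)] by blast
  have "U d = 0" if d: "d < q" for d
  proof (rule ccontr)
    assume "U d \<noteq> 0"
    define W where "W = (\<Sum>z\<in>{z. z < q ^ 2 \<and> z mod q = d}. V z)"
    have "q * cnt S q d = q * (p * m)" using zr_prime_cnt[OF q S z(2) d] k by (simp add: mult_ac)
    hence "p * m = q * U d + p * W" using UV(2) d q0 by (simp add: W_def)
    hence "p dvd q * U d" by (metis dvd_add_left_iff dvd_triv_left)
    hence "p dvd U d" using p q pq primes_dvd_imp_eq by (metis prime_dvd_mult_iff)
    hence "p \<le> U d" using \<open>U d \<noteq> 0\<close> by (simp add: dvd_imp_le)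
    hence "q * p \<le> q * U d" by simp
    hence "q * p \<le> p * m" using \<open>p * m = q * U d + p * W\<close> by linarith
    thus False using k(4) p0 by (simp add: mult.commute)
  qed
  hence "zr S (p ^ i1)" using UV(1) by simp
  hence "zr S p" "zr S (p^2)" using z(1) i by auto
  hence "p^2 dvd card S" by (rule zr_both_sq_dvd_card[OF p S])
  hence "p dvd q * m" using p0 by (simp add: k power2_eq_square mult.assoc)
  hence "p dvd m" using p q pq primes_dvd_imp_eq by (metis prime_dvd_mult_iff)
  thus False using k by (simp add: nat_dvd_not_less)
qed

text \<open>For sizes \<open>p q m\<close> with small \<open>m\<close>, a pure zero in each prime
  excludes a mixed zero at the complementary exponents. By symmetry only \<open>i0 = j0 = 2\<close>
  escapes the previous lemma. There row counts are divisible by \<open>p\<close> and column counts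
  by \<open>q\<close>; this forces \<open>p q\<close> to divide \<open>V\<close> and, since
  \<open>m < p\<close>, \<open>V = 0\<close>.\<close>

lemma zr_square_pattern:
  assumes p: "prime p" and q: "prime q" and pq: "p \<noteq> q" and S: "finite S"
    and i: "compl12 i0 i1"
    and j: "compl12 j0 j1"
    and z: "zr S (p ^ i0)" "zr S (q ^ j0)" "zr S (p ^ i1 * q ^ j1)"
    and k: "card S = p * q * m" "0 < m" "m < p" "m < q"
  shows False
proof -
  consider "j0 = 1 \<and> j1 = 2" | "i0 = 1 \<and> i1 = 2" | "i0 = 2" "i1 = 1" "j0 = 2" "j1 = 1"
    using i j by auto
  thus False
  proof cases
    case 1
    thus False using zr_square_pattern_step[OF p q pq S i z(1) _ _ k] z by simp
  next
    case 2
    have k': "card S = q * p * m" using k by simp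
    show False using zr_square_pattern_step[OF q p pq[symmetric] S j z(2) _ _ k' k(2,4,3)] 2 z
      by (simp add: mult.commute)
  next
    case 3
    have q0: "q > 0" and p0: "p > 0" using p q by (auto simp: prime_gt_0_nat)
    have cop: "coprime p q" using p q pq by (simp add: primes_coprime)
    obtain u v where uv: "\<forall>y<p. \<forall>z<q. cnt2 S p q y z = u y + v z" "\<exists>y<p. u y = (0::nat)"
      using zr_two_primes_decomp[OF p q pq S] z 3 by auto
    define U V where "U = (\<Sum>y<p. u y)" and "V = (\<Sum>z<q. v z)"
    have row: "cnt S p y = q * u y + V" if "y < p" for y
      using cnt_eq_sum_cnt2[OF S q0, of p y] uv that by (simp add: cnt2_commute V_def sum.distrib)
    have col: "cnt S q z = U + p * v z" if "z < q" for z
      using cnt_eq_sum_cnt2[OF S p0, of q z] uv that by (simp add: U_def sum.distrib)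
    have pr: "p dvd q * u y + V" if "y < p" for y
      using zr_prime_sq_dvd_cnt[OF p S _ that] z 3 row[OF that] by simp
    have qc: "q dvd U + p * v z" if "z < q" for z
      using zr_prime_sq_dvd_cnt[OF q S _ that] z 3 col[OF that] by simp
    \<comment> \<open>The normalised \<open>u\<close> vanishes in some row, whose count is then
      \<open>V\<close> itself.\<close>
    have pV: "p dvd V" using uv(2) pr by fastforce
    have "p dvd u y" if "y < p" for y
    proof -
      have "p dvd q * u y" using pr[OF that] pV by (simp add: dvd_add_left_iff)
      thus ?thesis using cop coprime_dvd_mult_right_iff by blast
    qed
    hence pU: "p dvd U" unfolding U_def by (intro dvd_sum) auto
    have tot: "p * q * m = q * U + p * V"
      using card_eq_sum_cnt[OF S p0] row k by (simp add: sum.distrib U_def sum_distrib_left)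
    have "q dvd p * V" using tot by (metis dvd_add_right_iff dvd_triv_left mult.assoc mult.left_commute)
    hence qV: "q dvd V" using cop coprime_dvd_mult_right_iff[of q p V] by (simp add: coprime_commute)
    obtain V' where V': "V = p * q * V'" using divides_mult[OF pV qV cop] by (auto elim: dvdE)
    obtain U' where U': "U = p * U'" using pU by (auto elim: dvdE)
    have "p * q * m = p * q * (U' + p * V')" using tot unfolding V' U' by (simp add: algebra_simps)
    hence "m = U' + p * V'" using p0 q0 by simp
    hence "V' = 0" using k(3) by (cases V') auto
    hence "V = 0" using V' by simp
    hence v0: "v z = 0" if "z < q" for z using that by (simp add: V_def)
    hence "cnt S q z = U" if "z < q" for z using col that by simp
    hence "zr S q" using zr_prime_iff[OF q S] by simp
    moreover have "zr S (q^2)" using z 3 by simp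
    ultimately have "q^2 dvd card S" by (rule zr_both_sq_dvd_card[OF q S])
    hence "q dvd p * m" using q0 by (simp add: k power2_eq_square mult_ac)
    hence "q dvd m" using cop coprime_dvd_mult_right_iff[of q p m] by (simp add: coprime_commute)
    thus False using k by (simp add: nat_dvd_not_less)
  qed
qed

text \<open>The zero at \<open>p^2 q^2\<close> makes every nonempty cell of the \<open>p\<close> by
  \<open>q\<close> table contain at least \<open>p\<close> elements. A row without empty cells would
  thus have \<open>p q > p^2\<close> elements. An empty cell in each row forces
  \<open>u = 0\<close>, so all rows have equal counts.\<close>

lemma zr_diagonal:
  assumes p: "prime p" and q: "prime q" and pq: "p < q" and S: "finite S"
    and z1: "zr S (p * q)" and z2: "zr S (p^2 * q^2)" and k: "card S \<le> p^2"
  shows "zr S p"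
proof -
  have q0: "q > 0" and p0: "p > 0" using p q by (auto simp: prime_gt_0_nat)
  have pq': "p \<noteq> q" using pq by simp
  have sq: "p * p = p^2" "q * q = q^2" by (simp_all add: power2_eq_square)
  obtain u v where uv: "\<forall>y<p. \<forall>z<q. cnt2 S p q y z = u y + (v z :: nat)"
    using zr_two_primes_decomp[OF p q pq' S z1] by blast
  obtain u2 v2 where uv2: "\<forall>y<p^2. \<forall>z<q^2. cnt2 S (p^2) (q^2) y z = u2 y (z mod q) + (v2 (y mod p) z :: nat)"
    using zr_two_decomp[OF p zero_less_numeral q zero_less_numeral pq' S z2] by auto
  have cell: "p \<le> cnt2 S p q y z" if yz: "y < p" "z < q" "cnt2 S p q y z > 0" for y z
  proof -
    define X where "X = {x\<in>S. x mod p = y \<and> x mod q = z}"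
    have finX: "finite X" using S by (simp add: X_def)
    from yz(3) obtain x where x: "x \<in> S" "x mod p = y" "x mod q = z"
      by (auto simp: cnt2_def card_gt_0_iff)
    define a b where "a = x mod p^2" and "b = x mod q^2"
    have ab: "a < p^2" "b < q^2" "a mod p = y" "b mod q = z"
      using p0 q0 x by (simp_all add: a_def b_def mod_mod_cancel)
    have "x \<in> {x\<in>S. x mod p^2 = a \<and> x mod q^2 = b}" using x by (simp add: a_def b_def)
    hence "cnt2 S (p^2) (q^2) a b > 0" unfolding cnt2_def using S by (auto simp: card_gt_0_iff)
    hence disj: "u2 a z > 0 \<or> v2 y b > 0" using uv2 ab by simp
    \<comment> \<open>A positive value of \<open>u2\<close> or \<open>v2\<close> does not change
      along a full coset of order \<open>q\<close> or \<open>p\<close>, so every class of that coset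
      contains an element.\<close>
    have hit: "\<exists>x\<in>X. x mod p^2 = a' \<and> x mod q^2 = b'"
      if ab': "a' < p^2" "b' < q^2" "a' mod p = y" "b' mod q = z" "u2 a' z > 0 \<or> v2 y b' > 0" for a' b'
    proof -
      have "cnt2 S (p^2) (q^2) a' b' > 0" using uv2 ab' by auto
      then obtain x' where "x' \<in> S" "x' mod p^2 = a'" "x' mod q^2 = b'" by (auto simp: cnt2_def card_gt_0_iff)
      moreover have "x' mod p = x' mod p^2 mod p" "x' mod q = x' mod q^2 mod q" by (simp_all add: mod_mod_cancel)
      ultimately show ?thesis using ab' by (intro bexI[of _ x']) (auto simp: X_def)
    qed
    from disj show ?thesis
    proof
      assume v: "v2 y b > 0"
      have "{a'. a' < p * p \<and> a' mod p = y} \<subseteq> (\<lambda>x. x mod p^2) ` X"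
        using hit[of _ b] v ab unfolding sq by blast
      hence "card {a'. a' < p * p \<and> a' mod p = y} \<le> card X" using finX by (rule surj_card_le[rotated])
      thus ?thesis using card_residue_class[OF yz(1), of p] by (simp add: X_def cnt2_def)
    next
      assume u: "u2 a z > 0"
      have "{b'. b' < q * q \<and> b' mod q = z} \<subseteq> (\<lambda>x. x mod q^2) ` X"
        using hit[of a] u ab unfolding sq by blast
      hence "card {b'. b' < q * q \<and> b' mod q = z} \<le> card X" using finX by (rule surj_card_le[rotated])
      hence "q \<le> card X" using card_residue_class[OF yz(2), of q] by simp
      thus ?thesis using pq by (simp add: X_def cnt2_def)
    qed
  qed
  have C: "\<exists>z<q. cnt2 S p q y z = 0" if y: "y < p" for y
  proof (rule ccontr)
    assume "\<not> ?thesis"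
    hence "\<forall>z<q. p \<le> cnt2 S p q y z" using cell y by blast
    hence "(\<Sum>z<q. p) \<le> (\<Sum>z<q. cnt2 S p q y z)" by (intro sum_mono) auto
    also have "\<dots> = cnt S p y" using cnt_eq_sum_cnt2[OF S q0, of p y] by (simp add: cnt2_commute)
    also have "\<dots> \<le> card S" unfolding cnt_def using S by (intro card_mono) auto
    finally have "q * p \<le> card S" by simp
    hence "q * p \<le> p * p" using k unfolding power2_eq_square by linarith
    thus False using pq p0 by simp
  qed
  hence "\<forall>y<p. u y = 0" using uv by fastforce
  hence "cnt S p y = (\<Sum>z<q. v z)" if "y < p" for y
    using cnt_eq_sum_cnt2[OF S q0, of p y] uv that by (simp add: cnt2_commute)
  thus ?thesis using zr_prime_iff[OF p S] by simp
qed

section \<open>Orders of differences and standard sets\<close>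

abbreviation ft :: "nat \<Rightarrow> nat set \<Rightarrow> int \<Rightarrow> complex" where
  "ft n S d \<equiv> \<Sum>x\<in>S. ru n (d * int x)"

text \<open>The order of \<^term>\<open>d\<close> in the group of integers modulo \<^term>\<open>n\<close>.\<close>

definition od :: "nat \<Rightarrow> int \<Rightarrow> nat" where
  "od n d = nat (int n div gcd d (int n))"

text \<open>After cancelling the gcd, the remaining multiplier is a unit modulo the order of
  \<open>d\<close>, and Galois invariance removes it.\<close>

lemma weighted_sum_od:
  assumes n: "n > 0"
  shows "(\<Sum>x\<in>A. of_int (w x) * ru n (d * f x)) = 0 \<longleftrightarrow> (\<Sum>x\<in>A. of_int (w x) * ru (od n d) (f x)) = 0"
proof -
  define g where "g = gcd d (int n)"
  have g: "g > 0" using n by (simp add: g_def)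
  obtain d' where d': "d = g * d'" using gcd_dvd1[of d "int n"] unfolding g_def by (elim dvdE)
  obtain n' where n': "int n = g * n'" using gcd_dvd2[of d "int n"] unfolding g_def by (elim dvdE)
  have n'0: "n' > 0" using n' g n by (metis of_nat_0_less_iff zero_less_mult_pos)
  have div: "int n div g = n'" "d div g = d'" using g by (simp_all add: n' d')
  hence od: "int (od n d) = n'" using n'0 by (simp add: od_def g_def)
  have "coprime d' n'" using div_gcd_coprime[of d "int n"] n div by (simp add: g_def)
  have "ru n (d * a) = ru (od n d) (d' * a)" for a
  proof -
    have "int n = int (nat g * od n d)" using g n' od by simp
    hence "n = nat g * od n d" by (simp only: of_nat_eq_iff)
    moreover have "d * a = int (nat g) * (d' * a)" using g d' by simp
    ultimately show ?thesis using g ru_scale[of "nat g" "od n d" "d' * a"] by (metis zero_less_nat_eq)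
  qed
  moreover have "od n d > 0" using od n'0 by linarith
  ultimately show ?thesis
    using galois_vanishing_sum_iff[of "od n d" d' w f A] \<open>coprime d' n'\<close> od by simp
qed

lemma sum_ru_eq_0_iff_zr: "n > 0 \<Longrightarrow> ft n S d = 0 \<longleftrightarrow> zr S (od n d)"
  using weighted_sum_od[of n "\<lambda>_. 1" d int S] by (simp add: zr_def)

text \<open>The \<open>p\<close>-part of the order of \<^term>\<open>d\<close> modulo \<open>p\<^sup>2q\<^sup>2\<close> is \<^term>\<open>p ^ tp p d\<close>.\<close>

definition tp :: "nat \<Rightarrow> int \<Rightarrow> nat" where
  "tp p d = (if int p ^ 2 dvd d then 0 else if int p dvd d then 1 else 2)"

lemma tp_cases: "tp p d = 0 \<or> tp p d = 1 \<or> tp p d = 2"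
  by (simp add: tp_def)

lemma tp_uminus [simp]: "tp p (- d) = tp p d" by (simp add: tp_def)

lemma int_power_dvd_iff: "p > 1 \<Longrightarrow> int p ^ a dvd int p ^ b \<longleftrightarrow> a \<le> b"
  unfolding of_nat_power[symmetric] int_dvd_int_iff
  using power_dvd_imp_le[of p a b] le_imp_power_dvd[of a b p] by blast

lemma gcd_prime_square:
  assumes "prime p" shows "gcd d (int p ^ 2) = int p ^ (2 - tp p d)"
proof -
  have "prime (int p)" using assms by simp
  moreover have "gcd d (int p ^ 2) dvd int p ^ 2" by simp
  ultimately obtain i where i: "i \<le> 2" "gcd d (int p ^ 2) = int p ^ i"
    by (metis divides_primepow gcd_ge_0_int normalize_idem normalize_int_def abs_of_nonneg normalize_gcd prime_ge_0_int zero_le_power)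
  have p1: "p > 1" using prime_gt_1_nat[OF assms] .
  have dv: "int p ^ j dvd d \<longleftrightarrow> j \<le> i" if "j \<le> 2" for j
  proof -
    have "int p ^ j dvd d \<longleftrightarrow> int p ^ j dvd gcd d (int p ^ 2)" using that by (auto simp: le_imp_power_dvd)
    also have "\<dots> \<longleftrightarrow> j \<le> i" unfolding i(2) using p1 by (rule int_power_dvd_iff)
    finally show ?thesis .
  qed
  have "tp p d = 2 - i" using dv[of 1] dv[of 2] i(1) by (auto simp: tp_def)
  hence "2 - tp p d = i" using i(1) by simp
  thus ?thesis using i(2) by simp
qed

lemma od_two_squares:
  assumes p: "prime p" and q: "prime q" and pq: "p \<noteq> q"
  shows "od (p^2 * q^2) d = p ^ tp p d * q ^ tp q d"
proof -
  have cop: "coprime (int p ^ 2) (int q ^ 2)" using primes_coprime[OF p q pq] by simp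
  have pos: "int p > 0" "int q > 0" using p q by (auto simp: prime_gt_0_nat)
  have "gcd d (int (p^2 * q^2)) = gcd d (int p ^ 2) * gcd d (int q ^ 2)"
  proof -
    obtain x y where xy: "gcd d (int p ^ 2 * int q ^ 2) = x * y" "x dvd int p ^ 2" "y dvd int q ^ 2"
      using dvd_productE[OF gcd_dvd2] by metis
    have "x dvd d" "y dvd d" using gcd_dvd1[of d "int p ^ 2 * int q ^ 2"] unfolding xy(1)
      by (auto dest: dvd_mult_left dvd_mult_right)
    hence "gcd d (int p ^ 2 * int q ^ 2) dvd gcd d (int p ^ 2) * gcd d (int q ^ 2)"
      unfolding xy(1) using xy(2,3) by (intro mult_dvd_mono gcd_greatest)
    moreover have "coprime (gcd d (int p ^ 2)) (gcd d (int q ^ 2))"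
      using cop by (meson coprime_divisors gcd_dvd2)
    hence "gcd d (int p ^ 2) * gcd d (int q ^ 2) dvd d" by (intro divides_mult) auto
    hence "gcd d (int p ^ 2) * gcd d (int q ^ 2) dvd gcd d (int p ^ 2 * int q ^ 2)"
      by (intro gcd_greatest mult_dvd_mono) auto
    ultimately have "gcd d (int p ^ 2 * int q ^ 2) = gcd d (int p ^ 2) * gcd d (int q ^ 2)"
      by (intro zdvd_antisym_nonneg) auto
    thus ?thesis by simp
  qed
  also have "\<dots> = int p ^ (2 - tp p d) * int q ^ (2 - tp q d)" by (simp add: gcd_prime_square p q)
  finally have g: "gcd d (int (p^2 * q^2)) = int p ^ (2 - tp p d) * int q ^ (2 - tp q d)" .
  have e: "a ^ 2 = a ^ tp p' d * a ^ (2 - tp p' d)" for a :: int and p'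
  proof -
    have "tp p' d + (2 - tp p' d) = 2" using tp_cases[of p' d] by auto
    thus ?thesis by (metis power_add)
  qed
  have "int (p^2 * q^2) = (int p ^ tp p d * int q ^ tp q d) * gcd d (int (p^2 * q^2))"
    unfolding g using e[of "int p" p] e[of "int q" q] by (simp add: mult_ac)
  moreover have "gcd d (int (p^2 * q^2)) \<noteq> 0" using g pos by simp
  ultimately have "int (p^2 * q^2) div gcd d (int (p^2 * q^2)) = int p ^ tp p d * int q ^ tp q d"
    by (metis nonzero_mult_div_cancel_right)
  thus ?thesis by (simp add: od_def nat_mult_distrib nat_power_eq)
qed

text \<open>Some difference of distinct elements of \<^term>\<open>X\<close> has order \<^term>\<open>p ^ i * q ^ j\<close>.\<close>

definition df :: "nat \<Rightarrow> nat \<Rightarrow> nat set \<Rightarrow> nat \<Rightarrow> nat \<Rightarrow> bool" where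
  "df p q X i j \<longleftrightarrow> (\<exists>x\<in>X. \<exists>y\<in>X. x \<noteq> y \<and> tp p (int x - int y) = i \<and> tp q (int x - int y) = j)"

lemma df_swap: "df p q X i j \<longleftrightarrow> df q p X j i"
  unfolding df_def by blast

lemma zr_1: "finite S \<Longrightarrow> zr S 1 \<longleftrightarrow> S = {}"
  by (simp add: zr_def ru_def)

text \<open>The set \<^term>\<open>stdp p P\<close> has \<^term>\<open>p ^ card P\<close> elements, whose differences modulo \<open>p\<^sup>2\<close> have
  orders \<^term>\<open>p ^ i\<close> with \<^term>\<open>i \<in> P\<close> only; \<open>nz P i\<close> says that it has no zero at \<^term>\<open>p ^ i\<close>.\<close>

definition stdp :: "nat \<Rightarrow> nat set \<Rightarrow> nat set" where
  "stdp p P = (if 1 \<in> P then if 2 \<in> P then {..<p^2} else (\<lambda>t. p * t) ` {..<p}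
               else if 2 \<in> P then {..<p} else {0})"

definition nz :: "nat set \<Rightarrow> nat \<Rightarrow> bool" where
  "nz P i \<longleftrightarrow> i = 0 \<or> P = {} \<or> P = {i}"

lemma finite_stdp [simp]: "finite (stdp p P)" by (simp add: stdp_def)

lemma subset_12_cases:
  assumes "P \<subseteq> {1, 2::nat}"
  obtains "P = {}" | "P = {1}" | "P = {2}" | "P = {1, 2}"
proof (cases "1 \<in> P"; cases "2 \<in> P")
  assume "1 \<in> P" "2 \<in> P"
  hence "P = {1, 2}" using assms by blast
  thus ?thesis by (rule that(4))
next
  assume "1 \<in> P" "2 \<notin> P"
  hence "P = {1}" using assms by blast
  thus ?thesis by (rule that(2))
next
  assume "1 \<notin> P" "2 \<in> P"
  hence "P = {2}" using assms by blast
  thus ?thesis by (rule that(3))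
next
  assume "1 \<notin> P" "2 \<notin> P"
  hence "P = {}" using assms by blast
  thus ?thesis by (rule that(1))
qed

lemma card_stdp: assumes "prime p" "P \<subseteq> {1, 2}" shows "card (stdp p P) = p ^ card P"
  using assms(2)
proof (cases rule: subset_12_cases)
  case 2
  have "inj_on (\<lambda>t. p * t) {..<p}" using prime_gt_0_nat[OF assms(1)] by (auto simp: inj_on_def)
  thus ?thesis using 2 by (simp add: stdp_def card_image)
qed (simp_all add: stdp_def power2_eq_square)

lemma tp_stdp:
  assumes p: "prime p" and P: "P \<subseteq> {1, 2}" and a: "a \<in> stdp p P" "b \<in> stdp p P" "a \<noteq> b"
  shows "tp p (int a - int b) \<in> P"
proof -
  have p0: "p > 0" using p by (rule prime_gt_0_nat)
  have small: "\<not> int n dvd int x - int y" if "x < n" "y < n" "x \<noteq> y" for n x y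
    using that by (metis cong_iff_dvd_diff cong_int_iff cong_less_modulus_unique_nat)
  from P show ?thesis
  proof (cases rule: subset_12_cases)
    case 1
    thus ?thesis using a by (simp add: stdp_def)
  next
    case 2
    then obtain x y where xy: "a = p * x" "b = p * y" "x < p" "y < p" using a by (auto simp: stdp_def)
    hence e: "int a - int b = int p * (int x - int y)" by (simp add: algebra_simps)
    have "\<not> int p dvd int x - int y" using xy a(3) by (intro small) auto
    hence "\<not> int p ^ 2 dvd int a - int b" using p0 unfolding e power2_eq_square by simp
    thus ?thesis using 2 e by (simp add: tp_def)
  next
    case 3
    hence "\<not> int p dvd int a - int b" using a by (intro small) (auto simp: stdp_def)
    moreover have "int p dvd int p ^ 2" by (simp add: power2_eq_square)
    ultimately show ?thesis using 3 by (auto simp: tp_def dest: dvd_trans)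
  next
    case 4
    hence "\<not> int (p^2) dvd int a - int b" using a by (intro small) (auto simp: stdp_def)
    thus ?thesis using 4 by (simp add: tp_def)
  qed
qed

lemma zr_stdp:
  assumes p: "prime p" and P: "P \<subseteq> {1, 2}" and i: "i \<le> 2"
  shows "zr (stdp p P) (p ^ i) \<longleftrightarrow> \<not> nz P i"
proof -
  have p0: "p > 0" and p1: "p > 1" using prime_gt_0_nat[OF p] prime_gt_1_nat[OF p] .
  have pp: "p < p * p" using p1 by simp
  have iff1: "zr S p \<longleftrightarrow> (\<forall>y<p. \<forall>y'<p. cnt S p y = cnt S p y')" if "finite S" for S
    using zr_prime_iff[OF p that] .
  have iff2: "zr S (p^2) \<longleftrightarrow> (\<forall>y<p^2. \<forall>y'<p^2. y mod p = y' mod p \<longrightarrow> cnt S (p^2) y = cnt S (p^2) y')"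
    if "finite S" for S using zr_prime_power[OF p zero_less_numeral that] by simp
  have not1: "\<not> zr S p" if "finite S" "cnt S p 0 \<noteq> cnt S p 1" for S
    using iff1[OF that(1)] that(2) p0 p1 by blast
  \<comment> \<open>Residues 0 and \<open>p\<close> agree modulo \<open>p\<close>, so unequal counts
    there break the periodicity required by a zero at \<open>p^2\<close>.\<close>
  have not2: "\<not> zr S (p^2)" if "finite S" "cnt S (p^2) 0 \<noteq> cnt S (p^2) p" for S
  proof -
    have "0 < p^2" "p < p^2" "0 mod p = p mod p" using p0 pp by (simp_all add: power2_eq_square)
    thus ?thesis using iff2[OF that(1)] that(2) by blast
  qed
  have single: "cnt S n y = (if y \<in> S then 1 else 0)" if "S \<subseteq> {..<n}" "y < n" for S n y
  proof -
    have "{x\<in>S. x mod n = y} = (if y \<in> S then {y} else {})" using that by auto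
    thus ?thesis by (simp add: cnt_def)
  qed
  consider "i = 0" | "i = 1" | "i = 2" using i by linarith
  thus ?thesis
  proof cases
    case 1
    have "card (stdp p P) > 0" using card_stdp[OF p P] p0 by simp
    hence "stdp p P \<noteq> {}" by auto
    thus ?thesis using 1 zr_1[of "stdp p P"] by (simp add: nz_def)
  next
    case i: 2
    from P show ?thesis
    proof (cases rule: subset_12_cases)
      case 1
      have "cnt {0} p 0 = 1" "cnt {0} p 1 = 0" using p1 by (auto simp: single)
      hence "\<not> zr {0} p" by (intro not1) simp_all
      thus ?thesis using 1 i by (simp add: stdp_def nz_def)
    next
      case 2
      define S where "S = (\<lambda>t. p * t) ` {..<p}"
      have *: "{x\<in>S. x mod p = 1} = {}" "0 \<in> {x\<in>S. x mod p = 0}" "finite S" using p1 by (auto simp: S_def)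
      have "cnt S p 1 = 0" unfolding cnt_def *(1) by simp
      moreover have "cnt S p 0 \<noteq> 0" unfolding cnt_def using *(2,3) by (subst card_0_eq) auto
      ultimately have "\<not> zr S p" using *(3) by (intro not1) simp_all
      thus ?thesis using 2 i by (simp add: stdp_def nz_def S_def)
    next
      case 3
      have "zr {..<p} p" using iff1[of "{..<p}"] by (simp add: single)
      thus ?thesis using 3 i by (simp add: stdp_def nz_def)
    next
      case 4
      have "zr {..<p^2} p"
      proof -
        have "cnt {..<p^2} p y = p" if "y < p" for y
          using card_residue_class[OF that, of p] by (simp add: cnt_def power2_eq_square)
        thus ?thesis using iff1[of "{..<p^2}"] by simp
      qed
      thus ?thesis using 4 i by (auto simp: stdp_def nz_def)
    qed
  next
    case i: 3
    from P show ?thesis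
    proof (cases rule: subset_12_cases)
      case 1
      have "cnt {0} (p^2) 0 = 1" "cnt {0} (p^2) p = 0" using p1 pp by (auto simp: single power2_eq_square)
      hence "\<not> zr {0} (p^2)" by (intro not2) simp_all
      thus ?thesis using 1 i by (simp add: stdp_def nz_def)
    next
      case 2
      define S where "S = (\<lambda>t. p * t) ` {..<p}"
      have S: "S \<subseteq> {..<p^2}" using p0 by (auto simp: S_def power2_eq_square)
      have memS: "y \<in> S \<longleftrightarrow> y mod p = 0" if "y < p^2" for y
      proof
        assume "y mod p = 0"
        then obtain t where "y = p * t" by auto
        moreover from this have "t < p" using that p0 by (simp add: power2_eq_square)
        ultimately show "y \<in> S" by (simp add: S_def)
      qed (auto simp: S_def)
      have "finite S" by (simp add: S_def)
      hence "zr S (p^2)" using iff2 S memS by (simp add: single)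
      thus ?thesis using 2 i by (simp add: stdp_def nz_def S_def)
    next
      case 3
      have "{..<p} \<subseteq> {..<p^2}" using pp by (auto simp: power2_eq_square)
      hence "cnt {..<p} (p^2) 0 = 1" "cnt {..<p} (p^2) p = 0" using p1 pp by (auto simp: single power2_eq_square)
      hence "\<not> zr {..<p} (p^2)" by (intro not2) simp_all
      thus ?thesis using 3 i by (simp add: stdp_def nz_def)
    next
      case 4
      have "zr {..<p^2} (p^2)" using iff2[of "{..<p^2}"] by (simp add: single)
      thus ?thesis using 4 i by (auto simp: stdp_def nz_def)
    qed
  qed
qed

text \<open>The factors \<open>q^2\<close> and \<open>p^2\<close> embed the two prime components of
  the cyclic group of order \<open>p^2 q^2\<close>. Elements are not reduced modulo
  \<open>p^2 q^2\<close>, since only differences and exponential sums matter.\<close>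

definition std :: "nat \<Rightarrow> nat \<Rightarrow> nat set \<Rightarrow> nat set \<Rightarrow> nat set" where
  "std p q P Q = (\<lambda>(a, b). q^2 * a + p^2 * b) ` (stdp p P \<times> stdp q Q)"

lemma tp_combination:
  assumes "prime p" "prime q" "p \<noteq> q"
  shows "tp p (int q ^ 2 * a + int p ^ 2 * b) = tp p a"
proof -
  have cop: "coprime (int p) (int q ^ 2)" "coprime (int p ^ 2) (int q ^ 2)"
    using primes_coprime[OF assms] by simp_all
  have "int p ^ 2 dvd int q ^ 2 * a + int p ^ 2 * b \<longleftrightarrow> int p ^ 2 dvd a"
    using cop by (simp add: dvd_add_left_iff coprime_dvd_mult_right_iff)
  moreover have "int p dvd int p ^ 2 * b" by (simp add: power2_eq_square)
  hence "int p dvd int q ^ 2 * a + int p ^ 2 * b \<longleftrightarrow> int p dvd a"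
    using cop by (simp add: dvd_add_left_iff coprime_dvd_mult_right_iff)
  ultimately show ?thesis by (simp add: tp_def)
qed

lemma std_diff:
  assumes "prime p" "prime q" "p \<noteq> q"
  shows "tp p (int (q^2 * a + p^2 * b) - int (q^2 * a' + p^2 * b')) = tp p (int a - int a')"
    and "tp q (int (q^2 * a + p^2 * b) - int (q^2 * a' + p^2 * b')) = tp q (int b - int b')"
proof -
  have e: "int (q^2 * a + p^2 * b) - int (q^2 * a' + p^2 * b') = int q ^ 2 * (int a - int a') + int p ^ 2 * (int b - int b')"
    by (simp add: algebra_simps)
  show "tp p (int (q^2 * a + p^2 * b) - int (q^2 * a' + p^2 * b')) = tp p (int a - int a')"
    unfolding e by (rule tp_combination[OF assms])
  show "tp q (int (q^2 * a + p^2 * b) - int (q^2 * a' + p^2 * b')) = tp q (int b - int b')"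
    unfolding e add.commute[of "int q ^ 2 * _"] using assms by (intro tp_combination) auto
qed

lemma tp_0 [simp]: "tp p 0 = 0" by (simp add: tp_def)

lemma inj_on_std:
  assumes pq: "prime p" "prime q" "p \<noteq> q" and P: "P \<subseteq> {1, 2}" "Q \<subseteq> {1, 2}"
  shows "inj_on (\<lambda>(a, b). q^2 * a + p^2 * b) (stdp p P \<times> stdp q Q)"
proof (rule inj_onI, clarsimp)
  fix a b a' b' assume ab: "a \<in> stdp p P" "b \<in> stdp q Q" "a' \<in> stdp p P" "b' \<in> stdp q Q"
    "q^2 * a + p^2 * b = q^2 * a' + p^2 * b'"
  have "tp p (int a - int a') = 0" "tp q (int b - int b') = 0"
    using std_diff[OF pq, of a b a' b'] ab(5) by simp_all
  moreover have "0 \<notin> P" "0 \<notin> Q" using P by auto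
  ultimately show "a = a' \<and> b = b'" using tp_stdp[OF pq(1) P(1), of a a'] tp_stdp[OF pq(2) P(2), of b b'] ab by metis
qed

lemma card_std:
  assumes pq: "prime p" "prime q" "p \<noteq> q" and P: "P \<subseteq> {1, 2}" "Q \<subseteq> {1, 2}"
  shows "card (std p q P Q) = p ^ card P * q ^ card Q"
  unfolding std_def card_image[OF inj_on_std[OF assms]] card_cartesian_product
  using card_stdp[OF pq(1) P(1)] card_stdp[OF pq(2) P(2)] by simp

lemma finite_std [simp]: "finite (std p q P Q)" by (simp add: std_def)

lemma df_std:
  assumes pq: "prime p" "prime q" "p \<noteq> q" and P: "P \<subseteq> {1, 2}" "Q \<subseteq> {1, 2}"
    and x: "x \<in> std p q P Q" "y \<in> std p q P Q"
  shows "tp p (int x - int y) \<in> insert 0 P" "tp q (int x - int y) \<in> insert 0 Q"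
    "x \<noteq> y \<Longrightarrow> tp p (int x - int y) \<noteq> 0 \<or> tp q (int x - int y) \<noteq> 0"
proof -
  from x obtain a b a' b' where ab: "a \<in> stdp p P" "b \<in> stdp q Q" "a' \<in> stdp p P" "b' \<in> stdp q Q"
    "x = q^2 * a + p^2 * b" "y = q^2 * a' + p^2 * b'" by (auto simp: std_def)
  have e: "tp p (int x - int y) = tp p (int a - int a')" "tp q (int x - int y) = tp q (int b - int b')"
    unfolding ab(5,6) by (rule std_diff[OF pq])+
  have 1: "a = a' \<or> tp p (int a - int a') \<in> P" "b = b' \<or> tp q (int b - int b') \<in> Q"
    using tp_stdp[OF pq(1) P(1) ab(1,3)] tp_stdp[OF pq(2) P(2) ab(2,4)] by blast+
  show "tp p (int x - int y) \<in> insert 0 P" "tp q (int x - int y) \<in> insert 0 Q" unfolding e using 1 by auto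
  have "0 \<notin> P" "0 \<notin> Q" using P by auto
  thus "x \<noteq> y \<Longrightarrow> tp p (int x - int y) \<noteq> 0 \<or> tp q (int x - int y) \<noteq> 0"
    unfolding e using 1 ab(5,6) by metis
qed

text \<open>The exponential sum factors over the product, and in each factor the embedding leaves a
  unit multiplier that Galois invariance removes.\<close>

lemma zr_std:
  assumes pq: "prime p" "prime q" "p \<noteq> q" and P: "P \<subseteq> {1, 2}" "Q \<subseteq> {1, 2}" and ij: "i \<le> 2" "j \<le> 2"
  shows "zr (std p q P Q) (p ^ i * q ^ j) \<longleftrightarrow> \<not> nz P i \<or> \<not> nz Q j"
proof -
  define d where "d = p ^ i * q ^ j"
  have p0: "p > 0" and q0: "q > 0" using pq by (auto simp: prime_gt_0_nat)
  have cop: "coprime p q" using primes_coprime[OF pq] .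
  have A: "(\<Sum>a\<in>X. ru d (int (q^2 * a))) = 0 \<longleftrightarrow> zr X (p ^ i)"  for X
  proof -
    have "q^2 = q ^ j * q ^ (2 - j)" using ij by (simp flip: power_add)
    hence "ru d (int (q^2 * a)) = ru (p ^ i) (int (q ^ (2 - j)) * int a)" for a
      using ru_scale[of "q ^ j" "p ^ i" "int (q ^ (2 - j)) * int a"] q0 by (simp add: d_def mult_ac)
    thus ?thesis using galois_vanishing_sum_iff[of "p ^ i" "int (q ^ (2 - j))" "\<lambda>_. 1" int X] p0 cop
      by (simp add: zr_def coprime_commute)
  qed
  have B: "(\<Sum>b\<in>X. ru d (int (p^2 * b))) = 0 \<longleftrightarrow> zr X (q ^ j)" for X
  proof -
    have "p^2 = p ^ i * p ^ (2 - i)" using ij by (simp flip: power_add)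
    hence "ru d (int (p^2 * b)) = ru (q ^ j) (int (p ^ (2 - i)) * int b)" for b
      using ru_scale[of "p ^ i" "q ^ j" "int (p ^ (2 - i)) * int b"] p0 by (simp add: d_def mult_ac)
    thus ?thesis using galois_vanishing_sum_iff[of "q ^ j" "int (p ^ (2 - i))" "\<lambda>_. 1" int X] q0 cop
      by (simp add: zr_def)
  qed
  have "(\<Sum>x\<in>std p q P Q. ru d (int x)) = (\<Sum>(a, b)\<in>stdp p P \<times> stdp q Q. ru d (int (q^2 * a)) * ru d (int (p^2 * b)))"
    unfolding std_def by (subst sum.reindex[OF inj_on_std[OF pq P]]) (simp add: case_prod_beta ru_add)
  also have "\<dots> = (\<Sum>a\<in>stdp p P. ru d (int (q^2 * a))) * (\<Sum>b\<in>stdp q Q. ru d (int (p^2 * b)))"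
    by (simp add: sum_product sum.cartesian_product)
  finally have "zr (std p q P Q) d \<longleftrightarrow>
    (\<Sum>a\<in>stdp p P. ru d (int (q^2 * a))) = 0 \<or> (\<Sum>b\<in>stdp q Q. ru d (int (p^2 * b))) = 0"
    unfolding zr_def by (simp only: mult_eq_0_iff)
  hence "zr (std p q P Q) d \<longleftrightarrow> zr (stdp p P) (p ^ i) \<or> zr (stdp q Q) (q ^ j)"
    by (simp only: A B)
  thus ?thesis using zr_stdp[OF pq(1) P(1) ij(1)] zr_stdp[OF pq(2) P(2) ij(2)] by (simp add: d_def)
qed

text \<open>The hypothesis makes addition injective from \<open>X\<close> times \<open>C\<close>
  into the residues modulo \<open>n\<close>. With equality it is a bijection, so the product of the
  transforms is that of the whole group, which vanishes at nonzero frequencies.\<close>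

lemma packing:
  assumes n: "n > 0" and fin: "finite X" "finite C"
    and inj: "\<And>x x' c c'. x \<in> X \<Longrightarrow> x' \<in> X \<Longrightarrow> c \<in> C \<Longrightarrow> c' \<in> C \<Longrightarrow>
      int n dvd (int x - int x') + (int c - int c') \<Longrightarrow> x = x' \<and> c = c'"
  shows "card X * card C \<le> n"
    and "card X * card C = n \<Longrightarrow> \<not> int n dvd d \<Longrightarrow>
      ft n X d = 0 \<or> ft n C d = 0"
proof -
  define f where "f = (\<lambda>(x, c). (x + c) mod n)"
  have inj': "inj_on f (X \<times> C)"
  proof (rule inj_onI)
    fix s s' assume s: "s \<in> X \<times> C" "s' \<in> X \<times> C" "f s = f s'"
    obtain x c where e1: "s = (x, c)" by (cases s)
    obtain x' c' where e2: "s' = (x', c')" by (cases s')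
    note e = e1 e2
    have *: "x \<in> X" "c \<in> C" "x' \<in> X" "c' \<in> C" "f (x, c) = f (x', c')" using s e by auto
    from *(5) have "[x + c = x' + c'] (mod n)" by (simp add: f_def cong_def)
    hence "[int (x + c) = int (x' + c')] (mod int n)" by (simp only: cong_int_iff)
    hence "int n dvd (int x - int x') + (int c - int c')" by (simp add: cong_iff_dvd_diff algebra_simps)
    thus "s = s'" using inj[OF *(1,3,2,4)] e by simp
  qed
  have sub: "f ` (X \<times> C) \<subseteq> {..<n}" using n by (auto simp: f_def)
  have c: "card (f ` (X \<times> C)) = card X * card C" using card_image[OF inj'] by (simp add: card_cartesian_product)
  show "card X * card C \<le> n" using card_mono[OF _ sub] c by simp
  assume eq: "card X * card C = n" and d: "\<not> int n dvd d"
  have "f ` (X \<times> C) = {..<n}" using sub eq c by (intro card_subset_eq) auto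
  hence bij: "bij_betw f (X \<times> C) {..<n}" using inj' by (simp add: bij_betw_def)
  have "ft n X d * ft n C d = (\<Sum>xc\<in>X \<times> C. ru n (int (f xc) * d))"
  proof -
    have "ru n (d * int x) * ru n (d * int c) = ru n (int (f (x, c)) * d)" for x c
    proof -
      have "[int (x + c) * d = int ((x + c) mod n) * d] (mod int n)"
        by (intro cong_mult) (simp_all add: cong_def of_nat_mod)
      hence "ru n (int (x + c) * d) = ru n (int ((x + c) mod n) * d)" by (rule ru_cong[OF n])
      thus ?thesis by (simp add: f_def ru_add[symmetric] algebra_simps)
    qed
    thus ?thesis by (simp add: sum_product sum.cartesian_product case_prod_beta)
  qed
  also have "\<dots> = (\<Sum>v<n. ru n (int v * d))" by (rule sum.reindex_bij_betw[OF bij])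
  also have "\<dots> = 0" using d by (simp add: sum_ru[OF n])
  finally show "ft n X d = 0 \<or> ft n C d = 0" by simp
qed

lemma int_dvd_two_squares_iff:
  assumes "prime p" "prime q" "p \<noteq> q"
  shows "int (p^2 * q^2) dvd d \<longleftrightarrow> tp p d = 0 \<and> tp q d = 0"
proof -
  have "coprime (int p ^ 2) (int q ^ 2)" using primes_coprime[OF assms] by simp
  hence "int p ^ 2 * int q ^ 2 dvd d \<longleftrightarrow> int p ^ 2 dvd d \<and> int q ^ 2 dvd d"
    by (meson divides_mult dvd_mult_left dvd_mult_right)
  thus ?thesis by (simp add: tp_def)
qed

lemma tp_of_pair:
  assumes "prime p" "prime q" "p \<noteq> q" "i \<le> 2"
  shows "tp p (int (p ^ (2 - i) * q ^ j)) = i"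
proof -
  have cop: "coprime (int p ^ a) (int q ^ j)" for a using primes_coprime[OF assms(1-3)] by simp
  have p1: "p > 1" using prime_gt_1_nat[OF assms(1)] .
  have "int p ^ a dvd int (p ^ (2 - i) * q ^ j) \<longleftrightarrow> a \<le> 2 - i" for a
  proof -
    have "int p ^ a dvd int p ^ (2 - i) * int q ^ j \<longleftrightarrow> int p ^ a dvd int p ^ (2 - i)"
      using cop by (rule coprime_dvd_mult_left_iff)
    also have "\<dots> \<longleftrightarrow> a \<le> 2 - i" using p1 by (rule int_power_dvd_iff)
    finally show ?thesis by simp
  qed
  from this[of 1] this[of 2] show ?thesis using assms(4) by (auto simp: tp_def)
qed

lemma ex_tp_pair:
  assumes pq: "prime p" "prime q" "p \<noteq> q" and ij: "i \<le> 2" "j \<le> 2"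
  shows "\<exists>d. tp p d = i \<and> tp q d = j"
  using tp_of_pair[OF pq ij(1), of "2 - j"] tp_of_pair[OF pq(2,1) pq(3)[symmetric] ij(2), of "2 - i"]
  unfolding mult.commute[of "q ^ (2 - j)"] by blast

text \<open>If \<open>X\<close> has no difference whose order has exponents in
  \<open>insert 0 P\<close> and \<open>insert 0 Q\<close>, then \<open>X\<close> packs against
  \<open>std p q P Q\<close>, whose differences have only such orders. In the extremal case
  \<open>X\<close> must vanish wherever the standard set does not.\<close>

lemma pack:
  assumes pq: "prime p" "prime q" "p \<noteq> q" and P: "P \<subseteq> {1, 2}" "Q \<subseteq> {1, 2}" and X: "finite X"
    and nd: "\<And>i j. i \<in> insert 0 P \<Longrightarrow> j \<in> insert 0 Q \<Longrightarrow> \<not> df p q X i j"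
  shows "card X * (p ^ card P * q ^ card Q) \<le> p^2 * q^2"
    and "card X * (p ^ card P * q ^ card Q) = p^2 * q^2 \<Longrightarrow> i \<le> 2 \<Longrightarrow> j \<le> 2 \<Longrightarrow> i \<noteq> 0 \<or> j \<noteq> 0 \<Longrightarrow>
      nz P i \<Longrightarrow> nz Q j \<Longrightarrow> zr X (p ^ i * q ^ j)"
proof -
  define n where "n = p^2 * q^2"
  define C where "C = std p q P Q"
  have n: "n > 0" using pq by (simp add: n_def prime_gt_0_nat)
  have inj: "x = x' \<and> c = c'" if *: "x \<in> X" "x' \<in> X" "c \<in> C" "c' \<in> C"
     "int n dvd (int x - int x') + (int c - int c')" for x x' c c'
  proof -
    have eq: "tp s (int x - int x') = tp s (int c - int c')" if "s = p \<or> s = q" for s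
    proof -
      have "int s ^ 2 dvd int n" using that by (auto simp: n_def)
      then obtain k where "(int x - int x') + (int c - int c') = int s ^ 2 * k" using *(5) by (meson dvdE dvd_trans)
      hence "int x - int x' = - (int c - int c') + int s ^ 2 * k" by simp
      \<comment> \<open>The type sees its argument only modulo \<open>s^2\<close>, so colliding
        differences of \<open>X\<close> and \<open>C\<close> have the same type.\<close>
      moreover have "tp s (a + int s ^ 2 * k) = tp s a" for a
        by (simp add: tp_def dvd_add_left_iff power2_eq_square mult.assoc)
      ultimately show ?thesis by (metis tp_uminus)
    qed
    have "x = x'"
    proof (rule ccontr)
      assume "x \<noteq> x'"
      hence "df p q X (tp p (int x - int x')) (tp q (int x - int x'))" using *(1,2) by (auto simp: df_def)
      thus False using nd df_std(1,2)[OF pq P] *(3,4) eq unfolding C_def by metis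
    qed
    moreover from this have "tp p (int c - int c') = 0" "tp q (int c - int c') = 0" using eq[of p] eq[of q] by simp_all
    hence "c = c'" using df_std(3)[OF pq P] *(3,4) unfolding C_def by metis
    ultimately show ?thesis by simp
  qed
  have cC: "card C = p ^ card P * q ^ card Q" unfolding C_def by (rule card_std[OF pq P])
  have finC: "finite C" by (simp add: C_def)
  show "card X * (p ^ card P * q ^ card Q) \<le> p^2 * q^2"
    using packing(1)[OF n X finC inj] by (simp only: cC n_def)
  assume *: "card X * (p ^ card P * q ^ card Q) = p^2 * q^2" "i \<le> 2" "j \<le> 2" "i \<noteq> 0 \<or> j \<noteq> 0" "nz P i" "nz Q j"
  obtain d where t: "tp p d = i" "tp q d = j" using ex_tp_pair[OF pq *(2,3)] by blast
  have od: "od n d = p ^ i * q ^ j" using od_two_squares[OF pq, of d] t by (simp add: n_def)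
  have "\<not> int n dvd d" using int_dvd_two_squares_iff[OF pq, of d] t *(4) by (simp only: n_def) auto
  from packing(2)[OF n X finC inj _ this] have "zr X (od n d) \<or> zr C (od n d)"
    using *(1) by (simp only: cC n_def[symmetric] sum_ru_eq_0_iff_zr[OF n]) 
  thus "zr X (p ^ i * q ^ j)" using zr_std[OF pq P *(2,3)] *(5,6) by (simp add: od C_def)
qed

section \<open>Spectral pairs modulo $p^2q^2$\<close>

text \<open>A whole family \<^term>\<open>F\<close> with one spectrum \<^term>\<open>L\<close> is treated at once, since a tiling complement common
  to all members is needed. The predicate \<open>good\<close> expresses (T1) and (T2) with exponent sets that
  do not depend on the member.\<close>

definition fam :: "nat \<Rightarrow> nat \<Rightarrow> nat set \<Rightarrow> nat set set \<Rightarrow> nat \<Rightarrow> bool" where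
  "fam p q L F k \<longleftrightarrow> prime p \<and> prime q \<and> p \<noteq> q \<and> k > 0 \<and> finite L \<and> card L = k \<and> F \<noteq> {} \<and>
     (\<forall>S\<in>F. finite S \<and> card S = k \<and>
        (\<forall>i j. df p q L i j \<longrightarrow> zr S (p ^ i * q ^ j)) \<and> (\<forall>i j. df p q S i j \<longrightarrow> zr L (p ^ i * q ^ j)))"

definition good :: "nat \<Rightarrow> nat \<Rightarrow> nat set set \<Rightarrow> nat \<Rightarrow> bool" where
  "good p q F k \<longleftrightarrow> (\<exists>P\<subseteq>{1, 2}. \<exists>Q\<subseteq>{1, 2}. k = p ^ card P * q ^ card Q \<and>
     (\<forall>S\<in>F. \<forall>i\<in>insert 0 P. \<forall>j\<in>insert 0 Q. i \<noteq> 0 \<or> j \<noteq> 0 \<longrightarrow> zr S (p ^ i * q ^ j)))"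

lemma goodI:
  assumes "P \<subseteq> {1, 2}" "Q \<subseteq> {1, 2}" "k = p ^ card P * q ^ card Q"
    "\<And>S i j. S \<in> F \<Longrightarrow> i \<in> insert 0 P \<Longrightarrow> j \<in> insert 0 Q \<Longrightarrow> i \<noteq> 0 \<or> j \<noteq> 0 \<Longrightarrow> zr S (p ^ i * q ^ j)"
  shows "good p q F k"
  unfolding good_def
  by (rule exI[of _ P], rule conjI, rule assms(1), rule exI[of _ Q], intro conjI ballI impI assms)

lemma fam_swap:
  assumes "fam p q L F k"
  shows "fam q p L F k"
proof -
  have sw: "zr Y (q ^ i * p ^ j)" if "df q p X i j" "\<forall>i j. df p q X i j \<longrightarrow> zr Y (p ^ i * q ^ j)" for X Y i j
    using that df_swap[of q p X i j] unfolding mult.commute[of "q ^ i"] by blast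
  show ?thesis unfolding fam_def
    by (intro conjI ballI allI impI; (rule sw, assumption)?) (use assms in \<open>unfold fam_def, blast\<close>)+
qed

lemma good_swap:
  assumes "good p q F k"
  shows "good q p F k"
proof -
  from assms obtain P Q where PQ: "P \<subseteq> {1, 2}" "Q \<subseteq> {1, 2}" "k = p ^ card P * q ^ card Q"
    "\<forall>S\<in>F. \<forall>i\<in>insert 0 P. \<forall>j\<in>insert 0 Q. i \<noteq> 0 \<or> j \<noteq> 0 \<longrightarrow> zr S (p ^ i * q ^ j)"
    unfolding good_def by blast
  show ?thesis
  proof (rule goodI[OF PQ(2,1)])
    show "k = q ^ card Q * p ^ card P" using PQ(3) by simp
    show "zr S (q ^ i * p ^ j)" if "S \<in> F" "i \<in> insert 0 Q" "j \<in> insert 0 P" "i \<noteq> 0 \<or> j \<noteq> 0" for S i j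
      using PQ(4) that unfolding mult.commute[of "q ^ i"] by blast
  qed
qed

lemma good_q2:
  assumes "k = q^2" "\<And>S. S \<in> F \<Longrightarrow> zr S q \<and> zr S (q^2)"
  shows "good p q F k"
proof (rule goodI[OF empty_subsetI subset_refl])
  show "zr S (p ^ i * q ^ j)" if "S \<in> F" "i \<in> insert 0 {}" "j \<in> insert 0 {1, 2}" "i \<noteq> 0 \<or> j \<noteq> 0" for S i j
    using that assms(2)[OF that(1)] by auto
qed (simp add: assms(1) power2_eq_square)

lemma good_p2:
  assumes "k = p^2" "\<And>S. S \<in> F \<Longrightarrow> zr S p \<and> zr S (p^2)"
  shows "good p q F k"
  by (rule good_swap, rule good_q2[OF assms])

lemma famD:
  assumes "fam p q L F k"
  shows "prime p" "prime q" "p \<noteq> q" "k > 0" "finite L" "card L = k" "F \<noteq> {}"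
    "S \<in> F \<Longrightarrow> finite S" "S \<in> F \<Longrightarrow> card S = k"
    "S \<in> F \<Longrightarrow> df p q L i j \<Longrightarrow> zr S (p ^ i * q ^ j)"
    "S \<in> F \<Longrightarrow> df p q S i j \<Longrightarrow> zr L (p ^ i * q ^ j)"
    "\<not> df p q L 0 0" "S \<in> F \<Longrightarrow> \<not> df p q S 0 0"
proof -
  show *: "prime p" "prime q" "p \<noteq> q" "k > 0" "finite L" "card L = k" "F \<noteq> {}"
    "S \<in> F \<Longrightarrow> finite S" "S \<in> F \<Longrightarrow> card S = k"
    "S \<in> F \<Longrightarrow> df p q L i j \<Longrightarrow> zr S (p ^ i * q ^ j)"
    "S \<in> F \<Longrightarrow> df p q S i j \<Longrightarrow> zr L (p ^ i * q ^ j)" for S i j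
    using assms unfolding fam_def by blast+
  show "\<not> df p q L 0 0"
  proof
    assume "df p q L 0 0"
    moreover obtain S where "S \<in> F" using *(7) by blast
    ultimately have "zr S 1" using *(10)[of S 0 0] by simp
    thus False using zr_1[OF *(8)[OF \<open>S \<in> F\<close>]] *(4) *(9)[OF \<open>S \<in> F\<close>] by simp
  qed
  show "\<not> df p q S 0 0" if "S \<in> F"
  proof
    assume "df p q S 0 0"
    hence "zr L 1" using *(11)[OF that, of 0 0] by simp
    thus False using zr_1[OF *(5)] *(4,6) by auto
  qed
qed

section \<open>Case analysis by the orders of differences in the spectrum\<close>

lemma zr_pq_dvd_card:
  assumes pq: "prime p" "prime q" "p \<noteq> q" and S: "finite S" and i: "i = 1 \<or> i = 2" and z: "zr S (p ^ i * q ^ 0)"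
  shows "p dvd card S"
  using zr_prime_dvd_card[OF pq(1) S i] z by simp

lemma complementary_types:
  assumes "i0 = 1 \<and> i1 = 2 \<or> i0 = 2 \<and> i1 = (1::nat)"
  shows "zr S (p ^ i0) \<Longrightarrow> zr S (p ^ i1) \<Longrightarrow> zr S p \<and> zr S (p^2)"
  using assms by auto

text \<open>As \<open>q^2\<close> does not divide \<open>k\<close>, the spectrum lacks a pure
  difference \<open>q^j1\<close>, and packing with exponent \<open>j1\<close> is perfect. So
  \<open>L\<close> vanishes at \<open>q^j1\<close> and hence not at \<open>q^j0\<close>; no member
  has a difference \<open>q^j0\<close>, and packing with \<open>j0\<close> is perfect for every
  member. The choice of \<open>j0\<close> depends on \<open>L\<close> alone.\<close>

lemma good_p2q:
  assumes f: "fam p q L F k" and k: "k = p^2 * q"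
  shows "good p q F k"
proof -
  note F = famD[OF f]
  have p0: "p > 0" and q0: "q > 0" and q1: "q > 1" using F(1,2) by (auto simp: prime_gt_0_nat prime_gt_Suc_0_nat)
  have nq: "\<not> q^2 dvd k"
  proof
    assume "q^2 dvd k"
    hence "q dvd p^2" using q0 by (simp add: k power2_eq_square)
    hence "q dvd p" using F(2) prime_dvd_power_nat by blast
    thus False using F(1-3) primes_dvd_imp_eq by blast
  qed
  have "\<not> (df p q L 0 1 \<and> df p q L 0 2)"
  proof
    assume *: "df p q L 0 1 \<and> df p q L 0 2"
    obtain S where S: "S \<in> F" using F(7) by blast
    have "zr S q" "zr S (q^2)" using * F(10)[OF S, of 0 1] F(10)[OF S, of 0 2] by simp_all
    thus False using zr_both_sq_dvd_card[OF F(2) F(8)[OF S]] F(9)[OF S] nq by simp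
  qed
  then obtain j0 j1 :: nat where j: "compl12 j0 j1" and nd: "\<not> df p q L 0 j1"
    by blast
  have sub: "{j1} \<subseteq> {1, 2}" "{j0} \<subseteq> {1, 2}" using j by auto
  have kk: "k * (p ^ card ({}::nat set) * q ^ card {j}) = p^2 * q^2" for j :: nat
    by (simp add: k power2_eq_square)
  have "zr L (p ^ 0 * q ^ j1)"
    by (rule pack(2)[OF F(1-3) empty_subsetI sub(1) F(5)]) (use nd F(6,12) kk j in \<open>auto simp: nz_def\<close>)
  hence zL: "zr L (q ^ j1)" by simp
  have nd': "\<not> df p q S 0 j0" if S: "S \<in> F" for S
  proof
    assume "df p q S 0 j0"
    hence "zr L (q ^ j0)" using F(11)[OF S, of 0 j0] by simp
    hence "q^2 dvd card L" using complementary_types[OF j _ zL] zr_both_sq_dvd_card[OF F(2) F(5)] by blast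
    thus False using F(6) nq by simp
  qed
  have res: "zr S (p ^ i * q ^ j)" if "S \<in> F" "i \<le> 2" "j = 0 \<or> j = j0" "i \<noteq> 0 \<or> j \<noteq> 0" for S i j
    by (rule pack(2)[OF F(1-3) empty_subsetI sub(2) F(8)[OF that(1)]])
       (use nd'[OF that(1)] F(9,13)[OF that(1)] kk that j in \<open>auto simp: nz_def\<close>)
  show ?thesis
  proof (rule goodI[OF subset_refl sub(2)])
    show "zr S (p ^ i * q ^ j)" if "S \<in> F" "i \<in> insert 0 {1, 2}" "j \<in> insert 0 {j0}" "i \<noteq> 0 \<or> j \<noteq> 0" for S i j
      by (rule res) (use that in auto)
  qed (simp add: k power2_eq_square)
qed

lemma good_pq2:
  assumes f: "fam p q L F k" and k: "k = p * q^2"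
  shows "good p q F k"
  by (rule good_swap, rule good_p2q[OF fam_swap[OF f]]) (simp add: k)

text \<open>Both pure zeros give \<open>k = q^2 m\<close>. If \<open>m < p\<close>, then
  \<open>p\<close> does not divide \<open>k\<close>, so no pure \<open>p\<close>-differences exist
  and packing yields \<open>m = 1\<close>. If \<open>m > p\<close>, packing shows that no pure
  \<open>p\<close>-difference is missing, so \<open>k\<close> is the whole group order. The case
  \<open>m = p\<close> is the preceding lemma.\<close>

lemma good_both_pure:
  assumes f: "fam p q L F k" and d: "df p q L 0 1" "df p q L 0 2"
  shows "good p q F k"
proof -
  note F = famD[OF f]
  have p0: "p > 0" and q0: "q > 0" using F(1,2) by (auto simp: prime_gt_0_nat)
  have zS: "zr S q" "zr S (q^2)" if "S \<in> F" for S
    using d F(10)[OF that, of 0 1] F(10)[OF that, of 0 2] by simp_all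
  obtain S0 where S0: "S0 \<in> F" using F(7) by blast
  have "q^2 dvd k" using zr_both_sq_dvd_card[OF F(2) F(8)[OF S0] zS[OF S0]] F(9)[OF S0] by simp
  then obtain m where m: "k = q^2 * m" by (elim dvdE)
  have m0: "m > 0" using F(4) m by simp
  consider "m < p" | "m = p" | "m > p" by linarith
  thus ?thesis
  proof cases
    case 1
    have npk: "\<not> p dvd k"
    proof
      assume "p dvd k"
      hence "p dvd q^2 \<or> p dvd m" using F(1) by (simp add: m prime_dvd_mult_iff)
      moreover have "\<not> p dvd q^2" using F(1-3) prime_dvd_power_nat primes_dvd_imp_eq by blast
      ultimately show False using 1 m0 by (simp add: nat_dvd_not_less)
    qed
    have nd: "\<not> df p q L i 0" if "i = 1 \<or> i = 2" for i
    proof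
      assume "df p q L i 0"
      hence "zr S0 (p ^ i * q ^ 0)" using F(10)[OF S0] by blast
      thus False using zr_pq_dvd_card[OF F(1-3) F(8)[OF S0] that] F(9)[OF S0] npk by simp
    qed
    have "card L * (p ^ card {1, 2::nat} * q ^ card ({}::nat set)) \<le> p^2 * q^2"
      by (rule pack(1)[OF F(1-3) subset_refl empty_subsetI F(5)]) (use nd F(12) in auto)
    hence "k * p^2 \<le> q^2 * p^2" using F(6) by (simp add: power2_eq_square mult_ac)
    hence "q^2 * m \<le> q^2 * 1" using p0 by (simp add: m)
    hence "m \<le> 1" using q0 by simp
    hence "k = q^2" using m0 m by (simp add: le_antisym Suc_leI)
    show ?thesis by (rule good_q2[OF \<open>k = q^2\<close>]) (use zS in blast)
  next
    case 2
    thus ?thesis by (intro good_pq2[OF f]) (simp add: m)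
  next
    case 3
    have "df p q L i 0" if i: "i = 1 \<or> i = 2" for i
    proof (rule ccontr)
      assume nd: "\<not> df p q L i 0"
      have "card L * (p ^ card {i} * q ^ card ({}::nat set)) \<le> p^2 * q^2"
        by (rule pack(1)[OF F(1-3) _ empty_subsetI F(5)]) (use nd F(12) i in auto)
      hence "(q^2 * p) * m \<le> (q^2 * p) * p" using F(6) by (simp add: m power2_eq_square mult_ac)
      thus False using 3 p0 q0 by simp
    qed
    hence "df p q L 1 0" "df p q L 2 0" by simp_all
    hence "zr S0 p" "zr S0 (p^2)" using F(10)[OF S0, of 1 0] F(10)[OF S0, of 2 0] by simp_all
    hence "p^2 dvd k" using zr_both_sq_dvd_card[OF F(1) F(8)[OF S0]] F(9)[OF S0] by simp
    hence "p^2 * q^2 dvd k" using \<open>q^2 dvd k\<close> primes_coprime[OF F(1-3)] by (intro divides_mult) auto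
    hence "p^2 * q^2 \<le> k" using F(4) by (simp add: dvd_imp_le)
    moreover have "card L * (p ^ card ({}::nat set) * q ^ card ({}::nat set)) \<le> p^2 * q^2"
      by (rule pack(1)[OF F(1-3) empty_subsetI empty_subsetI F(5)]) (use F(12) in auto)
    ultimately have kM: "k = p^2 * q^2" using F(6) by simp
    have res: "zr S (p ^ i * q ^ j)" if "S \<in> F" "i \<le> 2" "j \<le> 2" "i \<noteq> 0 \<or> j \<noteq> 0" for S i j
      by (rule pack(2)[OF F(1-3) empty_subsetI empty_subsetI F(8)[OF that(1)]])
         (use F(9,13)[OF that(1)] kM that in \<open>auto simp: nz_def\<close>)
    show ?thesis
    proof (rule goodI[OF subset_refl subset_refl])
      show "zr S (p ^ i * q ^ j)" if "S \<in> F" "i \<in> insert 0 {1, 2}" "j \<in> insert 0 {1, 2}" "i \<noteq> 0 \<or> j \<noteq> 0" for S i j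
        by (rule res) (use that in auto)
    qed (simp add: kM power2_eq_square)
  qed
qed

text \<open>The pure zeros give \<open>k = p q m\<close>, and the missing pure differences give
  \<open>m\<close> at most \<open>p\<close> and \<open>q\<close>. Below both bounds the square
  pattern excludes a mixed difference at \<open>i1, j1\<close>, so packing yields
  \<open>k = p q\<close>. Perfect packings of \<open>L\<close> and then of each member produce the
  remaining zeros.\<close>

lemma good_two_pure:
  assumes f: "fam p q L F k"
    and i: "compl12 i0 i1"
    and j: "compl12 j0 j1"
    and dj: "df p q L 0 j0" "\<not> df p q L 0 j1"
    and di: "\<And>S. S \<in> F \<Longrightarrow> zr S (p ^ i0)" "\<not> df p q L i1 0"
  shows "good p q F k"
proof -
  note F = famD[OF f]
  have p0: "p > 0" and q0: "q > 0" using F(1,2) by (auto simp: prime_gt_0_nat)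
  have cop: "coprime p q" using primes_coprime[OF F(1-3)] .
  obtain S0 where S0: "S0 \<in> F" using F(7) by blast
  have zq: "zr S (q ^ j0)" if "S \<in> F" for S using F(10)[OF that dj(1)] by simp
  have ij: "i0 = 1 \<or> i0 = 2" "i1 = 1 \<or> i1 = 2" "j0 = 1 \<or> j0 = 2" "j1 = 1 \<or> j1 = 2" using i j by auto
  have sub: "{i0} \<subseteq> {1, 2}" "{i1} \<subseteq> {1, 2}" "{j0} \<subseteq> {1, 2}" "{j1} \<subseteq> {1, 2}" using ij by auto
  have "p dvd k" using zr_prime_dvd_card[OF F(1) F(8)[OF S0] ij(1) di(1)[OF S0]] F(9)[OF S0] by simp
  moreover have "q dvd k" using zr_prime_dvd_card[OF F(2) F(8)[OF S0] ij(3) zq[OF S0]] F(9)[OF S0] by simp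
  ultimately have "p * q dvd k" using cop by (intro divides_mult)
  then obtain m where m: "k = p * q * m" by (elim dvdE)
  have m0: "m > 0" using F(4) m by simp
  have "card L * (p ^ card ({}::nat set) * q ^ card {j1}) \<le> p^2 * q^2"
    by (rule pack(1)[OF F(1-3) empty_subsetI _ F(5)]) (use dj F(12) ij in auto)
  hence "(p * q * q) * m \<le> (p * q * q) * p" using F(6) by (simp add: m power2_eq_square mult_ac)
  hence mp: "m \<le> p" using p0 q0 by simp
  have "card L * (p ^ card {i1} * q ^ card ({}::nat set)) \<le> p^2 * q^2"
    by (rule pack(1)[OF F(1-3) _ empty_subsetI F(5)]) (use di F(12) ij in auto)
  hence "(p * q * p) * m \<le> (p * q * p) * q" using F(6) by (simp add: m power2_eq_square mult_ac)
  hence mq: "m \<le> q" using p0 q0 by simp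
  consider "m = p" | "m = q" | "m < p" "m < q" using mp mq by linarith
  thus ?thesis
  proof cases
    case 1
    thus ?thesis by (intro good_p2q[OF f]) (simp add: m power2_eq_square)
  next
    case 2
    thus ?thesis by (intro good_pq2[OF f]) (simp add: m power2_eq_square)
  next
    case 3
    have nd: "\<not> df p q L i1 j1"
    proof
      assume "df p q L i1 j1"
      hence "zr S0 (p ^ i1 * q ^ j1)" using F(10)[OF S0] by blast
      thus False using zr_square_pattern[OF F(1-3) F(8)[OF S0] i j di(1)[OF S0] zq[OF S0] _ _ m0 3] F(9)[OF S0] m by simp
    qed
    have nds: "\<not> df p q L a b" if "a \<in> insert 0 {i1}" "b \<in> insert 0 {j1}" for a b
      using that nd di(2) dj(2) F(12) by auto
    have "card L * (p ^ card {i1} * q ^ card {j1}) \<le> p^2 * q^2"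
      by (rule pack(1)[OF F(1-3) _ _ F(5) nds]) (use ij in auto)
    hence "(p * q * p * q) * m \<le> (p * q * p * q) * 1" using F(6) by (simp add: m power2_eq_square mult_ac)
    hence "m \<le> 1" using p0 q0 by simp
    hence k: "k = p * q" using m0 m by simp
    have kk: "k * (p ^ card {a} * q ^ card {b}) = p^2 * q^2" for a b :: nat by (simp add: k power2_eq_square)
    \<comment> \<open>For \<open>k = p q\<close> the packing of \<open>L\<close> with exponents
      \<open>i1, j1\<close> is perfect, and the standard set has no zeros at these
      exponents.\<close>
    have zL: "zr L (p ^ a * q ^ b)" if "a \<in> {0, i1}" "b \<in> {0, j1}" "a \<noteq> 0 \<or> b \<noteq> 0" for a b
      by (rule pack(2)[OF F(1-3) sub(2,4) F(5) nds kk[folded F(6)]]) (use ij that in \<open>auto simp: nz_def\<close>)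
    have zL': "zr L (p ^ i1)" "zr L (q ^ j1)" using zL[of i1 0] zL[of 0 j1] ij by auto
    have np: "\<not> p^2 dvd k"
    proof
      assume "p^2 dvd k"
      hence "p dvd q" using p0 by (simp add: k power2_eq_square)
      thus False using F(1-3) primes_dvd_imp_eq by blast
    qed
    have nq: "\<not> q^2 dvd k"
    proof
      assume "q^2 dvd k"
      hence "q dvd p" using q0 by (simp add: k power2_eq_square)
      thus False using F(1-3) primes_dvd_imp_eq by blast
    qed
    have i': "compl12 i1 i0" using i by auto
    have j': "compl12 j1 j0" using j by auto
    have nL1: "\<not> zr L (p ^ i0)"
      using complementary_types[OF i _ zL'(1)] zr_both_sq_dvd_card[OF F(1) F(5)] F(6) np by blast
    have nL2: "\<not> zr L (q ^ j0)"
      using complementary_types[OF j _ zL'(2)] zr_both_sq_dvd_card[OF F(2) F(5)] F(6) nq by blast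
    \<comment> \<open>The square pattern applied to \<open>L\<close> with \<open>m = 1\<close> and
      the two exponent choices exchanged: \<open>L\<close> has its pure zeros at \<open>i1\<close>
      and \<open>j1\<close>.\<close>
    have nL3: "\<not> zr L (p ^ i0 * q ^ j0)"
      using zr_square_pattern[OF F(1-3) F(5) i' j' zL', where m = 1] k F(6) prime_gt_1_nat[OF F(1)] prime_gt_1_nat[OF F(2)]
      by auto
    have res: "zr S (p ^ a * q ^ b)" if S: "S \<in> F" and ab: "a \<in> {0, i0}" "b \<in> {0, j0}" "a \<noteq> 0 \<or> b \<noteq> 0" for S a b
    proof -
      have nS: "\<not> df p q S a b" if "a \<in> insert 0 {i0}" "b \<in> insert 0 {j0}" for a b
      proof
        assume d: "df p q S a b"
        hence "zr L (p ^ a * q ^ b)" by (rule F(11)[OF S])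
        hence "a = 0 \<and> b = 0" using that nL1 nL2 nL3 by auto
        thus False using d F(13)[OF S] by simp
      qed
      show ?thesis
        by (rule pack(2)[OF F(1-3) sub(1,3) F(8)[OF S] nS kk[folded F(9)[OF S]]]) (use ij ab in \<open>auto simp: nz_def\<close>)
    qed
    show ?thesis by (rule goodI[of "{i0}" "{j0}", OF _ _ _ res]) (use ij k in auto)
  qed
qed

text \<open>A single pure \<open>p\<close>-difference leads to the previous lemma. Without any,
  \<open>k\<close> is at most \<open>q^2\<close>; if no mixed difference has
  \<open>q\<close>-exponent \<open>j1\<close>, packing sharpens this to \<open>k = q\<close>.
  Otherwise that mixed zero and the column bound give \<open>k = q^2\<close> or the pure
  \<open>p\<close>-zero needed for the previous lemma.\<close>

lemma good_one_pure:
  assumes f: "fam p q L F k"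
    and j: "compl12 j0 j1"
    and dj: "df p q L 0 j0" "\<not> df p q L 0 j1"
    and di: "\<not> (df p q L 1 0 \<and> df p q L 2 0)"
  shows "good p q F k"
proof (cases "df p q L 1 0 \<or> df p q L 2 0")
  case True
  then obtain i0 i1 :: nat where i: "compl12 i0 i1" "df p q L i0 0" "\<not> df p q L i1 0"
    using di by blast
  have "zr S (p ^ i0)" if "S \<in> F" for S using famD(10)[OF f that i(2)] by simp
  thus ?thesis using good_two_pure[OF f i(1) j dj _ i(3)] by blast
next
  case nop: False
  note F = famD[OF f]
  have p0: "p > 0" and q0: "q > 0" using F(1,2) by (auto simp: prime_gt_0_nat)
  have jj: "j0 = 1 \<or> j0 = 2" "j1 = 1 \<or> j1 = 2" using j by auto
  obtain S0 where S0: "S0 \<in> F" using F(7) by blast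
  have zq: "zr S (q ^ j0)" if "S \<in> F" for S using F(10)[OF that dj(1)] by simp
  have qk: "q dvd k" using zr_prime_dvd_card[OF F(2) F(8)[OF S0] jj(1) zq[OF S0]] F(9)[OF S0] by simp
  have "card L * (p ^ card {1, 2::nat} * q ^ card ({}::nat set)) \<le> p^2 * q^2"
    by (rule pack(1)[OF F(1-3) subset_refl empty_subsetI F(5)]) (use nop F(12) in auto)
  hence "p^2 * k \<le> p^2 * q^2" using F(6) by (simp add: power2_eq_square mult_ac)
  hence kq: "k \<le> q^2" using p0 by simp
  show ?thesis
  proof (cases "df p q L 1 j1 \<or> df p q L 2 j1")
    case False
    have "card L * (p ^ card {1, 2::nat} * q ^ card {j1}) \<le> p^2 * q^2"
      by (rule pack(1)[OF F(1-3) subset_refl _ F(5)]) (use nop False dj jj F(12) in auto)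
    hence "(p^2 * q) * k \<le> (p^2 * q) * q" using F(6) by (simp add: power2_eq_square mult_ac)
    hence "k \<le> q" using p0 q0 by simp
    hence "k = q" using qk F(4) by (simp add: dvd_imp_le le_antisym)
    thus ?thesis by (intro goodI[of "{}" "{j0}"]) (use jj zq in auto)
  next
    case True
    then obtain i0 i1 :: nat where i: "compl12 i0 i1" "df p q L i0 j1" by blast
    have i0: "i0 > 0" "i0 = 1 \<or> i0 = 2" using i by auto
    have dich: "zr S (p ^ i0) \<or> (card S = q^2 \<and> zr S q \<and> zr S (q^2))" if S: "S \<in> F" for S
      using zr_mixed_column_bound[OF F(1) i0(1) F(2,3) F(8)[OF S] j zq[OF S] F(10)[OF S i(2)]] kq F(9)[OF S] by simp
    show ?thesis
    proof (cases "k = q^2")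
      case True
      have zS: "zr S q \<and> zr S (q^2)" if S: "S \<in> F" for S
      proof -
        have "\<not> zr S (p ^ i0)"
        proof
          assume "zr S (p ^ i0)"
          hence "p dvd q^2" using zr_prime_dvd_card[OF F(1) F(8)[OF S] i0(2)] F(9)[OF S] True by simp
          thus False using F(1-3) prime_dvd_power_nat primes_dvd_imp_eq by blast
        qed
        thus ?thesis using dich[OF S] by blast
      qed
      show ?thesis by (rule good_q2[OF True]) (use zS in blast)
    next
      case False
      hence "zr S (p ^ i0)" if "S \<in> F" for S using dich[OF that] F(9)[OF that] by blast
      moreover have "\<not> df p q L i1 0" using nop i by auto
      ultimately show ?thesis using good_two_pure[OF f i(1) j dj] by blast
    qed
  qed
qed

text \<open>The column bound with \<open>p\<close> and \<open>q\<close> exchanged. Its alternative,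
  a zero at a power of \<open>q\<close>, would make \<open>p q\<close> divide \<open>k\<close>,
  impossible for \<open>p < q\<close> and \<open>k\<close> at most \<open>p^2\<close>.\<close>

lemma good_from_pure_zero:
  assumes f: "fam p q L F k" and pq: "p < q" and k: "k \<le> p^2"
    and i: "compl12 i0 i1"
    and z: "\<And>S. S \<in> F \<Longrightarrow> zr S (p ^ i0)" and d: "df p q L i1 j" and j: "j = 1 \<or> j = 2"
  shows "good p q F k"
proof -
  note F = famD[OF f]
  have p0: "p > 0" and q0: "q > 0" using F(1,2) by (auto simp: prime_gt_0_nat)
  have j0: "j > 0" using j by auto
  have *: "card S = p^2 \<and> zr S p \<and> zr S (p^2)" if S: "S \<in> F" for S
  proof -
    have z1: "zr S (q ^ j * p ^ i1)" using F(10)[OF S d] by (simp add: mult.commute)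
    have "card S \<le> p^2" using k F(9)[OF S] by simp
    hence "zr S (q ^ j) \<or> (card S = p^2 \<and> zr S p \<and> zr S (p^2))"
      by (rule zr_mixed_column_bound[OF F(2) j0 F(1) F(3)[symmetric] F(8)[OF S] i z[OF S] z1])
    moreover have "\<not> zr S (q ^ j)"
    proof
      assume "zr S (q ^ j)"
      hence "q dvd k" using zr_prime_dvd_card[OF F(2) F(8)[OF S] j] F(9)[OF S] by simp
      moreover have "i0 = 1 \<or> i0 = 2" using i by auto
      hence "p dvd k" using zr_prime_dvd_card[OF F(1) F(8)[OF S] _ z[OF S]] F(9)[OF S] by simp
      ultimately have "p * q dvd k" using primes_coprime[OF F(1-3)] by (intro divides_mult)
      hence "p * q \<le> p * p" using k F(4) dvd_imp_le[of "p * q" k] unfolding power2_eq_square by linarith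
      thus False using pq p0 by simp
    qed
    ultimately show ?thesis by blast
  qed
  obtain S0 where S0: "S0 \<in> F" using F(7) by blast
  have kp: "k = p^2" using *[OF S0] F(9)[OF S0] by simp
  show ?thesis by (rule good_p2[OF kp]) (use * in blast)
qed

text \<open>Packing bounds \<open>k\<close> by \<open>p^2\<close>, and the cases follow the 2 by 2
  table of mixed orders in \<open>L\<close>. A full row gives a pure zero by the full-column lemma;
  an empty row bounds \<open>k\<close> by \<open>p\<close>. If each row has exactly one entry, these
  lie in one column, on the antidiagonal or on the diagonal.\<close>

lemma good_no_pure:
  assumes f: "fam p q L F k" and pq: "p < q"
    and nd: "\<And>i. i = 1 \<or> i = 2 \<Longrightarrow> \<not> df p q L i 0" "\<And>j. j = 1 \<or> j = 2 \<Longrightarrow> \<not> df p q L 0 j"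
  shows "good p q F k"
proof -
  note F = famD[OF f]
  have p0: "p > 0" and q0: "q > 0" using F(1,2) by (auto simp: prime_gt_0_nat)
  have "card L * (p ^ card ({}::nat set) * q ^ card {1, 2::nat}) \<le> p^2 * q^2"
    by (rule pack(1)[OF F(1-3) empty_subsetI subset_refl F(5)]) (use nd F(12) in auto)
  hence "k * q^2 \<le> p^2 * q^2" using F(6) by (simp add: power2_eq_square)
  hence kp: "k \<le> p^2" using q0 by simp
  have pq2: "p^2 < q^2" using pq by (simp add: power_strict_mono)
  have kleP: "k \<le> p" if "i1 = 1 \<or> i1 = 2" "\<And>j. j = 1 \<or> j = 2 \<Longrightarrow> \<not> df p q L i1 j" for i1
  proof -
    have "card L * (p ^ card {i1} * q ^ card {1, 2::nat}) \<le> p^2 * q^2"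
      by (rule pack(1)[OF F(1-3) _ subset_refl F(5)]) (use that nd F(12) in auto)
    hence "(p * q^2) * k \<le> (p * q^2) * p" using F(6) by (simp add: power2_eq_square mult_ac)
    thus ?thesis using p0 q0 by simp
  qed
  have kleQ: "k \<le> q" if "j1 = 1 \<or> j1 = 2" "\<And>i. i = 1 \<or> i = 2 \<Longrightarrow> \<not> df p q L i j1" for j1
  proof -
    have "card L * (p ^ card {1, 2::nat} * q ^ card {j1}) \<le> p^2 * q^2"
      by (rule pack(1)[OF F(1-3) subset_refl _ F(5)]) (use that nd F(12) in auto)
    hence "(p^2 * q) * k \<le> (p^2 * q) * q" using F(6) by (simp add: power2_eq_square mult_ac)
    thus ?thesis using p0 q0 by simp
  qed
  have types: "(tp p (int x - int y) = 1 \<or> tp p (int x - int y) = 2) \<and> (tp q (int x - int y) = 1 \<or> tp q (int x - int y) = 2)"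
    if "x \<in> L" "y \<in> L" "x \<noteq> y" for x y
  proof -
    have "df p q L (tp p (int x - int y)) (tp q (int x - int y))" using that by (auto simp: df_def)
    thus ?thesis using nd F(12) tp_cases[of p "int x - int y"] tp_cases[of q "int x - int y"] by metis
  qed
  have pk: "p dvd k" if "S \<in> F" "zr S (p ^ i)" "i = 1 \<or> i = 2" for S i
    using zr_prime_dvd_card[OF F(1) F(8)[OF that(1)] that(3,2)] F(9)[OF that(1)] by simp
  obtain S0 where S0: "S0 \<in> F" using F(7) by blast
  have single: "good p q F k" if "k \<le> p" "i = 1 \<or> i = 2" "\<And>S. S \<in> F \<Longrightarrow> zr S (p ^ i)" for i
  proof -
    have "k = p" using pk[OF S0 that(3)[OF S0] that(2)] that(1) F(4) by (simp add: dvd_imp_le le_antisym)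
    show ?thesis
      by (rule goodI[of "{i}" "{}"]) (use that(2,3) \<open>k = p\<close> in auto)
  qed
  show ?thesis
  proof (cases "k = 1")
    case True
    show ?thesis by (rule goodI[of "{}" "{}"]) (use True in auto)
  next
    case k1: False
    hence "\<not> card L \<le> Suc 0" using F(4,6) by simp
    then obtain x y where xy: "x \<in> L" "y \<in> L" "x \<noteq> y"
      unfolding card_le_Suc0_iff_eq[OF F(5)] by blast
    have some: "\<exists>i j. (i = 1 \<or> i = 2) \<and> (j = 1 \<or> j = 2) \<and> df p q L i j"
      using types[OF xy] xy unfolding df_def by blast
    show ?thesis
    proof (cases "\<exists>i. (i = 1 \<or> i = 2) \<and> df p q L i 1 \<and> df p q L i 2")
      case True
      then obtain i0 i1 :: nat where i: "compl12 i0 i1" and d: "df p q L i0 1" "df p q L i0 2"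
        by blast
      have i0: "i0 > 0" "i0 = 1 \<or> i0 = 2" "i1 = 1 \<or> i1 = 2" using i by auto
      have z: "zr S (p ^ i0)" if S: "S \<in> F" for S
      proof (rule zr_two_full_column[OF F(1) i0(1) F(2,3) F(8)[OF S]])
        show "zr S (p ^ i0 * q)" using F(10)[OF S d(1)] by simp
        show "zr S (p ^ i0 * q^2)" using F(10)[OF S d(2)] .
        show "card S < q^2" using F(9)[OF S] kp pq2 by simp
      qed
      show ?thesis
      proof (cases "\<exists>j. (j = 1 \<or> j = 2) \<and> df p q L i1 j")
        case True
        thus ?thesis using good_from_pure_zero[OF f pq kp i z] by blast
      next
        case False
        hence "k \<le> p" by (intro kleP[OF i0(3)]) blast
        thus ?thesis using single[OF _ i0(2) z] by blast
      qed
    next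
      case nodouble: False
      show ?thesis
      proof (cases "\<exists>i1. (i1 = 1 \<or> i1 = 2) \<and> \<not> df p q L i1 1 \<and> \<not> df p q L i1 2")
        case True
        then obtain i0 i1 :: nat where i: "compl12 i0 i1" and d: "\<not> df p q L i1 1" "\<not> df p q L i1 2"
          by blast
        have i0: "i0 > 0" "i0 = 1 \<or> i0 = 2" "i1 = 1 \<or> i1 = 2" using i by auto
        have kp': "k \<le> p" using d by (intro kleP[OF i0(3)]) auto
        obtain j where j: "j = 1 \<or> j = 2" "df p q L i0 j" using some d i by blast
        hence j0: "j > 0" by auto
        have "zr S (p ^ i0)" if S: "S \<in> F" for S
          using zr_two_small[OF F(1) i0(1) F(2) j0 F(3) F(8)[OF S] F(10)[OF S j(2)]] F(9)[OF S] kp' pq by simp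
        thus ?thesis using single[OF kp' i0(2)] by blast
      next
        case False
        then obtain j j' where j: "j = 1 \<or> j = 2" "df p q L 1 j" and j': "j' = 1 \<or> j' = 2" "df p q L 2 j'" by blast
        have only1: "b = j" if "df p q L 1 b" "b = 1 \<or> b = 2" for b using nodouble that j by blast
        have only2: "b = j'" if "df p q L 2 b" "b = 1 \<or> b = 2" for b using nodouble that j' by blast
        have jpos: "j > 0" "j' > 0" using j j' by auto
        consider "j = j'" | "j = 2" "j' = 1" | "j = 1" "j' = 2" using j j' by blast
        thus ?thesis
        proof cases
          case 1
          \<comment> \<open>The other exponent: no difference has it as \<open>q\<close>-part, which
            bounds \<open>k\<close> by \<open>q\<close>.\<close>
          define j1 where "j1 = 3 - j"
          have j1: "j1 = 1 \<or> j1 = 2" "j1 \<noteq> j" using j by (auto simp: j1_def)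
          have kq: "k \<le> q" using only1[of j1] only2[of j1] j1 1 by (intro kleQ[OF j1(1)]) auto
          have z1: "zr S (p ^ 1) \<or> (card S = q \<and> zr S (q ^ j))" if S: "S \<in> F" for S
            using zr_two_small[OF F(1) zero_less_one F(2) jpos(1) F(3) F(8)[OF S] F(10)[OF S j(2)]] F(9)[OF S] kq by simp
          have z2: "zr S (p ^ 2) \<or> (card S = q \<and> zr S (q ^ j))" if S: "S \<in> F" for S
            using zr_two_small[OF F(1) zero_less_numeral F(2) jpos(1) F(3) F(8)[OF S]] F(10)[OF S j'(2)] F(9)[OF S] kq 1 by simp
          show ?thesis
          proof (cases "k = q")
            case True
            have "zr S (q ^ j)" if S: "S \<in> F" for S
            proof (rule ccontr)
              assume "\<not> zr S (q ^ j)"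
              hence "zr S (p ^ 1)" using z1[OF S] by blast
              hence "p dvd q" using pk[OF S, of 1] True by simp
              thus False using F(1-3) primes_dvd_imp_eq by blast
            qed
            thus ?thesis by (intro goodI[of "{}" "{j}"]) (use j True in auto)
          next
            case False
            have zz: "zr S p" "zr S (p^2)" if S: "S \<in> F" for S
              using z1[OF S] z2[OF S] F(9)[OF S] False by auto
            have "p^2 dvd k" using zr_both_sq_dvd_card[OF F(1) F(8)[OF S0] zz[OF S0]] F(9)[OF S0] by simp
            hence "k = p^2" using kp F(4) by (simp add: dvd_imp_le le_antisym)
            show ?thesis by (rule good_p2[OF \<open>k = p^2\<close>]) (use zz in blast)
          qed
        next
          case 2
          \<comment> \<open>On the antidiagonal any two elements of \<open>L\<close> are congruent
            modulo exactly one of \<open>p\<close> and \<open>q\<close>. Two equivalence relations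
            that together relate all pairs cannot both be proper, so one congruence would hold
            throughout, against the presence of both types.\<close>
          have ty: "(tp p (int x - int y) = 1 \<and> tp q (int x - int y) = 2) \<or> (tp p (int x - int y) = 2 \<and> tp q (int x - int y) = 1)"
            if "x \<in> L" "y \<in> L" "x \<noteq> y" for x y
          proof -
            have d: "df p q L (tp p (int x - int y)) (tp q (int x - int y))" using that by (auto simp: df_def)
            from types[OF that] have tq: "tp q (int x - int y) = 1 \<or> tp q (int x - int y) = 2" by blast
            show ?thesis
            proof (cases "tp p (int x - int y) = 1")
              case True
              with only1[OF _ tq] d 2 show ?thesis by simp
            next
              case False
              hence "tp p (int x - int y) = 2" using types[OF that] by blast
              with only2[OF _ tq] d 2 show ?thesis by simp
            qed
          qed
          have t1: "int s dvd d" if "tp s d = 1" for s d using that by (simp add: tp_def split: if_splits)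
          have t2: "\<not> int s dvd d" if "tp s d = 2" for s d using that by (simp add: tp_def split: if_splits)
          obtain u v where uv: "u \<in> L" "v \<in> L" "u \<noteq> v" "tp p (int u - int v) = 2" "tp q (int u - int v) = 1"
            using j'(2) 2 unfolding df_def by blast
          obtain u' v' where uv': "u' \<in> L" "v' \<in> L" "u' \<noteq> v'" "tp p (int u' - int v') = 1" "tp q (int u' - int v') = 2"
            using j(2) 2 unfolding df_def by blast
          have all: "int q dvd int w - int u" if w: "w \<in> L" for w
          proof (cases "w = u")
            case wu: False
            from ty[OF w uv(1) wu] show ?thesis
            proof
              assume "tp p (int w - int u) = 1 \<and> tp q (int w - int u) = 2"
              hence pd: "int p dvd int w - int u" by (intro t1) simp
              have npd: "\<not> int p dvd int u - int v" using uv(4) by (rule t2)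
              have npwv: "\<not> int p dvd int w - int v"
              proof
                assume "int p dvd int w - int v"
                hence "int p dvd (int w - int v) - (int w - int u)" using pd by (rule dvd_diff)
                thus False using npd by simp
              qed
              hence "w \<noteq> v" by auto
              from ty[OF w uv(2) this] npwv t1 have "tp q (int w - int v) = 1" by blast
              hence "int q dvd int w - int v" by (rule t1)
              moreover have "int q dvd int u - int v" using uv(5) by (rule t1)
              ultimately have "int q dvd (int w - int v) - (int u - int v)" by (rule dvd_diff)
              thus ?thesis by simp
            qed (auto intro: t1)
          qed simp
          have "int q dvd (int u' - int u) - (int v' - int u)" using all[OF uv'(1)] all[OF uv'(2)] by (rule dvd_diff)
          hence False using t2[OF uv'(5)] by simp
          thus ?thesis ..
        next
          case 3
          have z: "zr S (p ^ 1)" if S: "S \<in> F" for S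
          proof -
            have "zr S p"
            proof (rule zr_diagonal[OF F(1,2) pq F(8)[OF S]])
              show "zr S (p * q)" using F(10)[OF S j(2)] 3 by simp
              show "zr S (p^2 * q^2)" using F(10)[OF S j'(2)] 3 by simp
              show "card S \<le> p^2" using F(9)[OF S] kp by simp
            qed
            thus ?thesis by simp
          qed
          show ?thesis
            by (rule good_from_pure_zero[OF f pq kp _ z j'(2,1)]) auto
        qed
      qed
    qed
  qed
qed

lemma good_if_fam:
  assumes f: "fam p q L F k"
  shows "good p q F k"
proof -
  note F = famD[OF f]
  note f' = fam_swap[OF f]
  consider "df p q L 0 1" "df p q L 0 2" | "df p q L 1 0" "df p q L 2 0"
    | j0 j1 where "compl12 j0 j1" "df p q L 0 j0" "\<not> df p q L 0 j1"
        "\<not> (df p q L 1 0 \<and> df p q L 2 0)"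
    | i0 i1 where "compl12 i0 i1" "df p q L i0 0" "\<not> df p q L i1 0"
        "\<not> (df p q L 0 1 \<and> df p q L 0 2)"
    | "\<not> df p q L 1 0" "\<not> df p q L 2 0" "\<not> df p q L 0 1" "\<not> df p q L 0 2"
    by metis
  thus ?thesis
  proof cases
    case 1
    thus ?thesis by (rule good_both_pure[OF f])
  next
    case 2
    thus ?thesis using good_both_pure[OF f'] df_swap[of p q L] good_swap by blast
  next
    case 3
    thus ?thesis by (rule good_one_pure[OF f])
  next
    case 4
    thus ?thesis using good_one_pure[OF f' 4(1)] df_swap[of p q L] good_swap by blast
  next
    case 5
    show ?thesis
    proof (cases "p < q")
      case True
      thus ?thesis using 5 by (intro good_no_pure[OF f]) auto
    next
      case False
      hence "q < p" using F(3) by simp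
      hence "good q p F k" using 5 df_swap[of p q L] by (intro good_no_pure[OF f']) auto
      thus ?thesis by (rule good_swap)
    qed
  qed
qed

text \<open>Spectral pairs without the basis condition: orthogonal characters are independent, so as
  many as points suffice. Neither set has to lie in \<open>{0..<n}\<close>, which allows slices and
  standard sets.\<close>

definition orth :: "nat \<Rightarrow> nat set \<Rightarrow> nat set \<Rightarrow> bool" where
  "orth n S L \<longleftrightarrow> finite S \<and> finite L \<and> card S = card L \<and> card S > 0 \<and>
     (\<forall>l\<in>L. \<forall>l'\<in>L. l \<noteq> l' \<longrightarrow> ft n S (int l - int l') = 0)"

text \<open>Expanding the indicator of a point of \<^term>\<open>S\<close> in the orthogonal characters
  leaves a remainder of norm 0, because there are as many characters as points.\<close>

lemma orth_sym:
  assumes "orth n S L"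
  shows "orth n L S"
proof -
  define k where "k = card S"
  have fin: "finite S" "finite L" and k: "card L = k" "k > 0"
    and o: "\<And>l l'. l \<in> L \<Longrightarrow> l' \<in> L \<Longrightarrow> l \<noteq> l' \<Longrightarrow> ft n S (int l - int l') = 0"
    using assms by (auto simp: orth_def k_def)
  have "ft n L (int s - int s') = 0" if s: "s \<in> S" "s' \<in> S" "s \<noteq> s'" for s s'
  proof -
    define G where "G = (\<lambda>x. \<Sum>l\<in>L. ru n (int l * (int x - int s')))"
    have Gs': "G s' = of_nat k" by (simp add: G_def k)
    have "(\<Sum>x\<in>S. G x * cnj (G x)) = (\<Sum>x\<in>S. \<Sum>l\<in>L. \<Sum>l'\<in>L. ru n ((int l' - int l) * int s') * ru n ((int l - int l') * int x))"
      unfolding G_def cnj_sum sum_product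
      by (intro sum.cong refl) (simp add: ru_minus[symmetric] ru_add[symmetric] algebra_simps)
    also have "\<dots> = (\<Sum>l\<in>L. \<Sum>x\<in>S. \<Sum>l'\<in>L. ru n ((int l' - int l) * int s') * ru n ((int l - int l') * int x))"
      by (rule sum.swap)
    also have "\<dots> = (\<Sum>l\<in>L. \<Sum>l'\<in>L. ru n ((int l' - int l) * int s') * ft n S (int l - int l'))"
      unfolding sum_distrib_left by (rule sum.cong[OF refl], rule sum.swap)
    also have "\<dots> = (\<Sum>l\<in>L. \<Sum>l'\<in>L. if l' = l then of_nat k else 0)"
      using o by (intro sum.cong refl) (auto simp: k_def)
    also have "\<dots> = of_nat k * of_nat k" using fin k by simp
    finally have "(\<Sum>x\<in>S. complex_of_real ((cmod (G x))\<^sup>2)) = of_nat k * of_nat k"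
      by (simp only: complex_norm_square)
    hence "complex_of_real (\<Sum>x\<in>S. (cmod (G x))\<^sup>2) = complex_of_real (real k * real k)" by simp
    hence "(\<Sum>x\<in>S. (cmod (G x))\<^sup>2) = real k * real k" by (simp only: of_real_eq_iff)
    \<comment> \<open>The value at \<open>s'\<close> alone contributes \<open>k^2\<close>, which is
      already the whole sum.\<close>
    moreover have "(\<Sum>x\<in>S. (cmod (G x))\<^sup>2) = (cmod (G s'))\<^sup>2 + (\<Sum>x\<in>S - {s'}. (cmod (G x))\<^sup>2)"
      using fin s by (intro sum.remove)
    moreover have "(cmod (G s'))\<^sup>2 = real k * real k" by (simp add: Gs' power2_eq_square)
    ultimately have "(\<Sum>x\<in>S - {s'}. (cmod (G x))\<^sup>2) = 0" by simp
    hence "\<forall>x\<in>S - {s'}. (cmod (G x))\<^sup>2 = 0" using fin by (subst (asm) sum_nonneg_eq_0_iff) auto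
    hence "G s = 0" using s by simp
    thus ?thesis by (simp add: G_def mult.commute)
  qed
  thus ?thesis using fin k assms by (auto simp: orth_def)
qed

text \<open>The Fourier side of the tiling \<open>S \<oplus> T = Z\<^bsub>n\<^esub>\<close>.\<close>

definition mtile :: "nat \<Rightarrow> nat set \<Rightarrow> nat set \<Rightarrow> bool" where
  "mtile n S T \<longleftrightarrow> finite S \<and> finite T \<and> card S * card T = n \<and>
     (\<forall>d. \<not> int n dvd d \<longrightarrow> ft n S d = 0 \<or> ft n T d = 0)"

section \<open>Common complements and common spectra modulo \<open>p^2 q^2\<close>\<close>

lemma orth_df_zr:
  assumes pq: "prime p" "prime q" "p \<noteq> q" and o: "orth (p^2 * q^2) S L" and d: "df p q L i j"
  shows "zr S (p ^ i * q ^ j)"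
proof -
  have n: "p^2 * q^2 > 0" using pq by (simp add: prime_gt_0_nat)
  from d obtain l l' where l: "l \<in> L" "l' \<in> L" "l \<noteq> l'" "tp p (int l - int l') = i" "tp q (int l - int l') = j"
    unfolding df_def by blast
  hence "ft (p^2 * q^2) S (int l - int l') = 0" using o by (auto simp: orth_def)
  hence "zr S (od (p^2 * q^2) (int l - int l'))" using sum_ru_eq_0_iff_zr[OF n] by blast
  thus ?thesis using od_two_squares[OF pq] l(4,5) by simp
qed

text \<open>The complement is the standard set that fails to vanish exactly at the orders with
  exponents in \<open>insert 0 P\<close> and \<open>insert 0 Q\<close>; these are zeros of all
  members, and \<open>P\<close>, \<open>Q\<close> do not depend on the member.\<close>

theorem common_tiling_complement:
  assumes pq: "prime p" "prime q" "p \<noteq> q" and F: "F \<noteq> {}" and o: "\<And>S. S \<in> F \<Longrightarrow> orth (p^2 * q^2) S L"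
  shows "\<exists>T. \<forall>S\<in>F. mtile (p^2 * q^2) S T"
proof -
  define k where "k = card L"
  have n: "p^2 * q^2 > 0" using pq by (simp add: prime_gt_0_nat)
  have oD: "finite S" "card S = k" "finite L" "k > 0" if "S \<in> F" for S
    using o[OF that] by (auto simp: orth_def k_def)
  have f: "fam p q L F k" unfolding fam_def
    using pq F oD orth_df_zr[OF pq o] orth_df_zr[OF pq orth_sym[OF o]] by (auto simp: k_def)
  from good_if_fam[OF f] obtain P Q where PQ: "P \<subseteq> {1, 2}" "Q \<subseteq> {1, 2}" "k = p ^ card P * q ^ card Q"
    "\<forall>S\<in>F. \<forall>i\<in>insert 0 P. \<forall>j\<in>insert 0 Q. i \<noteq> 0 \<or> j \<noteq> 0 \<longrightarrow> zr S (p ^ i * q ^ j)"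
    unfolding good_def by blast
  \<comment> \<open>A one-exponent standard set is nonzero precisely at its own exponent, so
    singletons are self-complementary while the empty and the full exponent set are
    exchanged.\<close>
  define cm where "cm = (\<lambda>P::nat set. if P = {} then {1, 2} else if P = {1, 2} then {} else P)"
  have cm: "cm P \<subseteq> {1, 2}" "card P + card (cm P) = 2" "\<And>i. i \<le> 2 \<Longrightarrow> nz (cm P) i \<longleftrightarrow> i \<in> insert 0 P"
    if "P \<subseteq> {1, 2}" for P
    using that by (cases rule: subset_12_cases; force simp: cm_def nz_def)+
  define T where "T = std p q (cm P) (cm Q)"
  have sq: "p ^ card P * p ^ card (cm P) = p^2" "q ^ card Q * q ^ card (cm Q) = q^2"
    unfolding power_add[symmetric] cm(2)[OF PQ(1)] cm(2)[OF PQ(2)] by (rule refl)+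
  have "k * card T = (p ^ card P * p ^ card (cm P)) * (q ^ card Q * q ^ card (cm Q))"
    unfolding T_def card_std[OF pq cm(1)[OF PQ(1)] cm(1)[OF PQ(2)]] PQ(3) by (simp only: mult_ac)
  hence cT: "k * card T = p^2 * q^2" by (simp only: sq)
  have "mtile (p^2 * q^2) S T" if S: "S \<in> F" for S unfolding mtile_def
  proof (intro conjI allI impI)
    fix d assume nd: "\<not> int (p^2 * q^2) dvd d"
    define i j where "i = tp p d" and "j = tp q d"
    have ij: "i \<le> 2" "j \<le> 2" "i \<noteq> 0 \<or> j \<noteq> 0"
      using tp_cases[of p d] tp_cases[of q d] nd int_dvd_two_squares_iff[OF pq, of d] by (auto simp: i_def j_def)
    have "zr S (p ^ i * q ^ j) \<or> zr T (p ^ i * q ^ j)"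
      unfolding T_def zr_std[OF pq cm(1)[OF PQ(1)] cm(1)[OF PQ(2)] ij(1,2)]
        cm(3)[OF PQ(1) ij(1)] cm(3)[OF PQ(2) ij(2)] using PQ(4) S ij(3) by blast
    thus "ft (p^2 * q^2) S d = 0 \<or> ft (p^2 * q^2) T d = 0"
      unfolding sum_ru_eq_0_iff_zr[OF n] od_two_squares[OF pq] i_def j_def .
  qed (use oD[OF S] cT in \<open>simp_all add: T_def\<close>)
  thus ?thesis by blast
qed

lemma prime_power_zeros_dvd_card:
  assumes p: "prime p" and S: "finite S" and P: "P \<subseteq> {1, 2}" and z: "\<And>i. i \<in> P \<Longrightarrow> zr S (p ^ i)"
  shows "p ^ card P dvd card S"
  using P
proof (cases rule: subset_12_cases)
  case 2
  thus ?thesis using zr_prime_dvd_card[OF p S, of 1] z[of 1] by simp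
next
  case 3
  thus ?thesis using zr_prime_dvd_card[OF p S, of 2] z[of 2] by simp
next
  case 4
  thus ?thesis using zr_both_sq_dvd_card[OF p S] z[of 1] z[of 2] by (simp add: power2_eq_square)
qed simp

lemma mtile_zr:
  assumes pq: "prime p" "prime q" "p \<noteq> q" and m: "mtile (p^2 * q^2) S T" and ij: "i \<le> 2" "j \<le> 2" "i \<noteq> 0 \<or> j \<noteq> 0"
  shows "zr S (p ^ i * q ^ j) \<or> zr T (p ^ i * q ^ j)"
proof -
  have n: "p^2 * q^2 > 0" using pq by (simp add: prime_gt_0_nat)
  obtain d where t: "tp p d = i" "tp q d = j" using ex_tp_pair[OF pq ij(1,2)] by blast
  have "\<not> int (p^2 * q^2) dvd d" using int_dvd_two_squares_iff[OF pq, of d] t ij(3) by simp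
  hence "zr S (od (p^2 * q^2) d) \<or> zr T (od (p^2 * q^2) d)"
    using m unfolding mtile_def sum_ru_eq_0_iff_zr[OF n] by blast
  thus ?thesis using od_two_squares[OF pq, of d] t by simp
qed

lemma zr_singleton: "\<not> zr {t} d" by (simp add: zr_def)

text \<open>The spectrum is the standard set on the exponents at which \<open>T\<close> has no pure
  zero. There \<open>S\<close> must vanish; that it also vanishes at the mixed orders is (T2),
  obtained by contradiction from the small size of \<open>T\<close>.\<close>

theorem common_spectrum:
  assumes pq: "prime p" "prime q" "p \<noteq> q"
  shows "\<exists>L. \<forall>S. mtile (p^2 * q^2) S T \<longrightarrow> orth (p^2 * q^2) S L"
proof -
  have n: "p^2 * q^2 > 0" and p0: "p > 0" and q0: "q > 0" using pq by (auto simp: prime_gt_0_nat)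
  have p1: "p > 1" and q1: "q > 1" using prime_gt_1_nat pq by auto
  \<comment> \<open>Read off from \<open>T\<close> only, so that one spectrum serves every
    \<open>S\<close> tiled by \<open>T\<close>.\<close>
  define P where "P = {i\<in>{1, 2}. \<not> zr T (p ^ i)}"
  define Q where "Q = {j\<in>{1, 2}. \<not> zr T (q ^ j)}"
  have sub: "P \<subseteq> {1, 2}" "Q \<subseteq> {1, 2}" by (auto simp: P_def Q_def)
  have cc: "card X + card ({1, 2} - X) = 2" if "X \<subseteq> {1, 2::nat}" for X
    using that by (cases rule: subset_12_cases) auto
  have "orth (p^2 * q^2) S (std p q P Q)" if m: "mtile (p^2 * q^2) S T" for S
  proof -
    have fin: "finite S" "finite T" and c: "card S * card T = p^2 * q^2" using m by (auto simp: mtile_def)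
    note D = mtile_zr[OF pq m]
    have zP: "zr S (p ^ i)" if "i \<in> P" for i using D[of i 0] that by (auto simp: P_def)
    have zQ: "zr S (q ^ j)" if "j \<in> Q" for j using D[of 0 j] that by (auto simp: Q_def)
    have tP: "zr T (p ^ i)" if "i \<in> {1, 2} - P" for i using that by (auto simp: P_def)
    have tQ: "zr T (q ^ j)" if "j \<in> {1, 2} - Q" for j using that by (auto simp: Q_def)
    have cop: "coprime (p ^ a) (q ^ b)" for a b using primes_coprime[OF pq] by simp
    have "p ^ card P * q ^ card Q dvd card S"
      using prime_power_zeros_dvd_card[OF pq(1) fin(1) sub(1) zP] prime_power_zeros_dvd_card[OF pq(2) fin(1) sub(2) zQ] cop
      by (intro divides_mult)
    then obtain a where a: "card S = p ^ card P * q ^ card Q * a" by (elim dvdE)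
    have "p ^ card ({1, 2} - P) * q ^ card ({1, 2} - Q) dvd card T"
      using prime_power_zeros_dvd_card[OF pq(1) fin(2) Diff_subset tP] prime_power_zeros_dvd_card[OF pq(2) fin(2) Diff_subset tQ] cop
      by (intro divides_mult)
    then obtain b where b: "card T = p ^ card ({1, 2} - P) * q ^ card ({1, 2} - Q) * b" by (elim dvdE)
    have "card S * card T = (p ^ card P * p ^ card ({1, 2} - P)) * (q ^ card Q * q ^ card ({1, 2} - Q)) * (a * b)"
      unfolding a b by (simp only: mult_ac)
    also have "\<dots> = p^2 * q^2 * (a * b)" unfolding power_add[symmetric] cc[OF sub(1)] cc[OF sub(2)] by (rule refl)
    finally have "p^2 * q^2 * (a * b) = p^2 * q^2 * 1" using c by simp
    \<comment> \<open>The divisors of the two sizes already multiply to \<open>p^2 q^2\<close>, so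
      both sizes are determined exactly; this is (T1).\<close>
    hence "a * b = 1" using n by (metis mult_cancel1 less_irrefl)
    hence cS: "card S = p ^ card P * q ^ card Q" and cT: "card T = p ^ card ({1, 2} - P) * q ^ card ({1, 2} - Q)"
      using a b by simp_all
    \<comment> \<open>Otherwise \<open>T\<close> vanishes at \<open>p^i q^j\<close>. Its size is
      then 1, \<open>q\<close>, \<open>p\<close> or \<open>p q\<close>; in turn the singleton, the
      column bound (twice) and the square pattern with \<open>m = 1\<close> rule this out, as
      \<open>T\<close> vanishes neither at \<open>p^i\<close> nor at \<open>q^j\<close>.\<close>
    have z2: "zr S (p ^ i * q ^ j)" if ij: "i \<in> P" "j \<in> Q" for i j
    proof (rule ccontr)
      assume "\<not> zr S (p ^ i * q ^ j)"
      moreover have ij': "i = 1 \<or> i = 2" "j = 1 \<or> j = 2" using ij by (auto simp: P_def Q_def)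
      ultimately have z: "zr T (p ^ i * q ^ j)" using D[of i j] by auto
      have nz: "\<not> zr T (p ^ i)" "\<not> zr T (q ^ j)" using ij by (auto simp: P_def Q_def)
      have ipos: "i > 0" "j > 0" using ij' by auto
      define i' j' where "i' = 3 - i" and "j' = 3 - j"
      have ii: "compl12 i' i" and jj: "compl12 j' j"
        using ij' by (auto simp: i'_def j'_def)
      have i12: "{1, 2} - {i} = {i'}" "{1, 2} - {j} = {j'}" using ii jj by auto
      have Pc: "P = {1, 2} \<or> P = {i}" using ij(1) sub(1) ij' by auto
      have Qc: "Q = {1, 2} \<or> Q = {j}" using ij(2) sub(2) ij' by auto
      from Pc Qc consider "P = {1, 2}" "Q = {1, 2}" | "P = {1, 2}" "Q = {j}" | "P = {i}" "Q = {1, 2}" | "P = {i}" "Q = {j}"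
        by blast
      thus False
      proof cases
        case 1
        hence "card T = 1" using cT by simp
        then obtain t where "T = {t}" by (auto simp: card_1_singleton_iff)
        thus False using z zr_singleton by simp
      next
        case 2
        hence "card T = q" using cT i12 by simp
        moreover have "zr T (q ^ j')" using 2 i12 by (intro tQ) auto
        ultimately have "zr T (p ^ i) \<or> card T = q^2"
          using zr_mixed_column_bound[OF pq(1) ipos(1) pq(2,3) fin(2) jj _ z] q1 by (auto simp: power2_eq_square)
        thus False using nz \<open>card T = q\<close> q1 by (auto simp: power2_eq_square)
      next
        case 3
        hence "card T = p" using cT i12 by simp
        moreover have "zr T (p ^ i')" using 3 i12 by (intro tP) auto
        moreover have "zr T (q ^ j * p ^ i)" using z by (simp add: mult.commute)
        ultimately have "zr T (q ^ j) \<or> card T = p^2"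
          using zr_mixed_column_bound[OF pq(2) ipos(2) pq(1) pq(3)[symmetric] fin(2) ii] p1 by (auto simp: power2_eq_square)
        thus False using nz \<open>card T = p\<close> p1 by (auto simp: power2_eq_square)
      next
        case 4
        have "card T = p * q * 1" using cT 4 i12 by simp
        moreover have "i' \<in> {1, 2} - P" "j' \<in> {1, 2} - Q" unfolding 4 i12 by simp_all
        hence "zr T (p ^ i')" "zr T (q ^ j')" using tP tQ by blast+
        ultimately show False
          using zr_square_pattern[OF pq fin(2) ii jj _ _ z _ zero_less_one p1 q1] by blast
      qed
    qed
    show ?thesis unfolding orth_def
    proof (intro conjI ballI impI)
      show "card S = card (std p q P Q)" using cS card_std[OF pq sub] by simp
      show "card S > 0" using cS p0 q0 by simp
      fix l l' assume l: "l \<in> std p q P Q" "l' \<in> std p q P Q" "l \<noteq> l'"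
      define i j where "i = tp p (int l - int l')" and "j = tp q (int l - int l')"
      have "i \<in> insert 0 P" "j \<in> insert 0 Q" "i \<noteq> 0 \<or> j \<noteq> 0"
        unfolding i_def j_def using df_std[OF pq sub l(1,2)] l(3) by blast+
      hence "zr S (p ^ i * q ^ j)" using z2 zP zQ by auto
      thus "ft (p^2 * q^2) S (int l - int l') = 0"
        unfolding sum_ru_eq_0_iff_zr[OF n] od_two_squares[OF pq] i_def j_def .
    qed (use fin in auto)
  qed
  thus ?thesis by blast
qed

section \<open>Passage between the Fourier condition and actual tilings\<close>

lemma mtile_sym: "mtile n S T \<Longrightarrow> mtile n T S"
  unfolding mtile_def mult.commute[of "card S"] by blast

text \<open>Fourier inversion counts the pairs with \<open>s + t\<close> congruent to
  \<open>g\<close>: only the zero frequency contributes, and it gives exactly one pair.\<close>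

lemma mtile_unique:
  assumes n: "n > 0" and m: "mtile n S T"
  shows "\<exists>!s. s \<in> S \<and> (\<exists>t\<in>T. [int s + int t = g] (mod int n))"
proof -
  have fin: "finite S" "finite T" and c: "card S * card T = n" using m by (auto simp: mtile_def)
  define A where "A = {st\<in>S \<times> T. int n dvd int (fst st) + int (snd st) - g}"
  have "(\<Sum>v<n. ru n (- (int v * g)) * (ft n S (int v) * ft n T (int v))) =
    (\<Sum>v<n. \<Sum>st\<in>S \<times> T. ru n (int v * (int (fst st) + int (snd st) - g)))"
  proof (intro sum.cong refl)
    fix v
    have "ru n (- (int v * g)) * (ru n (int v * int s) * ru n (int v * int t)) = ru n (int v * (int s + int t - g))" for s t
      unfolding ru_add[symmetric] by (simp add: algebra_simps)
    thus "ru n (- (int v * g)) * (ft n S (int v) * ft n T (int v)) =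
      (\<Sum>st\<in>S \<times> T. ru n (int v * (int (fst st) + int (snd st) - g)))"
      unfolding sum_product unfolding sum_distrib_left sum.cartesian_product by (simp add: case_prod_beta)
  qed
  also have "\<dots> = (\<Sum>st\<in>S \<times> T. \<Sum>v<n. ru n (int v * (int (fst st) + int (snd st) - g)))" by (rule sum.swap)
  also have "\<dots> = (\<Sum>st\<in>S \<times> T. if int n dvd int (fst st) + int (snd st) - g then of_nat n else 0)"
    by (simp add: sum_ru[OF n])
  also have "\<dots> = (\<Sum>st\<in>A. of_nat n)" unfolding A_def using fin by (subst sum.inter_filter) auto
  finally have 1: "(\<Sum>v<n. ru n (- (int v * g)) * (ft n S (int v) * ft n T (int v))) = of_nat (card A) * of_nat n"
    by simp
  have "(\<Sum>v<n. ru n (- (int v * g)) * (ft n S (int v) * ft n T (int v))) =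
    (\<Sum>v<n. if v = 0 then of_nat n else 0)"
  proof (intro sum.cong refl)
    fix v assume v: "v \<in> {..<n}"
    show "ru n (- (int v * g)) * (ft n S (int v) * ft n T (int v)) = (if v = 0 then of_nat n else 0)"
    proof (cases "v = 0")
      case True
      thus ?thesis using c by (simp flip: of_nat_mult)
    next
      case False
      hence "\<not> int n dvd int v" using v by (simp add: nat_dvd_not_less)
      hence "ft n S (int v) = 0 \<or> ft n T (int v) = 0"
        using m by (auto simp: mtile_def)
      thus ?thesis using False by auto
    qed
  qed
  also have "\<dots> = of_nat n" using n by simp
  finally have "(of_nat (card A * n) :: complex) = of_nat n" using 1 by simp
  hence "card A * n = n" by (simp only: of_nat_eq_iff)
  hence "card A = 1" using n by simp
  then obtain st where A: "A = {st}" by (auto simp: card_1_singleton_iff)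
  have mem: "(s, t) \<in> A \<longleftrightarrow> s \<in> S \<and> t \<in> T \<and> [int s + int t = g] (mod int n)" for s t
    by (auto simp: A_def cong_iff_dvd_diff)
  show "\<exists>!s. s \<in> S \<and> (\<exists>t\<in>T. [int s + int t = g] (mod int n))"
  proof (rule ex1I[of _ "fst st"])
    have "(fst st, snd st) \<in> A" using A by simp
    thus "fst st \<in> S \<and> (\<exists>t\<in>T. [int (fst st) + int t = g] (mod int n))" unfolding mem by blast
    fix s assume "s \<in> S \<and> (\<exists>t\<in>T. [int s + int t = g] (mod int n))"
    then obtain t where "(s, t) \<in> A" unfolding mem by blast
    thus "s = fst st" using A by auto
  qed
qed

text \<open>Describing the complement by a predicate permits congruence conditions. Uniqueness of
  \<open>s\<close> is enough, because \<open>t\<close> is reduced and hence determined by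
  \<open>s\<close> and \<open>g\<close>.\<close>

lemma tileI:
  assumes n: "n > 0" and S: "S \<subseteq> {0..<n}"
    and u: "\<And>g. g < n \<Longrightarrow> \<exists>!s. s \<in> S \<and> (\<exists>t<n. X t \<and> [int s + int t = int g] (mod int n))"
  shows "tile n S"
  unfolding tile_def
proof (intro conjI exI[of _ "{t. t < n \<and> X t}"] ballI S)
  show "{t. t < n \<and> X t} \<subseteq> {0..<n}" by auto
  fix g assume g: "g \<in> {0..<n}"
  have eq: "(s + t) mod n = g \<longleftrightarrow> [int s + int t = int g] (mod int n)" for s t
    using g int_cong_residue_iff[of g n "s + t"] by simp
  obtain s where s: "s \<in> S" "\<exists>t<n. X t \<and> [int s + int t = int g] (mod int n)"
    "\<And>s'. s' \<in> S \<Longrightarrow> \<exists>t<n. X t \<and> [int s' + int t = int g] (mod int n) \<Longrightarrow> s' = s"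
    using u[of g] g by (auto elim!: ex1E)
  obtain t where t: "t < n" "X t" "[int s + int t = int g] (mod int n)" using s(2) by blast
  show "\<exists>!(s, t). s \<in> S \<and> t \<in> {t. t < n \<and> X t} \<and> (s + t) mod n = g"
  proof (rule ex1I[of _ "(s, t)"])
    show "case (s, t) of (s, t) \<Rightarrow> s \<in> S \<and> t \<in> {t. t < n \<and> X t} \<and> (s + t) mod n = g"
      using s(1) t by (simp add: eq)
    fix st assume st: "case st of (s, t) \<Rightarrow> s \<in> S \<and> t \<in> {t. t < n \<and> X t} \<and> (s + t) mod n = g"
    obtain s' t' where e: "st = (s', t')" by (cases st)
    have st': "s' \<in> S" "t' < n" "X t'" "[int s' + int t' = int g] (mod int n)" using st by (auto simp: e eq)
    hence "s' = s" using s(3) by blast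
    hence "[int s + int t' = int s + int t] (mod int n)" using st'(4) t(3) cong_trans cong_sym by blast
    hence "[t' = t] (mod n)" by (simp add: cong_add_lcancel cong_int_iff)
    hence "t' = t" using st'(2) t(1) by (simp add: cong_less_modulus_unique_nat)
    thus "st = (s, t)" using e \<open>s' = s\<close> by simp
  qed
qed

text \<open>Uniqueness gives a packing and existence a covering, so the sizes multiply to
  \<open>n\<close> and the extremal case of the packing lemma applies.\<close>

lemma tile_imp_mtile:
  assumes n: "n > 0" and t: "tile n S"
  shows "\<exists>T. T \<subseteq> {0..<n} \<and> mtile n S T"
proof -
  from t obtain T where S: "S \<subseteq> {0..<n}" and T: "T \<subseteq> {0..<n}"
    and u: "\<forall>g\<in>{0..<n}. \<exists>!(s, t). s \<in> S \<and> t \<in> T \<and> (s + t) mod n = g"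
    unfolding tile_def by blast
  have fin: "finite S" "finite T" using S T finite_subset by blast+
  have inj: "x = x' \<and> c = c'" if *: "x \<in> S" "x' \<in> S" "c \<in> T" "c' \<in> T"
      "int n dvd (int x - int x') + (int c - int c')" for x x' c c'
  proof -
    have "[int (x + c) = int (x' + c')] (mod int n)" using *(5) by (simp add: cong_iff_dvd_diff algebra_simps)
    hence e: "(x + c) mod n = (x' + c') mod n" unfolding cong_int_iff by (simp add: cong_def)
    have "\<exists>!(s, t). s \<in> S \<and> t \<in> T \<and> (s + t) mod n = (x + c) mod n" using u n by simp
    then obtain st where st: "\<forall>y. (case y of (s, t) \<Rightarrow> s \<in> S \<and> t \<in> T \<and> (s + t) mod n = (x + c) mod n) \<longrightarrow> y = st"
      by (elim ex1E) blast
    have "(x, c) = st" "(x', c') = st"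
      using *(1-4) e spec[OF st, of "(x, c)"] spec[OF st, of "(x', c')"] by simp_all
    thus ?thesis by auto
  qed
  have "{..<n} \<subseteq> (\<lambda>(s, t). (s + t) mod n) ` (S \<times> T)"
  proof
    fix g assume "g \<in> {..<n}"
    hence "\<exists>!(s, t). s \<in> S \<and> t \<in> T \<and> (s + t) mod n = g" using u by simp
    then obtain st where "case st of (s, t) \<Rightarrow> s \<in> S \<and> t \<in> T \<and> (s + t) mod n = g" by (elim ex1E)
    thus "g \<in> (\<lambda>(s, t). (s + t) mod n) ` (S \<times> T)" by (cases st) auto
  qed
  hence "card {..<n} \<le> card ((\<lambda>(s, t). (s + t) mod n) ` (S \<times> T))" using fin by (intro card_mono) auto
  also have "\<dots> \<le> card (S \<times> T)" using fin by (intro card_image_le) auto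
  finally have "n \<le> card S * card T" by (simp add: card_cartesian_product)
  moreover have "card S * card T \<le> n" by (rule packing(1)[OF n fin inj])
  ultimately have c: "card S * card T = n" by simp
  hence "mtile n S T" unfolding mtile_def using fin packing(2)[OF n fin inj c] by blast
  thus ?thesis using T by blast
qed

section \<open>Slicing along the large prime\<close>

definition slice :: "nat \<Rightarrow> nat set \<Rightarrow> nat \<Rightarrow> nat set" where
  "slice r S j = {x\<in>S. x mod r = j}"

lemma finite_slice [simp]: "finite S \<Longrightarrow> finite (slice r S j)" by (simp add: slice_def)

lemma sum_slices: "finite S \<Longrightarrow> r > 0 \<Longrightarrow> sum f S = (\<Sum>j<r. sum f (slice r S j))"
  unfolding slice_def by (rule sum_mod_classes)

lemma card_slices: "finite S \<Longrightarrow> r > 0 \<Longrightarrow> card S = (\<Sum>j<r. card (slice r S j))"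
  using sum_slices[of S r "\<lambda>_. 1::nat"] by simp

lemma empty_slice:
  assumes "finite S" "card S < r"
  obtains j where "j < r" "slice r S j = {}"
proof -
  have "\<not> {..<r} \<subseteq> (\<lambda>x. x mod r) ` S"
  proof
    assume "{..<r} \<subseteq> (\<lambda>x. x mod r) ` S"
    hence "card {..<r} \<le> card S" using assms(1) by (rule surj_card_le[rotated])
    thus False using assms(2) by simp
  qed
  then obtain j where "j < r" "j \<notin> (\<lambda>x. x mod r) ` S" by auto
  thus ?thesis by (intro that[of j]) (auto simp: slice_def)
qed

lemma ru_diff_cong:
  assumes "n > 0" "[d = d'] (mod int n)"
  shows "ru n (d * a) = ru n (d' * a)"
  using assms by (intro ru_cong cong_mult) auto

locale big_prime =
  fixes M r :: nat
  assumes M: "M > 0" and r: "prime r" and Mr: "M < r"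
begin

lemma r0: "r > 0" using r by (rule prime_gt_0_nat)

lemma N0: "M * r > 0" using M r0 by simp

lemma not_r_dvd_M: "\<not> r dvd M" using M Mr by (simp add: nat_dvd_not_less)

lemma cop: "coprime M r"
  using prime_imp_coprime[OF r not_r_dvd_M] by (simp add: coprime_commute)

lemma N_dvd_iff: "int (M * r) dvd d \<longleftrightarrow> int M dvd d \<and> int r dvd d"
proof -
  have "coprime (int M) (int r)" using cop by simp
  thus ?thesis unfolding of_nat_mult by (meson divides_mult dvd_mult_left dvd_mult_right)
qed

text \<open>A frequency \<open>d = r e\<close> factors through the integers modulo \<open>M\<close>,
  where \<open>r\<close> is a unit; Galois invariance replaces \<open>e\<close> by
  \<open>r e = d\<close> again.\<close>

lemma sum_multiple:
  assumes "int r dvd d"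
  shows "ft (M * r) S d = 0 \<longleftrightarrow> ft M S d = 0"
proof -
  obtain e where e: "d = int r * e" using assms by (elim dvdE)
  have "ru (M * r) (d * int x) = ru M (e * int x)" for x
    using ru_scale[OF r0, of M "e * int x"] by (simp add: e mult_ac)
  moreover have "coprime (int r) (int M)" using cop by (simp add: coprime_commute)
  ultimately show ?thesis
    using galois_vanishing_sum_iff[OF M, of "int r" "\<lambda>_. 1" "\<lambda>x. e * int x" S] by (simp add: e mult.assoc)
qed

text \<open>Bezout splits the character into an \<open>M\<close>-part and a nontrivial
  \<open>r\<close>-part. Resolving the latter equates the sums \<open>G\<close> of all slices, and
  Galois invariance removes the Bezout multiplier \<open>a\<close>.\<close>

lemma sum_nonmultiple:
  assumes d: "\<not> int r dvd d" and S: "finite S"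
  shows "ft (M * r) S d = 0 \<longleftrightarrow>
    (\<forall>j<r. \<forall>j'<r. ft M (slice r S j) d = ft M (slice r S j') d)"
proof -
  obtain a b where ab: "a * int r + b * int M = 1"
    using cop by (metis bezout_int coprime_commute coprime_imp_gcd_eq_1 coprime_int_iff)
  have ca: "coprime a (int M)"
    using ab by (intro coprimeI) (metis dvd_add dvd_mult dvd_mult2)
  have cb: "\<not> int r dvd b * d"
  proof
    assume "int r dvd b * d"
    hence "int r dvd b" using d r by (simp add: prime_dvd_mult_iff)
    hence "int r dvd a * int r + b * int M" by simp
    thus False using ab r by auto
  qed
  have split: "ru (M * r) (d * int x) = ru M (a * (d * int x)) * ru r (b * d * int x)" for x
  proof -
    have "d * int x = (a * int r + b * int M) * (d * int x)" by (simp add: ab)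
    also have "\<dots> = a * (d * int x) * int r + b * d * int x * int M" by (simp add: algebra_simps)
    finally show ?thesis using M r0 ru_combine[of M r "a * (d * int x)" "b * d * int x"] by simp
  qed
  define G where "G = (\<lambda>j. \<Sum>x\<in>slice r S j. ru M (a * (d * int x)))"
  define H where "H = (\<lambda>j. \<Sum>x\<in>slice r S j. ru M (d * int x))"
  have GH: "G j = G j' \<longleftrightarrow> H j = H j'" for j j'
  proof (cases "j = j'")
    case False
    \<comment> \<open>Signs turn the comparison of two slices into one vanishing sum, to which
      Galois invariance applies.\<close>
    define w where "w = (\<lambda>x. if x mod r = j then 1 else (-1) :: int)"
    have disj: "slice r S j \<inter> slice r S j' = {}" using False by (auto simp: slice_def)
    have *: "(\<Sum>x\<in>slice r S j \<union> slice r S j'. of_int (w x) * f x) = sum f (slice r S j) - sum f (slice r S j')"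
      for f :: "nat \<Rightarrow> complex"
    proof -
      have "(\<Sum>x\<in>slice r S j \<union> slice r S j'. of_int (w x) * f x) =
        (\<Sum>x\<in>slice r S j. of_int (w x) * f x) + (\<Sum>x\<in>slice r S j'. of_int (w x) * f x)"
        using S disj by (intro sum.union_disjoint) auto
      also have "(\<Sum>x\<in>slice r S j. of_int (w x) * f x) = sum f (slice r S j)"
        by (intro sum.cong) (auto simp: slice_def w_def)
      also have "(\<Sum>x\<in>slice r S j'. of_int (w x) * f x) = (\<Sum>x\<in>slice r S j'. - f x)"
        using False by (intro sum.cong) (auto simp: slice_def w_def)
      finally show ?thesis by (simp add: sum_negf)
    qed
    show ?thesis
      using galois_vanishing_sum_iff[OF M ca, of w "\<lambda>x. d * int x" "slice r S j \<union> slice r S j'"]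
      unfolding * G_def H_def by simp
  qed simp
  have "ft (M * r) S d = 0 \<longleftrightarrow> (\<forall>j<r. \<forall>j'<r. G j = G j')"
  proof (intro iffI allI impI)
    fix j j' assume z: "ft (M * r) S d = 0" and j: "j < r" "j' < r"
    have "(\<Sum>x\<in>{x\<in>S. [int x = int j] (mod int (r ^ 1))}. of_int 1 * ru M (a * (d * int x))) =
          (\<Sum>x\<in>{x\<in>S. [int x = int j'] (mod int (r ^ 1))}. of_int 1 * ru M (a * (d * int x)))"
    proof (rule vanishing_sum_prime_power[OF r zero_less_one M cop cb S])
      show "(\<Sum>x\<in>S. of_int 1 * (ru M (a * (d * int x)) * ru (r ^ 1) (b * d * int x))) = 0"
        using z by (simp add: split)
    qed simp
    thus "G j = G j'" unfolding power_one_right int_cong_residue_iff[OF j(1)] int_cong_residue_iff[OF j(2)]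
      by (simp add: G_def slice_def)
  next
    assume g: "\<forall>j<r. \<forall>j'<r. G j = G j'"
    have "ft (M * r) S d = (\<Sum>j<r. \<Sum>x\<in>slice r S j. ru (M * r) (d * int x))"
      by (rule sum_slices[OF S r0])
    also have "\<dots> = (\<Sum>j<r ^ 1. G j * ru (r ^ 1) (b * d * int j))"
    proof (intro sum.cong)
      fix j
      have "ft (M * r) (slice r S j) d = (\<Sum>x\<in>slice r S j. ru M (a * (d * int x)) * ru r (b * d * int j))"
        unfolding split
        by (intro sum.cong refl arg_cong2[of _ _ _ _ "(*)"] ru_cong[OF r0] cong_mult)
           (auto simp: slice_def cong_def of_nat_mod)
      thus "ft (M * r) (slice r S j) d = G j * ru (r ^ 1) (b * d * int j)"
        by (simp add: G_def sum_distrib_right)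
    qed simp
    also have "\<dots> = 0"
    proof (rule sum_periodic_ru[OF r zero_less_one cb])
      fix y y' assume "y < r ^ 1" "y' < r ^ 1"
      thus "G y = G y'" using g unfolding power_one_right by blast
    qed
    finally show "ft (M * r) S d = 0" .
  qed
  thus ?thesis unfolding GH H_def .
qed

lemma sum_nonmultiple_small:
  assumes d: "\<not> int r dvd d" and S: "finite S" and small: "card S \<le> M"
    and z: "ft (M * r) S d = 0"
  shows "ft M S d = 0"
proof -
  obtain j0 where j0: "j0 < r" "slice r S j0 = {}" using empty_slice[OF S, of r] small Mr by auto
  have "ft M (slice r S j) d = 0" if "j < r" for j
  proof -
    have "ft M (slice r S j) d = ft M (slice r S j0) d"
      using z that j0(1) unfolding sum_nonmultiple[OF d S] by blast
    thus ?thesis by (simp add: j0(2))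
  qed
  thus ?thesis by (simp add: sum_slices[OF S r0])
qed

lemma orth_small:
  assumes o: "orth (M * r) S L" and small: "card S \<le> M"
  shows "orth M S L"
  unfolding orth_def
proof (intro conjI ballI impI)
  fix l l' assume l: "l \<in> L" "l' \<in> L" "l \<noteq> l'"
  hence z: "ft (M * r) S (int l - int l') = 0" using o by (auto simp: orth_def)
  have S: "finite S" using o by (simp add: orth_def)
  show "ft M S (int l - int l') = 0"
  proof (cases "int r dvd int l - int l'")
    case True
    thus ?thesis using z sum_multiple by blast
  next
    case False
    thus ?thesis using sum_nonmultiple_small[OF _ S small z] by blast
  qed
qed (use o in \<open>auto simp: orth_def\<close>)

lemma distinct_orth:
  assumes "orth n S L" "n > 0" "l \<in> L" "l' \<in> L" "l \<noteq> l'"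
  shows "\<not> int n dvd int l - int l'"
proof
  assume "int n dvd int l - int l'"
  hence "ru n ((int l - int l') * int x) = 1" for x using assms(2) by (simp add: ru_eq_1_iff)
  hence "ft n S (int l - int l') = of_nat (card S)" by simp
  thus False using assms by (auto simp: orth_def)
qed

text \<open>By pigeonhole two elements of \<open>L\<close> agree modulo \<open>M\<close>. Their
  difference is trivial on the \<open>M\<close>-part, so the equal slice sums are the slice
  sizes.\<close>

lemma large_equal_slices:
  assumes o: "orth (M * r) S L" and large: "card S > M"
  shows "\<forall>j<r. \<forall>j'<r. card (slice r S j) = card (slice r S j')"
proof -
  have fin: "finite S" "finite L" "card L = card S" using o by (auto simp: orth_def)
  have "\<not> inj_on (\<lambda>l. l mod M) L"
  proof
    assume "inj_on (\<lambda>l. l mod M) L"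
    hence "card L = card ((\<lambda>l. l mod M) ` L)" by (simp add: card_image)
    also have "\<dots> \<le> card {..<M}" using M by (intro card_mono) auto
    finally show False using large fin by simp
  qed
  then obtain l l' where l: "l \<in> L" "l' \<in> L" "l \<noteq> l'" "l mod M = l' mod M" by (auto simp: inj_on_def)
  have "[int l = int l'] (mod int M)" using l(4) unfolding cong_int_iff by (simp add: cong_def)
  hence Md: "int M dvd int l - int l'" by (simp add: cong_iff_dvd_diff)
  hence nr: "\<not> int r dvd int l - int l'" using distinct_orth[OF o N0 l(1-3)] unfolding N_dvd_iff by blast
  have one: "ru M ((int l - int l') * int x) = 1" for x using M Md by (simp add: ru_eq_1_iff)
  have "ft (M * r) S (int l - int l') = 0" using o l by (auto simp: orth_def)
  thus ?thesis unfolding sum_nonmultiple[OF nr fin(1)] one sum_constant mult_1_right of_nat_eq_iff .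
qed

lemma equal_slices_card:
  assumes "finite S" "\<forall>j<r. \<forall>j'<r. card (slice r S j) = card (slice r S j')" "i < r"
  shows "card S = r * card (slice r S i)"
proof -
  have "card S = (\<Sum>j<r. card (slice r S j))" by (rule card_slices[OF assms(1) r0])
  also have "\<dots> = (\<Sum>j<r. card (slice r S i))" by (intro sum.cong refl) (use assms in blast)
  finally show ?thesis by simp
qed

lemma orth_large:
  assumes o: "orth (M * r) S L" and large: "card S > M"
  shows "\<exists>j<r. \<forall>i<r. orth M (slice r S i) (slice r L j)"
proof -
  have fin: "finite S" "finite L" "card L = card S" using o by (auto simp: orth_def)
  have eS: "\<forall>j<r. \<forall>j'<r. card (slice r S j) = card (slice r S j')" by (rule large_equal_slices[OF o large])
  have eL: "\<forall>j<r. \<forall>j'<r. card (slice r L j) = card (slice r L j')"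
    by (rule large_equal_slices[OF orth_sym[OF o]]) (use fin large in simp)
  \<comment> \<open>Otherwise each of the \<open>r\<close> slices has an element without a partner, and these are distinct modulo \<open>M < r\<close>.\<close>
  have "\<exists>j<r. \<forall>l\<in>slice r L j. \<exists>l''\<in>L. l'' mod M = l mod M \<and> l'' mod r \<noteq> j"
  proof (rule ccontr)
    assume "\<not> ?thesis"
    hence "\<forall>j. \<exists>l. j < r \<longrightarrow> l \<in> slice r L j \<and> (\<forall>l''\<in>L. l'' mod M = l mod M \<longrightarrow> l'' mod r = j)" by blast
    then obtain c where c: "\<And>j. j < r \<Longrightarrow> c j \<in> slice r L j"
      "\<And>j l''. j < r \<Longrightarrow> l'' \<in> L \<Longrightarrow> l'' mod M = c j mod M \<Longrightarrow> l'' mod r = j" by metis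
    have "inj_on (\<lambda>j. c j mod M) {..<r}"
    proof (rule inj_onI)
      fix j j' assume j: "j \<in> {..<r}" "j' \<in> {..<r}" "c j mod M = c j' mod M"
      have "c j \<in> L" "c j mod r = j" using c(1)[of j] j(1) by (auto simp: slice_def)
      thus "j = j'" using c(2)[of j' "c j"] j by simp
    qed
    hence "card {..<r} = card ((\<lambda>j. c j mod M) ` {..<r})" by (simp add: card_image)
    also have "\<dots> \<le> card {..<M}" using M by (intro card_mono) auto
    finally show False using Mr by simp
  qed
  then obtain j where j: "j < r" "\<And>l. l \<in> slice r L j \<Longrightarrow> \<exists>l''\<in>L. l'' mod M = l mod M \<and> l'' mod r \<noteq> j" by blast
  have "orth M (slice r S i) (slice r L j)" if i: "i < r" for i
    unfolding orth_def
  proof (intro conjI ballI impI)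
    have "r * card (slice r S i) = r * card (slice r L j)"
      using equal_slices_card[OF fin(1) eS i] equal_slices_card[OF fin(2) eL j(1)] fin(3) by simp
    thus "card (slice r S i) = card (slice r L j)" using r0 by simp
    show "card (slice r S i) > 0" using equal_slices_card[OF fin(1) eS i] large by (cases "card (slice r S i)") auto
    fix l l' assume l: "l \<in> slice r L j" "l' \<in> slice r L j" "l \<noteq> l'"
    \<comment> \<open>Since \<open>l\<close> and \<open>l'\<close> agree modulo \<open>r\<close>,
      their difference only shows that the slice sums \<open>A\<close> add up to 0. Replacing
      \<open>l\<close> by \<open>l''\<close> keeps the frequency modulo \<open>M\<close> but makes
      it nontrivial modulo \<open>r\<close>, so all \<open>A i\<close> are equal and hence
      0.\<close>
    obtain l'' where l'': "l'' \<in> L" "l'' mod M = l mod M" "l'' mod r \<noteq> j" using j(2)[OF l(1)] by blast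
    have lL: "l \<in> L" "l' \<in> L" "l mod r = j" "l' mod r = j" using l by (auto simp: slice_def)
    define A where "A = (\<lambda>i. \<Sum>x\<in>slice r S i. ru M ((int l - int l') * int x))"
    have "[int l = int l'] (mod int r)" using lL(3,4) unfolding cong_int_iff by (simp add: cong_def)
    hence rd: "int r dvd int l - int l'" by (simp add: cong_iff_dvd_diff)
    have "ft (M * r) S (int l - int l') = 0" using o lL l(3) by (auto simp: orth_def)
    hence "ft M S (int l - int l') = 0" using sum_multiple[OF rd] by blast
    hence sumA: "(\<Sum>i<r. A i) = 0" using sum_slices[OF fin(1) r0, of "\<lambda>x. ru M ((int l - int l') * int x)"] by (simp add: A_def)
    have "\<not> [l'' = l'] (mod r)" using l''(3) lL(4) by (simp add: cong_def)
    hence "\<not> [int l'' = int l'] (mod int r)" unfolding cong_int_iff .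
    hence nr: "\<not> int r dvd int l'' - int l'" by (simp add: cong_iff_dvd_diff)
    hence "l'' \<noteq> l'" by auto
    hence "ft (M * r) S (int l'' - int l') = 0" using o l''(1) lL by (auto simp: orth_def)
    hence eq: "\<forall>i<r. \<forall>i'<r. ft M (slice r S i) (int l'' - int l') = ft M (slice r S i') (int l'' - int l')"
      using sum_nonmultiple[OF nr fin(1)] by blast
    have "[int l'' = int l] (mod int M)" using l''(2) unfolding cong_int_iff by (simp add: cong_def)
    hence "[int l'' - int l' = int l - int l'] (mod int M)" by (intro cong_diff) auto
    hence e: "ru M ((int l'' - int l') * int x) = ru M ((int l - int l') * int x)" for x by (rule ru_diff_cong[OF M])
    have eqA: "\<forall>i<r. \<forall>i'<r. A i = A i'" using eq unfolding e A_def .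
    have "(\<Sum>i'<r. A i') = (\<Sum>i'<r. A i)" by (intro sum.cong refl) (use eqA i in blast)
    hence "of_nat r * A i = 0" using sumA by simp
    thus "ft M (slice r S i) (int l - int l') = 0" using r0 by (simp add: A_def)
  qed (use fin in auto)
  thus ?thesis using j(1) by blast
qed

text \<open>The complement consists of the lifts of \<open>T\<close> modulo \<open>M\<close> that
  satisfy \<open>R\<close>. For a target \<open>g\<close> only the \<open>s\<close> with
  \<open>R (g - s)\<close> compete. \<open>R\<close> true takes all lifts and tiles with the whole
  of \<open>S\<close>; \<open>R\<close> divisibility by \<open>r\<close> takes one lift per residue
  and tiles slice by slice.\<close>

lemma tile_of_mtile_selection:
  assumes S: "S \<subseteq> {0..<M * r}"
    and R: "\<And>a b. [a = b] (mod int (M * r)) \<Longrightarrow> R a \<Longrightarrow> R b"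
    and m: "\<And>g. mtile M {s\<in>S. R (int g - int s)} T"
  shows "tile (M * r) S"
proof (rule tileI[OF N0 S, where X = "\<lambda>t. R (int t) \<and> (\<exists>t0\<in>T. [int t = int t0] (mod int M))"])
  fix g assume "g < M * r"
  from mtile_unique[OF M m[of g], of "int g"] obtain s
    where 1: "s \<in> {s\<in>S. R (int g - int s)} \<and> (\<exists>t\<in>T. [int s + int t = int g] (mod int M))"
    and 2: "\<forall>s'. s' \<in> {s\<in>S. R (int g - int s)} \<and> (\<exists>t\<in>T. [int s' + int t = int g] (mod int M)) \<longrightarrow> s' = s"
    by (rule ex1E)
  have s: "s \<in> S" "R (int g - int s)" "\<exists>t\<in>T. [int s + int t = int g] (mod int M)" using 1 by blast+
  show "\<exists>!s. s \<in> S \<and> (\<exists>t<M * r. (R (int t) \<and> (\<exists>t0\<in>T. [int t = int t0] (mod int M))) \<and> [int s + int t = int g] (mod int (M * r)))"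
  proof (rule ex1I[of _ s])
    obtain t0 where t0: "t0 \<in> T" "[int s + int t0 = int g] (mod int M)" using s(3) by blast
    define t where "t = nat ((int g - int s) mod int (M * r))"
    have t: "int t = (int g - int s) mod int (M * r)" using N0 by (simp add: t_def)
    hence tl: "t < M * r" using N0 by (metis of_nat_0_less_iff of_nat_less_iff pos_mod_bound)
    have tc: "[int t = int g - int s] (mod int (M * r))" unfolding t by (simp add: cong_def)
    hence c: "[int s + int t = int s + (int g - int s)] (mod int (M * r))" by (intro cong_add) auto
    hence c': "[int s + int t = int g] (mod int (M * r))" by simp
    hence "[int s + int t = int g] (mod int M)" by (auto intro: cong_dvd_modulus)
    hence "[int s + int t = int s + int t0] (mod int M)" using t0(2) cong_sym cong_trans by blast
    hence tM: "[int t = int t0] (mod int M)" by (simp add: cong_add_lcancel)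
    have "R (int t)" using R[OF cong_sym[OF tc] s(2)] .
    thus "s \<in> S \<and> (\<exists>t<M * r. (R (int t) \<and> (\<exists>t0\<in>T. [int t = int t0] (mod int M))) \<and> [int s + int t = int g] (mod int (M * r)))"
      using s(1) tl c' t0(1) tM by blast
    fix s' assume "s' \<in> S \<and> (\<exists>t<M * r. (R (int t) \<and> (\<exists>t0\<in>T. [int t = int t0] (mod int M))) \<and> [int s' + int t = int g] (mod int (M * r)))"
    then obtain t' t0' where *: "s' \<in> S" "t0' \<in> T" "[int t' = int t0'] (mod int M)" "[int s' + int t' = int g] (mod int (M * r))"
      "R (int t')" by blast
    have "[int s' + int t' = int g] (mod int M)" using *(4) by (auto intro: cong_dvd_modulus)
    moreover have "[int s' + int t0' = int s' + int t'] (mod int M)" using *(3) by (intro cong_add) (auto intro: cong_sym)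
    ultimately have 3: "[int s' + int t0' = int g] (mod int M)" using cong_trans by blast
    have "[int t' = int g - int s'] (mod int (M * r))" using *(4) by (simp add: cong_iff_dvd_diff algebra_simps)
    hence "R (int g - int s')" using R *(5) by blast
    thus "s' = s" using 2 *(1,2) 3 by blast
  qed
qed

lemma tile_of_mtile:
  assumes S: "S \<subseteq> {0..<M * r}" and m: "mtile M S T"
  shows "tile (M * r) S"
  by (rule tile_of_mtile_selection[OF S, where R = "\<lambda>_. True" and T = T]) (use m in simp_all)

lemma tile_of_mtile_slices:
  assumes S: "S \<subseteq> {0..<M * r}" and m: "\<And>i. i < r \<Longrightarrow> mtile M (slice r S i) T"
  shows "tile (M * r) S"
proof (rule tile_of_mtile_selection[OF S, where R = "\<lambda>d. int r dvd d" and T = T])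
  show "int r dvd b" if "[a = b] (mod int (M * r))" "int r dvd a" for a b
  proof -
    have "[a = b] (mod int r)" using that(1) by (auto intro: cong_dvd_modulus)
    thus ?thesis using that(2) cong_dvd_iff by blast
  qed
  fix g
  have "x mod r = g mod r \<longleftrightarrow> int r dvd int g - int x" for x
  proof -
    have "x mod r = g mod r \<longleftrightarrow> [g = x] (mod r)" by (auto simp: cong_def)
    also have "\<dots> \<longleftrightarrow> [int g = int x] (mod int r)" unfolding cong_int_iff ..
    finally show ?thesis by (simp add: cong_iff_dvd_diff)
  qed
  hence "slice r S (g mod r) = {s\<in>S. int r dvd int g - int s}" by (simp add: slice_def)
  thus "mtile M {s\<in>S. int r dvd int g - int s} T" using m[of "g mod r"] r0 by simp
qed

end

section \<open>Spectral pairs as orthogonal sets of equal size\<close>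

lemma zchar_ru: "zchar n l x = ru n (int l * int x)"
  unfolding zchar_def ru_def cis_conv_exp by (simp add: field_simps)

lemma inner_on_zchar:
  "inner_on S (zchar n l) (zchar n l') = ft n S (int l - int l')"
  unfolding inner_on_def zchar_ru ru_minus[symmetric] ru_add[symmetric]
  by (simp add: algebra_simps)

text \<open>Only \<open>card S = card L\<close> needs an argument. Expanding the indicator of a
  point \<open>s\<close> and pairing with the character \<open>m\<close> shows that each term
  \<open>c m * zchar n m s\<close> equals \<open>1 / card S\<close>, while these terms add up to
  1.\<close>

lemma spectral_pair_imp_orth:
  assumes sp: "spectral_pair n S L" and S: "S \<noteq> {}"
  shows "orth n S L"
proof -
  have fin: "finite S" "finite L" using sp finite_subset unfolding spectral_pair_def by blast+
  have o: "ft n S (int l - int l') = 0" if "l \<in> L" "l' \<in> L" "l \<noteq> l'" for l l'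
    using sp that unfolding spectral_pair_def inner_on_zchar by blast
  obtain s where s: "s \<in> S" using S by blast
  have "\<forall>f :: nat \<Rightarrow> complex. \<exists>c :: nat \<Rightarrow> complex. \<forall>x\<in>S. f x = (\<Sum>l\<in>L. c l * zchar n l x)"
    using sp unfolding spectral_pair_def by blast
  from spec[OF this, of "\<lambda>x. if x = s then 1 else 0"]
  obtain c where c: "\<forall>x\<in>S. (if x = s then 1 else 0) = (\<Sum>l\<in>L. c l * zchar n l x)" by blast
  have cm: "c m * zchar n m s * of_nat (card S) = 1" if m: "m \<in> L" for m
  proof -
    have "cnj (zchar n m s) = (\<Sum>x\<in>S. if x = s then cnj (zchar n m x) else 0)" using fin s by simp
    also have "\<dots> = (\<Sum>x\<in>S. (\<Sum>l\<in>L. c l * zchar n l x) * cnj (zchar n m x))"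
    proof (intro sum.cong refl)
      fix x assume "x \<in> S"
      hence "(\<Sum>l\<in>L. c l * zchar n l x) = (if x = s then 1 else 0)" using c by simp
      thus "(if x = s then cnj (zchar n m x) else 0) = (\<Sum>l\<in>L. c l * zchar n l x) * cnj (zchar n m x)" by simp
    qed
    also have "\<dots> = (\<Sum>x\<in>S. \<Sum>l\<in>L. c l * (zchar n l x * cnj (zchar n m x)))"
      by (simp add: sum_distrib_right mult.assoc)
    also have "\<dots> = (\<Sum>l\<in>L. c l * inner_on S (zchar n l) (zchar n m))"
      unfolding inner_on_def sum_distrib_left by (rule sum.swap)
    also have "\<dots> = (\<Sum>l\<in>L. if l = m then c m * of_nat (card S) else 0)"
      using o m by (intro sum.cong refl) (auto simp: inner_on_zchar)
    also have "\<dots> = c m * of_nat (card S)" using fin m by simp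
    finally have "cnj (zchar n m s) * zchar n m s = c m * zchar n m s * of_nat (card S)" by (simp add: mult_ac)
    moreover have "cnj (zchar n m s) * zchar n m s = 1"
      unfolding zchar_ru ru_minus[symmetric] ru_add[symmetric] by simp
    ultimately show ?thesis by simp
  qed
  have "of_nat (card S) = (\<Sum>l\<in>L. c l * zchar n l s) * of_nat (card S)" using c s by auto
  also have "\<dots> = (\<Sum>l\<in>L. c l * zchar n l s * of_nat (card S))" by (simp add: sum_distrib_right)
  also have "\<dots> = of_nat (card L)" using cm by simp
  finally have "card S = card L" by (simp only: of_nat_eq_iff)
  thus ?thesis using fin o S by (auto simp: orth_def card_gt_0_iff)
qed

lemma orth_imp_spectral_pair:
  assumes sub: "S \<subseteq> {0..<n}" "L \<subseteq> {0..<n}" and o: "orth n S L"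
  shows "spectral_pair n S L"
  unfolding spectral_pair_def
proof (intro conjI allI sub)
  show "\<forall>l1\<in>L. \<forall>l2\<in>L. l1 \<noteq> l2 \<longrightarrow> inner_on S (zchar n l1) (zchar n l2) = 0"
    unfolding inner_on_zchar using o by (simp add: orth_def)
  fix f :: "nat \<Rightarrow> complex"
  have fin: "finite S" "finite L" and k: "card L = card S" "card S > 0" using o by (auto simp: orth_def)
  define c where "c = (\<lambda>l. (\<Sum>s\<in>S. f s * ru n (- (int l * int s))) / of_nat (card S))"
  show "\<exists>c. \<forall>x\<in>S. f x = (\<Sum>l\<in>L. c l * zchar n l x)"
  proof (intro exI[of _ c] ballI)
    fix x assume x: "x \<in> S"
    have "(\<Sum>l\<in>L. c l * zchar n l x) * of_nat (card S) = (\<Sum>l\<in>L. \<Sum>s\<in>S. f s * ru n ((int x - int s) * int l))"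
      unfolding sum_distrib_right
    proof (intro sum.cong refl)
      fix l
      have e: "ru n (- (int l * int s)) * ru n (int l * int x) = ru n ((int x - int s) * int l)" for s
        unfolding ru_add[symmetric] by (simp add: algebra_simps)
      have "c l * zchar n l x * of_nat (card S) = (\<Sum>s\<in>S. f s * ru n (- (int l * int s))) * ru n (int l * int x)"
        using k by (simp add: c_def zchar_ru)
      also have "\<dots> = (\<Sum>s\<in>S. f s * ru n ((int x - int s) * int l))"
        unfolding sum_distrib_right mult.assoc e ..
      finally show "c l * zchar n l x * of_nat (card S) = (\<Sum>s\<in>S. f s * ru n ((int x - int s) * int l))" .
    qed
    also have "\<dots> = (\<Sum>s\<in>S. f s * ft n L (int x - int s))"
      unfolding sum_distrib_left by (rule sum.swap)
    also have "\<dots> = (\<Sum>s\<in>S. if s = x then f x * of_nat (card S) else 0)"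
      using orth_sym[OF o] x by (intro sum.cong refl) (auto simp: orth_def)
    also have "\<dots> = f x * of_nat (card S)" using fin x by simp
    finally show "f x = (\<Sum>l\<in>L. c l * zchar n l x)" using k by simp
  qed
qed

section \<open>Lifting tilings and spectra between the moduli \<open>M\<close> and
  \<open>M r\<close>\<close>

context big_prime
begin

text \<open>A frequency \<open>d\<close> modulo \<open>M\<close> has lifts divisible and not
  divisible by \<open>r\<close>. If \<open>S\<close> does not vanish at \<open>d\<close> modulo
  \<open>M\<close>, it vanishes at no lift, so \<open>T\<close> does: one lift makes the slice sums
  of \<open>T\<close> equal, the other makes their total 0.\<close>

lemma mtile_small_side:
  assumes m: "mtile (M * r) S T" and small: "card S \<le> M" and j: "j < r"
  shows "mtile M S (slice r T j)"
proof -
  have fin: "finite S" "finite T" and c: "card S * card T = M * r"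
    and z: "\<And>d. \<not> int (M * r) dvd d \<Longrightarrow> ft (M * r) S d = 0 \<or> ft (M * r) T d = 0"
    using m by (auto simp: mtile_def)
  have S0: "card S > 0" using c N0 by (metis gr0I mult_0 less_irrefl)
  have nrM: "\<not> int r dvd int M" using not_r_dvd_M by simp
  have oneM: "ru M (int M * int x) = 1" for x using M by (simp add: ru_eq_1_iff)
  \<comment> \<open>The frequency \<open>M\<close> is trivial modulo \<open>M\<close>, so its slice
    sums are sizes; \<open>S\<close> cannot vanish there, and the zero of \<open>T\<close> makes its
    slices equally large.\<close>
  have "\<not> int (M * r) dvd int M" using nrM unfolding N_dvd_iff by blast
  from z[OF this] have "ft (M * r) T (int M) = 0"
  proof
    assume "ft (M * r) S (int M) = 0"
    hence "ft M S (int M) = 0" by (rule sum_nonmultiple_small[OF nrM fin(1) small])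
    hence False using S0 by (simp add: oneM)
    thus ?thesis ..
  qed
  hence eq: "\<forall>j<r. \<forall>j'<r. card (slice r T j) = card (slice r T j')"
    unfolding sum_nonmultiple[OF nrM fin(2)] oneM sum_constant mult_1_right of_nat_eq_iff .
  have "r * (card S * card (slice r T j)) = r * M"
    using equal_slices_card[OF fin(2) eq j] c by (simp add: mult_ac)
  hence cT: "card S * card (slice r T j) = M" using r0 by simp
  have "ft M S d = 0 \<or> ft M (slice r T j) d = 0" if d: "\<not> int M dvd d" for d
  proof (rule disjCI)
    assume nT: "ft M (slice r T j) d \<noteq> 0"
    have copi: "coprime (int M) (int r)" using cop by simp
    obtain d0 where d0: "[d0 = d] (mod int M)" "[d0 = 0] (mod int r)" using binary_chinese_remainder_int[OF copi] by blast
    obtain d1 where d1: "[d1 = d] (mod int M)" "[d1 = 1] (mod int r)" using binary_chinese_remainder_int[OF copi] by blast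
    have rd0: "int r dvd d0" using d0(2) by (simp add: cong_0_iff)
    have rd1: "\<not> int r dvd d1"
    proof
      assume "int r dvd d1"
      hence "int r dvd 1" using cong_dvd_iff[OF d1(2)] by blast
      thus False using r by auto
    qed
    have Md: "\<not> int (M * r) dvd d0" "\<not> int (M * r) dvd d1"
      unfolding N_dvd_iff using d cong_dvd_iff[OF d0(1)] cong_dvd_iff[OF d1(1)] by blast+
    note e0 = ru_diff_cong[OF M d0(1)] and e1 = ru_diff_cong[OF M d1(1)]
    show "ft M S d = 0"
    proof (rule ccontr)
      assume nS: "ft M S d \<noteq> 0"
      define A where "A = (\<lambda>j. \<Sum>x\<in>slice r T j. ru M (d * int x))"
      have "ft (M * r) S d1 \<noteq> 0"
        using sum_nonmultiple_small[OF rd1 fin(1) small] nS unfolding e1 by blast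
      hence "ft (M * r) T d1 = 0" using z[OF Md(2)] by blast
      hence all: "\<forall>j<r. \<forall>j'<r. A j = A j'" unfolding sum_nonmultiple[OF rd1 fin(2)] e1 A_def .
      have "ft (M * r) S d0 \<noteq> 0"
        using nS unfolding sum_multiple[OF rd0] e0 .
      hence "ft (M * r) T d0 = 0" using z[OF Md(1)] by blast
      hence "ft M T d = 0" unfolding sum_multiple[OF rd0] e0 .
      moreover have "ft M T d = (\<Sum>j'<r. A j')"
        unfolding A_def by (rule sum_slices[OF fin(2) r0])
      moreover have "(\<Sum>j'<r. A j') = (\<Sum>j'<r. A j)"
        by (intro sum.cong refl) (use all j in blast)
      ultimately have "of_nat r * A j = 0" by simp
      thus False using nT r0 by (simp add: A_def)
    qed
  qed
  thus ?thesis unfolding mtile_def using fin cT finite_slice by blast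
qed

text \<open>Multiplication by \<open>r\<close> lifts characters modulo \<open>M\<close> to
  characters modulo \<open>M r\<close> with the same values.\<close>

lemma spectral_of_orth_small:
  assumes S: "S \<subseteq> {0..<M * r}" and o: "orth M S L"
  shows "spectral (M * r) S"
proof -
  define g where "g = (\<lambda>l. (r * l) mod (M * r))"
  have diff: "ru (M * r) ((int (g l) - int (g l')) * a) = ru M ((int l - int l') * a)" for l l' a
  proof -
    have "[int (g l) = int (r * l)] (mod int (M * r))" for l
      by (simp only: cong_int_iff) (simp add: g_def cong_def)
    hence "[int (g l) - int (g l') = int (r * l) - int (r * l')] (mod int (M * r))" by (intro cong_diff)
    hence "ru (M * r) ((int (g l) - int (g l')) * a) = ru (M * r) ((int (r * l) - int (r * l')) * a)"
      by (rule ru_diff_cong[OF N0])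
    also have "\<dots> = ru (r * M) (int r * ((int l - int l') * a))"
      by (simp add: algebra_simps)
    also have "\<dots> = ru M ((int l - int l') * a)" by (rule ru_scale[OF r0])
    finally show ?thesis .
  qed
  have inj: "inj_on g L"
  proof (rule inj_onI, rule ccontr)
    fix l l' assume l: "l \<in> L" "l' \<in> L" "g l = g l'" "l \<noteq> l'"
    have "ru M ((int l - int l') * 1) = 1" using diff[of l l' 1] l(3) by simp
    hence "int M dvd int l - int l'" using ru_eq_1_iff[OF M] by simp
    thus False using distinct_orth[OF o M l(1,2,4)] by blast
  qed
  have "orth (M * r) S (g ` L)" unfolding orth_def
  proof (intro conjI ballI impI)
    show "card S = card (g ` L)" using o inj by (simp add: card_image orth_def)
    fix m m' assume "m \<in> g ` L" "m' \<in> g ` L" "m \<noteq> m'"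
    then obtain l l' where l: "l \<in> L" "l' \<in> L" "m = g l" "m' = g l'" "l \<noteq> l'" by auto
    thus "ft (M * r) S (int m - int m') = 0"
      using o unfolding l(3,4) diff by (simp add: orth_def)
  qed (use o in \<open>auto simp: orth_def\<close>)
  moreover have "g ` L \<subseteq> {0..<M * r}" using N0 by (auto simp: g_def)
  ultimately have "spectral_pair (M * r) S (g ` L)" using S by (intro orth_imp_spectral_pair)
  moreover have "S \<noteq> {}" using o by (auto simp: orth_def)
  ultimately show ?thesis using S by (auto simp: spectral_def)
qed

text \<open>The spectrum \<open>K\<close> consists of all lifts of \<open>L\<close>. Two lifts of
  one element differ by a frequency trivial modulo \<open>M\<close>, where equal slice sizes
  suffice; for other pairs every slice sum vanishes, which settles both kinds of frequency.\<close>

lemma spectral_of_orth_slices: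
  assumes S: "S \<subseteq> {0..<M * r}" and o: "\<And>j. j < r \<Longrightarrow> orth M (slice r S j) L"
  shows "spectral (M * r) S"
proof -
  have finS: "finite S" using S finite_subset by blast
  define X where "X = (\<lambda>c. {y. y < r * M \<and> y mod M = c})"
  define K where "K = (\<Union>l\<in>L. X (l mod M))"
  have finL: "finite L" using o[OF r0] by (simp add: orth_def)
  have cL: "card (slice r S j) = card L" "card L > 0" if "j < r" for j
    using o[OF that] by (auto simp: orth_def)
  have inj: "l = l'" if "l \<in> L" "l' \<in> L" "l mod M = l' mod M" for l l'
  proof (rule ccontr)
    assume "l \<noteq> l'"
    have "[int l = int l'] (mod int M)" using that(3) unfolding cong_int_iff by (simp add: cong_def)
    thus False using distinct_orth[OF o[OF r0] M that(1,2) \<open>l \<noteq> l'\<close>] by (simp add: cong_iff_dvd_diff)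
  qed
  have "card K = (\<Sum>l\<in>L. card (X (l mod M)))" unfolding K_def
  proof (rule card_UN_disjoint[OF finL])
    show "\<forall>i\<in>L. \<forall>j\<in>L. i \<noteq> j \<longrightarrow> X (i mod M) \<inter> X (j mod M) = {}" using inj by (auto simp: X_def)
  qed (auto simp: X_def r0)
  also have "\<dots> = (\<Sum>l\<in>L. r)" using M by (intro sum.cong refl) (simp add: X_def card_residue_class)
  finally have cK: "card K = card L * r" by simp
  have cS: "card S = card L * r" using card_slices[OF finS r0] cL by simp
  have Ksub: "K \<subseteq> {0..<M * r}" by (auto simp: K_def X_def mult.commute)
  have finK: "finite K" using Ksub finite_subset by blast
  have "orth (M * r) S K" unfolding orth_def
  proof (intro conjI ballI impI)
    show "card S = card K" using cS cK by simp
    show "card S > 0" using cS cL(2)[OF r0] r0 by simp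
    fix m m' assume mm: "m \<in> K" "m' \<in> K" "m \<noteq> m'"
    then obtain l l' where l: "l \<in> L" "l' \<in> L" "m mod M = l mod M" "m' mod M = l' mod M"
      by (auto simp: K_def X_def)
    define d where "d = int m - int m'"
    have "[int m = int l] (mod int M)" "[int m' = int l'] (mod int M)"
      using l(3,4) unfolding cong_int_iff by (simp_all add: cong_def)
    hence cd: "[d = int l - int l'] (mod int M)" unfolding d_def by (intro cong_diff)
    note e = ru_diff_cong[OF M cd]
    show "ft (M * r) S (int m - int m') = 0"
    proof (cases "l = l'")
      case True
      hence Md: "int M dvd d" using cd by (simp add: cong_0_iff)
      have "m < M * r" "m' < M * r" using mm Ksub by auto
      hence "\<not> [m = m'] (mod M * r)" using mm(3) cong_less_modulus_unique_nat by blast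
      hence "\<not> int (M * r) dvd d" unfolding d_def cong_iff_dvd_diff[symmetric] cong_int_iff .
      hence nr: "\<not> int r dvd d" using Md unfolding N_dvd_iff by blast
      have one: "ru M (d * int x) = 1" for x using M Md by (simp add: ru_eq_1_iff)
      have "ft (M * r) S d = 0"
        unfolding sum_nonmultiple[OF nr finS] one sum_constant mult_1_right of_nat_eq_iff using cL by simp
      thus ?thesis by (simp add: d_def)
    next
      case False
      have zero: "ft M (slice r S j) d = 0" if "j < r" for j
        unfolding e using o[OF that] l(1,2) False by (simp add: orth_def)
      have "ft (M * r) S d = 0"
      proof (cases "int r dvd d")
        case True
        have "ft M S d = 0" using zero by (simp add: sum_slices[OF finS r0])
        thus ?thesis using sum_multiple[OF True] by blast
      next
        case False
        thus ?thesis unfolding sum_nonmultiple[OF False finS] using zero by simp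
      qed
      thus ?thesis by (simp add: d_def)
    qed
  qed (use finS finK in auto)
  hence "spectral_pair (M * r) S K" using S Ksub by (intro orth_imp_spectral_pair)
  moreover have "S \<noteq> {}" using cS cL(2)[OF r0] r0 by auto
  ultimately show ?thesis using S by (auto simp: spectral_def)
qed

end

theorem theorem1p1:
  fixes p q r :: nat
  assumes "prime p" "prime q" "prime r"
    and "p \<noteq> q" "p \<noteq> r" "q \<noteq> r"
    and "p^2 * q^2 < r"
  shows "(\<forall>S. spectral (p^2 * q^2 * r) S \<longrightarrow> tile (p^2 * q^2 * r) S)
         \<and> fuglede_cyclic (p^2 * q^2 * r)"
proof -
  note pq = assms(1,2,4)
  define M where "M = p^2 * q^2"
  interpret big_prime M r
  proof
    show "M > 0" using assms(1,2) by (simp add: M_def prime_gt_0_nat)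
    show "prime r" "M < r" using assms(3,7) by (simp_all add: M_def)
  qed
  have st: "tile (M * r) S" if sp: "spectral (M * r) S" for S
  proof -
    from sp obtain L where S: "S \<subseteq> {0..<M * r}" "S \<noteq> {}" and L: "spectral_pair (M * r) S L"
      unfolding spectral_def by blast
    have o: "orth (M * r) S L" by (rule spectral_pair_imp_orth[OF L S(2)])
    show ?thesis
    proof (cases "card S \<le> M")
      case True
      have "orth M S L" by (rule orth_small[OF o True])
      then obtain T where "mtile M S T"
        using common_tiling_complement[OF pq, of "{S}" L] unfolding M_def by blast
      thus ?thesis by (rule tile_of_mtile[OF S(1)])
    next
      case False
      then obtain j where "\<forall>i<r. orth M (slice r S i) (slice r L j)" using orth_large[OF o] by auto
      then obtain T where T: "\<forall>S'\<in>slice r S ` {..<r}. mtile M S' T"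
        using common_tiling_complement[OF pq, of "slice r S ` {..<r}" "slice r L j"] r0 unfolding M_def by blast
      show ?thesis by (rule tile_of_mtile_slices[OF S(1), of T]) (use T in simp)
    qed
  qed
  moreover have "spectral (M * r) S" if t: "tile (M * r) S" for S
  proof -
    have S: "S \<subseteq> {0..<M * r}" using t unfolding tile_def by blast
    obtain T where m: "mtile (M * r) S T" using tile_imp_mtile[OF N0 t] by blast
    have c: "card S * card T = M * r" using m by (simp add: mtile_def)
    have small: "card X \<le> M" if "card X dvd M * r" "\<not> r dvd card X" for X :: "nat set"
    proof -
      have "coprime (card X) r" using prime_imp_coprime[OF r that(2)] by (simp add: coprime_commute)
      hence "card X dvd M" using that(1) by (simp add: coprime_dvd_mult_left_iff)
      thus ?thesis using M by (simp add: dvd_imp_le)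
    qed
    have "\<not> (r dvd card S \<and> r dvd card T)"
    proof
      assume "r dvd card S \<and> r dvd card T"
      hence "r * r dvd M * r" unfolding c[symmetric] by (intro mult_dvd_mono) auto
      thus False using not_r_dvd_M r0 by simp
    qed
    then consider "\<not> r dvd card S" | "\<not> r dvd card T" by blast
    thus ?thesis
    proof cases
      case 1
      have "card S \<le> M" by (rule small[OF _ 1]) (simp flip: c)
      hence "mtile M S (slice r T 0)" by (rule mtile_small_side[OF m _ r0])
      then obtain L where "orth M S L" using common_spectrum[OF pq, of "slice r T 0"] unfolding M_def by blast
      thus ?thesis by (rule spectral_of_orth_small[OF S])
    next
      case 2
      have "card T \<le> M" by (rule small[OF _ 2]) (simp flip: c)
      hence "mtile M (slice r S j) T" if "j < r" for j
        using mtile_small_side[OF mtile_sym[OF m] _ that] mtile_sym by blast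
      moreover obtain L where "\<forall>S. mtile M S T \<longrightarrow> orth M S L"
        using common_spectrum[OF pq, of T] unfolding M_def by blast
      ultimately show ?thesis by (intro spectral_of_orth_slices[OF S, of L]) blast
    qed
  qed
  ultimately show ?thesis unfolding fuglede_cyclic_def M_def by blast
qed

end
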